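(* Let $(\mathcal X,d,\mu)$ be a doubling metric measure space with doubling exponent $n>0$ (see context). Let $s\in(0,\infty)$ and $p,q\in(0,\infty]$; in (i)--(iv), $\sigma$ is always a finite positive number. Then, with equality of spaces meaning two-sided inclusion with comparable (quasi-semi)norms: (i) If $\sigma\in(0,p]$, then $\dot B^s_{p,q}(\mathcal X)=\vec C^{s,\sigma}\dot B_{p,q}(\mathcal X)$. (ii) If $\sigma\in(0,p_\ast(s))$, then $\dot B^s_{p,q}(\mathcal X)=\vec I^{s,\sigma}\dot B_{p,q}(\mathcal X)$. (iii) If $\epsilon\in[0,s)$ and $\sigma\in(0,p_\ast(s))$, then $\dot B^s_{p,q}(\mathcal X)=\vec S^{s,\epsilon,\sigma}\dot B_{p,q}(\mathcal X)$. (iv) If $p\in(n/(n+s),\infty]$ and $\sigma\in(0,p_\ast(s))$, then $\dot B^s_{p,q}(\mathcal X)=\vec A^{s,\sigma}\dot B_{p,q}(\mathcal X)$. Moreover, the ranges of $\epsilon$ and $\sigma$ are optimal in the following sense, where $\mathbb R^n$ ($n\ge 1$ an integer) carries the Euclidean distance and Lebesgue measure: (v) Let $s\in(0,1)$, $p\in(0,n/s)$ and $\sigma>p_\ast(s)$. Then there exists a function $u$ such that for all $q\in(0,\infty]$, $u\in\dot B^s_{p,q}(\mathbb R^n)$ but $u\notin L^\sigma_{\rm loc}(\mathbb R^n)$, and hence, for $\vec E=\vec A^{s,\sigma}$, $\vec I^{s,\sigma}$ or $\vec S^{s,\epsilon,\sigma}$, $u\notin\vec E\dot B_{p,q}(\mathbb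 R^n)$. (vi) Let $p\in(0,\infty)$, $\sigma\in(p,\infty)$ and $s\in(0,n/p-n/\sigma)\cap(0,1)$. Then there exists a function $u$ such that for all $q\in(0,\infty]$, $u\in\dot B^s_{p,q}(\mathbb R^n)$ but $u\notin\vec C^{s,\sigma}\dot B_{p,q}(\mathbb R^n)$. (vii) Let $s\in(0,1)$ and $p\in(0,\infty)$. Then there exists a function $u\in\dot B^s_{p,p}(\mathbb R^n)$ with $u\notin\vec S^{s,s,p}\dot B_{p,p}(\mathbb R^n)$.
   Context: Setting: $(\mathcal X,d)$ is a metric space and $\mu$ a regular Borel measure on $\mathcal X$ such that all balls have finite and positive measure, and $\mu$ is doubling: there exist constants $C_1>1$ and $n>0$ (fixed; $n$ is called the doubling exponent here) such that $\mu(B(x,\lambda r))\le C_1\lambda^n\mu(B(x,r))$ for all $x\in\mathcal X$, $r\in(0,\infty)$, $\lambda\in(1,\infty)$. For $\mathbb R^n$ the exponent is the dimension $n$. Functions are real-valued. $\frac{1}{\mu(E)}\int_E f\,d\mu$ is denoted $⨍_E f\,d\mu$, and $u_B=⨍_B u\,d\mu$. $u\in L^\sigma_{\rm loc}(\mathcal X)$ means $u\in L^\sigma(B)$ for each ball $B$. For $s\in(0,\infty)$, $p\in(0,\infty]$: $p_\ast(s)=np/(n-ps)$ if $p<n/s$, and $p_\ast(s)=\infty$ if $p\ge n/s$. Besov space: $\dot B^s_{p,q}(\mathcal X)$ is the collection of all $u\in L^p_{\rm loc}(\mathcal X)$ with $$\|u\|_{\dot B^s_{p,q}(\mathcal X)}=\Big(\int_0^\infty\Big(\int_{\mathcal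 X}⨍_{B(x,t)}|u(x)-u(y)|^p\,d\mu(y)\,d\mu(x)\Big)^{q/p}\frac{dt}{t^{1+sq}}\Big)^{1/q}<\infty,$$ with the usual modification (essential suprema; for $q=\infty$, supremum over $t$ of $t^{-s}$ times the inner quantity) when $p=\infty$ or $q=\infty$. For $s,\sigma\in(0,\infty)$, $\epsilon\in[0,s]$, $x\in\mathcal X$, $t\in(0,\infty)$ set $\vec C^{s,\sigma}(u)(x,t)=t^{-s}\big(⨍_{B(x,t)}|u(x)-u(y)|^\sigma d\mu(y)\big)^{1/\sigma}$, $\vec A^{s,\sigma}(u)(x,t)=t^{-s}\big(⨍_{B(x,t)}|u(y)-u_{B(x,t)}|^\sigma d\mu(y)\big)^{1/\sigma}$, $\vec I^{s,\sigma}(u)(x,t)=t^{-s}\big(\inf_{c\in\mathbb R}⨍_{B(x,t)}|u(y)-c|^\sigma d\mu(y)\big)^{1/\sigma}$, $\vec S^{s,\epsilon,\sigma}(u)(x,t)=t^{\epsilon-s}\sup_{r\in(0,t]}r^{-\epsilon}\big(\inf_{c\in\mathbb R}⨍_{B(x,r)}|u(y)-c|^\sigma d\mu(y)\big)^{1/\sigma}$. For $\vec E$ one of $\vec C^{s,\sigma},\vec A^{s,\sigma},\vec I^{s,\sigma},\vec S^{s,\epsilon,\sigma}$, $\vec E\dot B_{p,q}(\mathcal X)$ is the collection of all $u\in L^\sigma_{\rm loc}(\mathcal X)$ with $\|u\|_{\vec E\dot B_{p,q}(\mathcal X)}=\big(\int_0^\infty\|\vec E(u)(\cdot,t)\|_{L^p(\mathcal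 X)}^q\frac{dt}{t}\big)^{1/q}<\infty$, with the usual modification when $p=\infty$ or $q=\infty$. (For $\vec E=\vec A^{s,\sigma}$ with $\sigma<1$, $u$ is also required to be integrable on balls, so that $u_{B(x,t)}$ is defined.) For (quasi-semi)normed spaces, $X\subset Y$ means $u\in X$ implies $u\in Y$ and $\|u\|_Y\le C\|u\|_X$ with $C$ independent of $u$; $X=Y$ means $X\subset Y$ and $Y\subset X$. *)

theory Defs
  imports "HOL-Analysis.Analysis" "HOL-Probability.Essential_Supremum"
begin

text \<open>
  A regular Borel measure is rendered as a measure that is defined at least on the Borel sets and
  for which every measurable set has a Borel envelope of the same measure.  This covers both a
  measure on the Borel sigma-algebra itself, for which \<open>borel_regular\<close> is trivial, and its
  completion, such as \<^const>\<open>lebesgue\<close>.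
\<close>

locale doubling_metric_measure =
  fixes M :: "'a::metric_space measure" and C1 n :: real
  assumes borel_sets: "sets borel \<subseteq> sets M"
    and borel_regular: "\<And>A. A \<in> sets M \<Longrightarrow> \<exists>B \<in> sets borel. A \<subseteq> B \<and> emeasure M B = emeasure M A"
    and ball_pos: "\<And>x r. 0 < r \<Longrightarrow> 0 < emeasure M (ball x r)"
    and ball_finite: "\<And>x r. 0 < r \<Longrightarrow> emeasure M (ball x r) < \<infinity>"
    and C1_gt_1: "1 < C1"
    and n_pos: "0 < n"
    and doubling: "\<And>x r l. 0 < r \<Longrightarrow> 1 < l \<Longrightarrow>
          emeasure M (ball x (l * r)) \<le> ennreal (C1 * l powr n) * emeasure M (ball x r)"

text \<open>
  Norms take values in \<^typ>\<open>ennreal\<close>, and so do the exponents \<open>p\<close> and \<open>q\<close>, which range over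
  \<open>(0, \<infinity>]\<close>.  The power below is only used with a positive exponent.
\<close>

definition epow :: "ennreal \<Rightarrow> real \<Rightarrow> ennreal" where
  "epow x a = (if x = \<infinity> then \<infinity> else ennreal (enn2real x powr a))"

definition avg :: "'a measure \<Rightarrow> 'a set \<Rightarrow> ('a \<Rightarrow> ennreal) \<Rightarrow> ennreal" where
  "avg M E f = (\<integral>\<^sup>+y\<in>E. f y \<partial>M) / emeasure M E"

definition mean :: "'a measure \<Rightarrow> 'a set \<Rightarrow> ('a \<Rightarrow> real) \<Rightarrow> real" where
  "mean M E u = (LINT y:E|M. u y) / measure M E"

definition Lp_norm :: "'a measure \<Rightarrow> ennreal \<Rightarrow> ('a \<Rightarrow> ennreal) \<Rightarrow> ennreal" where
  "Lp_norm M p f =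
     (if p = \<infinity> then esssup M f
      else epow (\<integral>\<^sup>+x. epow (f x) (enn2real p) \<partial>M) (1 / enn2real p))"

definition Lp_loc :: "'a::metric_space measure \<Rightarrow> ennreal \<Rightarrow> ('a \<Rightarrow> real) set" where
  "Lp_loc M p = {u \<in> borel_measurable M.
     \<forall>x. \<forall>r>0. Lp_norm (restrict_space M (ball x r)) p (\<lambda>y. ennreal \<bar>u y\<bar>) < \<infinity>}"

definition p_star :: "real \<Rightarrow> real \<Rightarrow> ennreal \<Rightarrow> ennreal" where
  "p_star n s p =
     (if p < ennreal (n / s) then ennreal (n * enn2real p / (n - enn2real p * s)) else \<infinity>)"

text \<open>A function space is represented by its set of members together with its quasi-seminorm.\<close>

type_synonym 'a fun_space = "('a \<Rightarrow> real) set \<times> (('a \<Rightarrow> real) \<Rightarrow> ennreal)"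

abbreviation members :: "'a fun_space \<Rightarrow> ('a \<Rightarrow> real) set" where
  "members X \<equiv> fst X"

abbreviation qnorm :: "'a fun_space \<Rightarrow> ('a \<Rightarrow> real) \<Rightarrow> ennreal" where
  "qnorm X \<equiv> snd X"

definition embeds :: "'a fun_space \<Rightarrow> 'a fun_space \<Rightarrow> bool" where
  "embeds X Y \<longleftrightarrow>
     (\<exists>C::real. \<forall>u \<in> members X. u \<in> members Y \<and> qnorm Y u \<le> ennreal C * qnorm X u)"

definition same_space :: "'a fun_space \<Rightarrow> 'a fun_space \<Rightarrow> bool" where
  "same_space X Y \<longleftrightarrow> embeds X Y \<and> embeds Y X"

definition Besov_osc :: "'a::metric_space measure \<Rightarrow> ennreal \<Rightarrow> ('a \<Rightarrow> real) \<Rightarrow> real \<Rightarrow> ennreal" where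
  "Besov_osc M p u t =
     (if p = \<infinity> then
        esssup M (\<lambda>x. esssup (restrict_space M (ball x t)) (\<lambda>y. ennreal \<bar>u x - u y\<bar>))
      else
        epow (\<integral>\<^sup>+x. avg M (ball x t) (\<lambda>y. ennreal (\<bar>u x - u y\<bar> powr enn2real p)) \<partial>M)
          (1 / enn2real p))"

definition Besov_norm ::
  "'a::metric_space measure \<Rightarrow> real \<Rightarrow> ennreal \<Rightarrow> ennreal \<Rightarrow> ('a \<Rightarrow> real) \<Rightarrow> ennreal" where
  "Besov_norm M s p q u =
     (if q = \<infinity> then (SUP t\<in>{0<..}. ennreal (t powr - s) * Besov_osc M p u t)
      else epow (\<integral>\<^sup>+t\<in>{0<..}. epow (Besov_osc M p u t) (enn2real q)
                    * ennreal (1 / t powr (1 + s * enn2real q)) \<partial>lborel) (1 / enn2real q))"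

definition Besov :: "'a::metric_space measure \<Rightarrow> real \<Rightarrow> ennreal \<Rightarrow> ennreal \<Rightarrow> 'a fun_space" where
  "Besov M s p q =
     ({u \<in> Lp_loc M p. Besov_norm M s p q u < \<infinity>}, Besov_norm M s p q)"

definition vecC ::
  "'a::metric_space measure \<Rightarrow> real \<Rightarrow> real \<Rightarrow> ('a \<Rightarrow> real) \<Rightarrow> 'a \<Rightarrow> real \<Rightarrow> ennreal" where
  "vecC M s \<sigma> u x t = ennreal (t powr - s) *
     epow (avg M (ball x t) (\<lambda>y. ennreal (\<bar>u x - u y\<bar> powr \<sigma>))) (1 / \<sigma>)"

definition vecA ::
  "'a::metric_space measure \<Rightarrow> real \<Rightarrow> real \<Rightarrow> ('a \<Rightarrow> real) \<Rightarrow> 'a \<Rightarrow> real \<Rightarrow> ennreal" where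
  "vecA M s \<sigma> u x t = ennreal (t powr - s) *
     epow (avg M (ball x t) (\<lambda>y. ennreal (\<bar>u y - mean M (ball x t) u\<bar> powr \<sigma>))) (1 / \<sigma>)"

definition vecI ::
  "'a::metric_space measure \<Rightarrow> real \<Rightarrow> real \<Rightarrow> ('a \<Rightarrow> real) \<Rightarrow> 'a \<Rightarrow> real \<Rightarrow> ennreal" where
  "vecI M s \<sigma> u x t = ennreal (t powr - s) *
     epow (INF c::real. avg M (ball x t) (\<lambda>y. ennreal (\<bar>u y - c\<bar> powr \<sigma>))) (1 / \<sigma>)"

definition vecS ::
  "'a::metric_space measure \<Rightarrow> real \<Rightarrow> real \<Rightarrow> real \<Rightarrow> ('a \<Rightarrow> real) \<Rightarrow> 'a \<Rightarrow> real \<Rightarrow> ennreal" where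
  "vecS M s \<epsilon> \<sigma> u x t = ennreal (t powr (\<epsilon> - s)) *
     (SUP r\<in>{0<..t}. ennreal (r powr - \<epsilon>) *
        epow (INF c::real. avg M (ball x r) (\<lambda>y. ennreal (\<bar>u y - c\<bar> powr \<sigma>))) (1 / \<sigma>))"

definition vec_norm ::
  "'a measure \<Rightarrow> ennreal \<Rightarrow> ennreal \<Rightarrow> (('a \<Rightarrow> real) \<Rightarrow> 'a \<Rightarrow> real \<Rightarrow> ennreal)
     \<Rightarrow> ('a \<Rightarrow> real) \<Rightarrow> ennreal" where
  "vec_norm M p q E u =
     (if q = \<infinity> then (SUP t\<in>{0<..}. Lp_norm M p (\<lambda>x. E u x t))
      else epow (\<integral>\<^sup>+t\<in>{0<..}. epow (Lp_norm M p (\<lambda>x. E u x t)) (enn2real q)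
                    * ennreal (1 / t) \<partial>lborel) (1 / enn2real q))"

definition vec_space ::
  "'a::metric_space measure \<Rightarrow> real \<Rightarrow> ennreal \<Rightarrow> ennreal
     \<Rightarrow> (('a \<Rightarrow> real) \<Rightarrow> 'a \<Rightarrow> real \<Rightarrow> ennreal) \<Rightarrow> 'a fun_space" where
  "vec_space M \<sigma> p q E =
     ({u \<in> Lp_loc M (ennreal \<sigma>). vec_norm M p q E u < \<infinity>}, vec_norm M p q E)"

definition CB :: "'a::metric_space measure \<Rightarrow> real \<Rightarrow> real \<Rightarrow> ennreal \<Rightarrow> ennreal \<Rightarrow> 'a fun_space" where
  "CB M s \<sigma> p q = vec_space M \<sigma> p q (vecC M s \<sigma>)"

text \<open>For \<open>\<sigma> < 1\<close> integrability on balls is an extra requirement, without which the Bochner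
  integral in \<^const>\<open>mean\<close> would be a junk value.\<close>

definition AB :: "'a::metric_space measure \<Rightarrow> real \<Rightarrow> real \<Rightarrow> ennreal \<Rightarrow> ennreal \<Rightarrow> 'a fun_space" where
  "AB M s \<sigma> p q =
     ({u \<in> members (vec_space M \<sigma> p q (vecA M s \<sigma>)). \<sigma> < 1 \<longrightarrow> u \<in> Lp_loc M 1},
      qnorm (vec_space M \<sigma> p q (vecA M s \<sigma>)))"

definition IB :: "'a::metric_space measure \<Rightarrow> real \<Rightarrow> real \<Rightarrow> ennreal \<Rightarrow> ennreal \<Rightarrow> 'a fun_space" where
  "IB M s \<sigma> p q = vec_space M \<sigma> p q (vecI M s \<sigma>)"

definition SB ::
  "'a::metric_space measure \<Rightarrow> real \<Rightarrow> real \<Rightarrow> real \<Rightarrow> ennreal \<Rightarrow> ennreal \<Rightarrow> 'a fun_space" where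
  "SB M s \<epsilon> \<sigma> p q = vec_space M \<sigma> p q (vecS M s \<epsilon> \<sigma>)"

end

theory Submission
  imports Defs
begin

text \<open>
  All norms are compared through dyadic scales.  At almost every point, telescoping along balls of
  radius \<open>2\<^sup>k\<^sup>-\<^sup>j\<close> bounds \<open>u(x) - c\<close> by a geometrically weighted supremum of the oscillations
  of \<open>u\<close> over these balls, as measured by \<^const>\<open>vecI\<close>.  Near-optimal constants of neighbouring balls are compared by Chebyshev's
  inequality, so that no exponent \<open>\<sigma>\<close> is special, and the telescoping reaches \<open>u(x)\<close> itself because
  \<open>u\<close> is close to \<open>u(x)\<close> on most of arbitrarily small balls.  This bounds the Besov norm by that of
  \<^const>\<open>vecI\<close>.  Conversely, for \<open>\<sigma> > p\<close> each term of the telescoping series is an average of a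
  \<open>p\<close>-oscillation at scale \<open>2\<^sup>k\<^sup>-\<^sup>j\<close>; interpolating between its \<open>L\<^sup>p\<close> norm and its supremum on a ball of
  radius \<open>2\<^sup>k\<close> costs the factor \<open>2\<close> to the power \<open>j n (1/p - 1/\<sigma>)\<close>, which the weight \<open>2\<close> to the power
  \<open>- j s\<close> absorbs exactly when \<open>\<sigma> < p\<^sub>*(s)\<close>.  A discrete Hardy inequality then sums the scales.

  The counterexample for (v) and (vi) is \<open>\<Sum>\<^sub>j 2\<^sup>j\<^sup>a \<phi>(2\<^sup>j x)\<close> with a Lipschitz bump \<open>\<phi>\<close> and
  \<open>n/\<sigma> < a < n/p - s\<close>: it behaves like \<open>|x|\<close> to the power \<open>-a\<close>, and fails to be in \<open>L\<^sup>\<sigma>\<close> near the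
  origin, which already excludes it from all the spaces with exponent \<open>\<sigma>\<close>.  For (vii) the bump itself
  suffices.
\<close>

section \<open>Powers, sequence norms and dyadic discretization\<close>

text \<open>The exponents \<open>p\<close> and \<open>q\<close> may lie below 1, so neither L^p nor
  l^q offers a triangle inequality. Wherever scales would be summed, a supremum with geometric
  weights is kept instead: its p-th power is at most a sum of p-th powers, and this sum converges
  once an arbitrarily small extra factor 2^(d j) has been conceded. Every concession is paid by a
  strict inequality among the hypotheses: 0 < s when the Besov norm is bounded, \<sigma> < p_*(s) in
  the converse direction, \<epsilon> < s for \<open>vecS\<close>. Each comparison of norms thus
  becomes an estimate F(2^k) \<le> K sup_j 2^(\<theta> j) G(2^(k+m-j)) between quantities at dyadic
  scales with \<theta> < s, and the single lemma \<open>dt_norm_transfer\<close> turns it into an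
  inequality of norms. Joint measurability of the averages rests on separability of the space, which
  is itself extracted from doubling.\<close>

lemma epow_ennreal: "0 \<le> r \<Longrightarrow> epow (ennreal r) a = ennreal (r powr a)"
  by (simp add: epow_def)

lemma epow_top [simp]: "epow top a = top"
  by (simp add: epow_def)

lemma epow_0 [simp]: "epow 0 a = 0"
  by (simp add: epow_def)

lemma epow_1_right [simp]: "epow x 1 = x"
  by (cases x) (simp_all add: epow_ennreal)

lemma epow_epow: "0 < a \<Longrightarrow> 0 < b \<Longrightarrow> epow (epow x a) b = epow x (a * b)"
  by (cases x) (simp_all add: epow_ennreal powr_powr)

lemma epow_inverse [simp]: "0 < a \<Longrightarrow> epow (epow x a) (1 / a) = x"
  and epow_inverse' [simp]: "0 < a \<Longrightarrow> epow (epow x (1 / a)) a = x"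
  by (simp_all add: epow_epow)

lemma epow_mono: "0 < a \<Longrightarrow> x \<le> y \<Longrightarrow> epow x a \<le> epow y a"
  by (cases x; cases y) (auto simp: epow_ennreal powr_mono2 top_unique)

lemma epow_le_iff: "0 < a \<Longrightarrow> epow x a \<le> epow y a \<longleftrightarrow> x \<le> y"
  using epow_mono[of a x y] epow_mono[of "1 / a" "epow x a" "epow y a"] by auto

lemma epow_le_iff_root: "0 < a \<Longrightarrow> epow x (1 / a) \<le> y \<longleftrightarrow> x \<le> epow y a"
  using epow_le_iff[of a "epow x (1 / a)" y] by simp

lemma epow_mult: "0 < a \<Longrightarrow> epow (x * y) a = epow x a * epow y a"
proof -
  assume a: "0 < a"
  have top: "epow (top * y) a = top * epow y a" for y
    using a by (cases y) (auto simp: epow_ennreal ennreal_top_mult)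
  show ?thesis
  proof (cases "x = top \<or> y = top")
    case True
    then show ?thesis
      using top[of x] top[of y] by (auto simp: mult.commute)
  next
    case False
    then show ?thesis
      by (cases x; cases y) (simp_all add: epow_ennreal powr_mult flip: ennreal_mult)
  qed
qed

text \<open>For a > 0 the power is an order isomorphism of [0, \<infinity>] whose inverse is the
  power with exponent 1/a.\<close>

lemma epow_SUP:
  assumes a: "0 < a"
  shows "epow (SUP i\<in>I. f i) a = (SUP i\<in>I. epow (f i) a)"
proof (rule antisym)
  have "(SUP i\<in>I. f i) \<le> epow (SUP i\<in>I. epow (f i) a) (1 / a)"
  proof (rule SUP_least)
    fix i assume "i \<in> I"
    then have "epow (epow (f i) a) (1 / a) \<le> epow (SUP i\<in>I. epow (f i) a) (1 / a)"
      using a by (intro epow_mono SUP_upper) auto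
    then show "f i \<le> epow (SUP i\<in>I. epow (f i) a) (1 / a)"
      using a by simp
  qed
  then show "epow (SUP i\<in>I. f i) a \<le> (SUP i\<in>I. epow (f i) a)"
    using epow_mono[OF a] a by fastforce
  show "(SUP i\<in>I. epow (f i) a) \<le> epow (SUP i\<in>I. f i) a"
    by (intro SUP_least epow_mono a SUP_upper)
qed

lemma measurable_epow [measurable]:
  assumes [measurable]: "f \<in> borel_measurable N"
  shows "(\<lambda>x. epow (f x) a) \<in> borel_measurable N"
  unfolding epow_def by measurable

text \<open>From x + y \<le> 2 max(x, y), an argument indifferent to whether the power is convex or
  concave.\<close>

lemma epow_add_le:
  assumes a: "0 < a"
  shows "epow (x + y) a \<le> ennreal (2 powr a) * (epow x a + epow y a)"
proof -
  have "x + y \<le> 2 * max x y"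
    by (simp add: mult_2 add_mono)
  then have "epow (x + y) a \<le> epow (2 * max x y) a"
    using a by (intro epow_mono)
  also have "\<dots> = ennreal (2 powr a) * epow (max x y) a"
    using a epow_ennreal[of 2 a] by (simp add: epow_mult)
  also have "epow (max x y) a \<le> epow x a + epow y a"
    by (auto simp: max_def add_increasing add_increasing2)
  finally show ?thesis
    by (simp add: mult_left_mono)
qed

lemma epow_less_top_iff: "epow x a < top \<longleftrightarrow> x < top"
  by (cases x) (auto simp: epow_ennreal)

lemma epow_ennreal_abs_powr: "epow (ennreal \<bar>x\<bar>) a = ennreal (\<bar>x\<bar> powr a)"
  by (rule epow_ennreal) simp

lemma powr_le1_neg: "a \<le> 0 \<Longrightarrow> 2 powr a \<le> (1::real)"
  using powr_mono[of a 0 2] by simp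

lemma SUP_le_suminf_ennreal: "(SUP j. f j) \<le> (\<Sum>j. f j :: ennreal)"
proof (rule SUP_least)
  fix j
  have "f j \<le> (\<Sum>i<Suc j. f i)"
    by (rule member_le_sum) auto
  also have "\<dots> \<le> (\<Sum>j. f j)"
    by (rule sum_le_suminf) auto
  finally show "f j \<le> (\<Sum>j. f j)" .
qed

lemma ennreal_powr_mult_split:
  "a = b + c \<Longrightarrow> ennreal (2 powr a) * x = ennreal (2 powr b) * (ennreal (2 powr c) * x)"
  by (simp add: powr_add ennreal_mult mult.assoc)

lemma suminf_geometric_powr:
  assumes "0 < d"
  shows "(\<Sum>j. ennreal (2 powr (- d * real j))) = ennreal (1 / (1 - 2 powr - d))"
proof -
  have "2 powr - d < (1::real)"
    using assms by (simp add: powr_less_one)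
  moreover have "2 powr (- d * real j) = (2 powr - d) ^ j" for j
    by (simp add: powr_powr flip: powr_realpow)
  ultimately show ?thesis
    by (auto intro!: suminf_ennreal_eq geometric_sums simp: norm_power)
qed

section \<open>Quasinorms of geometrically weighted suprema, for functions and for sequences\<close>

lemma Lp_norm_mono:
  assumes "0 < p" "AE x in M. f x \<le> g x" "p = \<infinity> \<Longrightarrow> f \<in> borel_measurable M"
  shows "Lp_norm M p f \<le> Lp_norm M p g"
proof (cases "p = \<infinity>")
  \<comment> \<open>\<open>esssup\<close> assigns top to a nonmeasurable function, so monotonicity
    at p = \<infinity> asks for a measurable smaller function; \<open>nn_integral\<close> is
    monotone on all functions.\<close>
  case True
  then show ?thesis
    using assms by (simp add: Lp_norm_def esssup_AE_mono)
next
  case False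
  then have "0 < enn2real p"
    using assms(1) by (simp add: enn2real_positive_iff top.not_eq_extremum)
  with assms(2) False show ?thesis
    by (auto simp: Lp_norm_def intro!: epow_mono nn_integral_mono_AE)
qed

lemma Lp_norm_cmult:
  assumes "0 < p" "f \<in> borel_measurable M"
  shows "Lp_norm M p (\<lambda>x. ennreal c * f x) \<le> ennreal c * Lp_norm M p f"
proof (cases "p = \<infinity>")
  case True
  have "AE x in M. ennreal c * f x \<le> ennreal c * esssup M f"
    using esssup_AE[of f M] by eventually_elim (simp add: mult_left_mono)
  then show ?thesis
    using assms True by (auto simp: Lp_norm_def)
next
  case False
  then have "0 < enn2real p"
    using assms(1) by (simp add: enn2real_positive_iff top.not_eq_extremum)
  with assms(2) False show ?thesis
    by (simp add: Lp_norm_def epow_mult nn_integral_cmult)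
qed

text \<open>The p-th root of the geometric sum of 2^(-d p j) over j \<ge> 0; for p = \<infinity>
  nothing has to be summed.\<close>

definition sup_const :: "real \<Rightarrow> ennreal \<Rightarrow> real" where
  "sup_const d p = (if p = \<infinity> then 1 else (1 / (1 - 2 powr (- d * enn2real p))) powr (1 / enn2real p))"

lemma sup_const_pos: "0 < d \<Longrightarrow> 0 < p \<Longrightarrow> 0 < sup_const d p"
proof (cases "p = \<infinity>")
  case False
  assume "0 < d" "0 < p"
  with False have "2 powr (- d * enn2real p) < (1::real)"
    by (simp add: powr_less_one enn2real_positive_iff top.not_eq_extremum)
  with False show ?thesis
    by (auto simp: sup_const_def)
qed (simp add: sup_const_def)

text \<open>Replacing the sum of a geometrically weighted sequence by its supremum loses only an
  arbitrarily small part of the exponent; this makes the triangle inequality superfluous and treats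
  all exponents in \<open>(0, \<infinity>]\<close> alike.\<close>

lemma Lp_norm_weighted_SUP:
  fixes f :: "nat \<Rightarrow> 'a \<Rightarrow> ennreal"
  assumes p: "0 < p" and d: "0 < d" and [measurable]: "\<And>j. f j \<in> borel_measurable M"
  shows "Lp_norm M p (\<lambda>x. SUP j. ennreal (2 powr (a * real j)) * f j x)
    \<le> ennreal (sup_const d p) * (SUP j. ennreal (2 powr ((a + d) * real j)) * Lp_norm M p (f j))"
    (is "_ \<le> _ * ?S")
proof (cases "p = \<infinity>")
  case True
  have "AE x in M. \<forall>j. f j x \<le> esssup M (f j)"
    by (subst AE_all_countable) (auto intro: esssup_AE)
  then have "AE x in M. (SUP j. ennreal (2 powr (a * real j)) * f j x) \<le> ?S"
  proof eventually_elim
    case (elim x)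
    show ?case
    proof (rule SUP_mono)
      fix j
      show "\<exists>j'\<in>UNIV. ennreal (2 powr (a * real j)) * f j x
          \<le> ennreal (2 powr ((a + d) * real j')) * Lp_norm M p (f j')"
        using elim True d
        by (intro bexI[of _ j] mult_mono ennreal_leI) (auto simp: Lp_norm_def distrib_right)
    qed
  qed
  then show ?thesis
    using True by (simp add: sup_const_def Lp_norm_def esssup_I)
next
  case False
  define r where "r = enn2real p"
  have r: "0 < r"
    using p False by (simp add: r_def enn2real_positive_iff top.not_eq_extremum)
  have *: "(\<integral>\<^sup>+x. epow (ennreal (2 powr (a * real j)) * f j x) r \<partial>M)
      \<le> ennreal (2 powr (- (d * r) * real j)) * epow ?S r" for j
  proof -
    have "(\<integral>\<^sup>+x. epow (ennreal (2 powr (a * real j)) * f j x) r \<partial>M)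
        = epow (ennreal (2 powr (a * real j)) * Lp_norm M p (f j)) r"
      using r False by (simp add: epow_mult nn_integral_cmult Lp_norm_def r_def)
    \<comment> \<open>The factor 2^(-d j) is split off to be summed over j; the rest is a term of
      \<open>?S\<close>.\<close>
    also have "ennreal (2 powr (a * real j)) * Lp_norm M p (f j)
        = ennreal (2 powr (- d * real j)) * (ennreal (2 powr ((a + d) * real j)) * Lp_norm M p (f j))"
      by (rule ennreal_powr_mult_split) (simp add: algebra_simps)
    also have "epow \<dots> r \<le> epow (ennreal (2 powr (- d * real j)) * ?S) r"
      using r by (intro epow_mono mult_left_mono SUP_upper) auto
    also have "\<dots> = ennreal (2 powr (- (d * r) * real j)) * epow ?S r"
      using r by (simp add: epow_mult epow_ennreal powr_powr mult_ac)
    finally show ?thesis .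
  qed
  have "(\<integral>\<^sup>+x. epow (SUP j. ennreal (2 powr (a * real j)) * f j x) r \<partial>M)
      \<le> (\<integral>\<^sup>+x. (\<Sum>j. epow (ennreal (2 powr (a * real j)) * f j x) r) \<partial>M)"
    using r by (intro nn_integral_mono) (simp only: epow_SUP SUP_le_suminf_ennreal)
  also have "\<dots> = (\<Sum>j. \<integral>\<^sup>+x. epow (ennreal (2 powr (a * real j)) * f j x) r \<partial>M)"
    by (intro nn_integral_suminf) measurable
  also have "\<dots> \<le> (\<Sum>j. ennreal (2 powr (- (d * r) * real j)) * epow ?S r)"
    using * by (rule suminf_le) simp_all
  also have "\<dots> = ennreal (1 / (1 - 2 powr - (d * r))) * epow ?S r"
    by (subst ennreal_suminf_multc, subst suminf_geometric_powr) (use r d in simp_all)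
  finally have "Lp_norm M p (\<lambda>x. SUP j. ennreal (2 powr (a * real j)) * f j x)
      \<le> epow (ennreal (1 / (1 - 2 powr - (d * r))) * epow ?S r) (1 / r)"
    using r False by (simp add: Lp_norm_def r_def epow_mono)
  also have "\<dots> = ennreal (sup_const d p) * ?S"
  proof -
    have "2 powr - (d * r) < (1::real)"
      using d r by (simp add: powr_less_one)
    then show ?thesis
      using r False by (simp add: epow_mult epow_ennreal sup_const_def r_def)
  qed
  finally show ?thesis .
qed

text \<open>Sequences are indexed by all integers, one entry for each dyadic scale. Writing the sum
  as an integral against counting measure makes shift invariance a change of variables and lets
  \<open>nn_integral_suminf\<close> interchange it with sums over j.\<close>

definition lq :: "ennreal \<Rightarrow> (int \<Rightarrow> ennreal) \<Rightarrow> ennreal" where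
  "lq q b = (if q = \<infinity> then (SUP k. b k)
     else epow (\<integral>\<^sup>+k. epow (b k) (enn2real q) \<partial>count_space UNIV) (1 / enn2real q))"

lemma lq_mono:
  assumes "0 < q" "\<And>k. b k \<le> c k"
  shows "lq q b \<le> lq q c"
proof (cases "q = \<infinity>")
  case True
  then show ?thesis
    using assms by (auto simp: lq_def intro!: SUP_mono)
next
  case False
  then have "0 < enn2real q"
    using assms(1) by (simp add: enn2real_positive_iff top.not_eq_extremum)
  with assms(2) False show ?thesis
    by (auto simp: lq_def intro!: epow_mono nn_integral_mono)
qed

lemma lq_cmult:
  assumes "0 < q"
  shows "lq q (\<lambda>k. ennreal c * b k) = ennreal c * lq q b"
proof (cases "q = \<infinity>")
  case True
  then show ?thesis
    by (simp add: lq_def SUP_mult_left_ennreal)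
next
  case False
  then have "0 < enn2real q"
    using assms(1) by (simp add: enn2real_positive_iff top.not_eq_extremum)
  with False show ?thesis
    by (simp add: lq_def epow_mult nn_integral_cmult)
qed

lemma nn_integral_count_space_int_shift:
  "(\<integral>\<^sup>+k. f (k + m) \<partial>count_space UNIV) = (\<integral>\<^sup>+k. f k \<partial>count_space (UNIV :: int set))"
  by (rule nn_integral_bij_count_space[where g="\<lambda>k. k + m"])
    (auto intro!: bij_betwI[where g="\<lambda>k. k - m"])

lemma lq_shift: "lq q (\<lambda>k. b (k + m)) = lq q b"
proof -
  have "(SUP k. b (k + m)) = (SUP k. b k)"
    using surj_plus_right[of m] by (metis image_image)
  then show ?thesis
    using nn_integral_count_space_int_shift[of "\<lambda>k. epow (b k) (enn2real q)" m]
    by (simp add: lq_def)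
qed

text \<open>Hardy's inequality in supremum form. Shifting the index by j preserves the l^q norm, so
  the j-th term contributes only the factor 2^(-a j), whose q-th powers are summable; for q =
  \<infinity> every weight is at most 1.\<close>

lemma lq_weighted_SUP:
  assumes q: "0 < q" and a: "0 < a"
  shows "lq q (\<lambda>k. SUP j::nat. ennreal (2 powr (- a * real j)) * b (k - int j))
    \<le> ennreal (sup_const a q) * lq q b"
proof (cases "q = \<infinity>")
  case True
  have "ennreal (2 powr (- a * real j)) * b (k - int j) \<le> (SUP k. b k)" for j k
  proof -
    have "ennreal (2 powr (- a * real j)) * b (k - int j) \<le> 1 * b (k - int j)"
      using a by (intro mult_right_mono) (auto simp: powr_le1_neg)
    also have "\<dots> \<le> (SUP k. b k)"
      by (simp add: SUP_upper)
    finally show ?thesis .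
  qed
  then show ?thesis
    using True by (auto simp: lq_def sup_const_def intro!: SUP_least)
next
  case False
  define r where "r = enn2real q"
  have r: "0 < r"
    using q False by (simp add: r_def enn2real_positive_iff top.not_eq_extremum)
  let ?I = "\<integral>\<^sup>+k. epow (b k) r \<partial>count_space UNIV"
  have "(\<integral>\<^sup>+k. epow (SUP j::nat. ennreal (2 powr (- a * real j)) * b (k - int j)) r \<partial>count_space UNIV)
      \<le> (\<integral>\<^sup>+k. (\<Sum>j. epow (ennreal (2 powr (- a * real j)) * b (k - int j)) r) \<partial>count_space UNIV)"
    using r by (intro nn_integral_mono) (simp only: epow_SUP SUP_le_suminf_ennreal)
  also have "\<dots> = (\<Sum>j. \<integral>\<^sup>+k. epow (ennreal (2 powr (- a * real j)) * b (k - int j)) r \<partial>count_space UNIV)"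
    by (intro nn_integral_suminf) measurable
  also have "\<dots> = (\<Sum>j. ennreal (2 powr (- (a * r) * real j)) * ?I)"
  proof (intro suminf_cong)
    fix j
    show "(\<integral>\<^sup>+k. epow (ennreal (2 powr (- a * real j)) * b (k - int j)) r \<partial>count_space UNIV)
      = ennreal (2 powr (- (a * r) * real j)) * ?I"
      using r nn_integral_count_space_int_shift[of "\<lambda>k. epow (b k) r" "- int j"]
      by (simp add: epow_mult epow_ennreal powr_powr nn_integral_cmult nn_integral_multc mult_ac)
  qed
  also have "\<dots> = ennreal (1 / (1 - 2 powr - (a * r))) * ?I"
    by (subst ennreal_suminf_multc, subst suminf_geometric_powr) (use r a in simp_all)
  finally have "lq q (\<lambda>k. SUP j::nat. ennreal (2 powr (- a * real j)) * b (k - int j))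
      \<le> epow (ennreal (1 / (1 - 2 powr - (a * r))) * ?I) (1 / r)"
    using r False by (simp add: lq_def r_def epow_mono)
  also have "\<dots> = ennreal (sup_const a q) * lq q b"
  proof -
    have "2 powr - (a * r) < (1::real)"
      using a r by (simp add: powr_less_one)
    then show ?thesis
      using r False by (simp add: epow_mult epow_ennreal sup_const_def r_def lq_def)
  qed
  finally show ?thesis .
qed


section \<open>Norms with respect to dt/t and their dyadic discretization\<close>

definition dt_norm :: "ennreal \<Rightarrow> (real \<Rightarrow> ennreal) \<Rightarrow> ennreal" where
  "dt_norm q F = (if q = \<infinity> then (SUP t\<in>{0<..}. F t)
     else epow (\<integral>\<^sup>+t\<in>{0<..}. epow (F t) (enn2real q) * ennreal (1 / t) \<partial>lborel) (1 / enn2real q))"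

lemma vec_norm_eq_dt_norm: "vec_norm M p q E u = dt_norm q (\<lambda>t. Lp_norm M p (\<lambda>x. E u x t))"
  by (simp add: vec_norm_def dt_norm_def)

text \<open>The weight is absorbed into the integrand: dt / t^(1 + s q) = (t^(-s))^q dt / t.
  Afterwards the Besov norm and the norms \<open>vec_norm\<close> have the same outer form.\<close>

lemma Besov_norm_eq_dt_norm:
  assumes "0 < q"
  shows "Besov_norm M s p q u = dt_norm q (\<lambda>t. ennreal (t powr - s) * Besov_osc M p u t)"
proof (cases "q = \<infinity>")
  case False
  then have q: "0 < enn2real q"
    using assms by (simp add: enn2real_positive_iff top.not_eq_extremum)
  have "ennreal (1 / t powr (1 + s * enn2real q))
      = epow (ennreal (t powr - s)) (enn2real q) * ennreal (1 / t)" if "0 < t" for t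
    using that by (simp add: epow_ennreal powr_powr powr_add powr_minus_divide[of t "s * enn2real q"] mult.commute
        flip: ennreal_mult)
  then have "(\<integral>\<^sup>+t\<in>{0<..}. epow (Besov_osc M p u t) (enn2real q)
        * ennreal (1 / t powr (1 + s * enn2real q)) \<partial>lborel)
      = (\<integral>\<^sup>+t\<in>{0<..}. epow (ennreal (t powr - s) * Besov_osc M p u t) (enn2real q) * ennreal (1 / t) \<partial>lborel)"
    using q by (intro nn_integral_cong) (auto simp: epow_mult mult_ac split: split_indicator)
  then show ?thesis
    using False by (simp add: Besov_norm_def dt_norm_def)
qed (simp add: Besov_norm_def dt_norm_def)

lemma dt_norm_mono:
  assumes "0 < q" "\<And>t. 0 < t \<Longrightarrow> F t \<le> G t"
  shows "dt_norm q F \<le> dt_norm q G"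
proof (cases "q = \<infinity>")
  case True
  then show ?thesis
    using assms by (auto simp: dt_norm_def intro!: SUP_mono)
next
  case False
  then have q: "0 < enn2real q"
    using assms(1) by (simp add: enn2real_positive_iff top.not_eq_extremum)
  have "epow (F t) (enn2real q) * ennreal (1 / t) * indicator {0<..} t
      \<le> epow (G t) (enn2real q) * ennreal (1 / t) * indicator {0<..} t" for t
    using assms(2)[of t] q by (cases "0 < t") (auto intro!: mult_right_mono epow_mono)
  with q False show ?thesis
    by (auto simp: dt_norm_def intro!: epow_mono nn_integral_mono)
qed

text \<open>Open on the left and closed on the right, so that the index of the interval containing t
  is the ceiling of log_2 t.\<close>

abbreviation dyadic_interval :: "int \<Rightarrow> real set" where
  "dyadic_interval k \<equiv> {2 powr (real_of_int k - 1)<..2 powr real_of_int k}"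

lemma in_dyadic_interval_iff: "0 < t \<Longrightarrow> t \<in> dyadic_interval k \<longleftrightarrow> k = \<lceil>log 2 t\<rceil>"
  using ceiling_eq_iff[of "log 2 t" k] by (auto simp: less_log_iff log_le_iff)

text \<open>A step function on (0, \<infinity>) is encoded as an integral over the index: at each t
  a single term survives, while its integral in t follows by exchanging the two integrals.\<close>

lemma nn_integral_dyadic_step:
  "0 < t \<Longrightarrow> (\<integral>\<^sup>+k. c k * indicator (dyadic_interval k) t \<partial>count_space UNIV) = c \<lceil>log 2 t\<rceil>"
proof -
  assume t: "0 < t"
  then have "indicator (dyadic_interval k) t = (indicator {\<lceil>log 2 t\<rceil>} k :: ennreal)" for k
    using in_dyadic_interval_iff[OF t, of k] by (auto simp del: greaterThanAtMost_iff split: split_indicator)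
  then show ?thesis
    by (simp add: nn_integral_count_space_indicator[symmetric])
qed

lemma notin_dyadic_interval: "t \<le> 0 \<Longrightarrow> t \<notin> dyadic_interval k"
  using powr_ge_zero[of 2 "real_of_int k - 1"] by (auto simp del: powr_ge_zero)

lemma nn_integral_dyadic_steps:
  "(\<integral>\<^sup>+t. (\<integral>\<^sup>+k. c k * indicator (dyadic_interval k) t \<partial>count_space UNIV) \<partial>lborel)
    = (\<integral>\<^sup>+k. c k * ennreal (2 powr (real_of_int k - 1)) \<partial>count_space UNIV)"
proof -
  have "2 powr real_of_int k - 2 powr (real_of_int k - 1) = 2 powr (real_of_int k - 1)" for k
    by (simp add: powr_diff)
  then show ?thesis
    by (subst nn_integral_count_space_nn_integral) (auto simp: nn_integral_cmult)
qed

text \<open>Each t is moved up to the right end 2^k of its dyadic interval, by less than one octave,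
  and 1/t \<le> 2 / 2^k there. The integrand is then below a step function whose integral is
  explicit.\<close>

lemma dt_norm_le_lq:
  assumes q: "0 < q" and K: "0 < K"
    and F: "\<And>t t'. 0 < t \<Longrightarrow> t \<le> t' \<Longrightarrow> t' \<le> 2 * t \<Longrightarrow> F t \<le> ennreal K * F t'"
  shows "dt_norm q F \<le> ennreal K * lq q (\<lambda>k. F (2 powr real_of_int k))"
proof -
  have up: "F t \<le> ennreal K * F (2 powr real_of_int \<lceil>log 2 t\<rceil>)"
    and up': "1 / t \<le> 2 / 2 powr real_of_int \<lceil>log 2 t\<rceil>" if "0 < t" for t
  proof -
    have "t \<in> dyadic_interval \<lceil>log 2 t\<rceil>"
      using that in_dyadic_interval_iff by blast
    then have *: "t \<le> 2 powr real_of_int \<lceil>log 2 t\<rceil>" "2 powr real_of_int \<lceil>log 2 t\<rceil> \<le> 2 * t"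
      by (auto simp: powr_diff)
    then show "F t \<le> ennreal K * F (2 powr real_of_int \<lceil>log 2 t\<rceil>)"
      using that by (intro F)
    show "1 / t \<le> 2 / 2 powr real_of_int \<lceil>log 2 t\<rceil>"
      using * that by (simp add: divide_simps)
  qed
  show ?thesis
  proof (cases "q = \<infinity>")
    case True
    have "F t \<le> ennreal K * (SUP k. F (2 powr real_of_int k))" if "0 < t" for t
      using up[OF that] by (rule order_trans) (intro mult_left_mono SUP_upper, auto)
    then show ?thesis
      using True by (auto simp: dt_norm_def lq_def intro!: SUP_least)
  next
    case False
    define r where "r = enn2real q"
    have r: "0 < r"
      using q False by (simp add: r_def enn2real_positive_iff top.not_eq_extremum)
    define c where "c k = epow (ennreal K * F (2 powr real_of_int k)) r
        * ennreal (2 / 2 powr real_of_int k)" for k :: int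
    have "(\<integral>\<^sup>+t\<in>{0<..}. epow (F t) r * ennreal (1 / t) \<partial>lborel)
        \<le> (\<integral>\<^sup>+t. (\<integral>\<^sup>+k. c k * indicator (dyadic_interval k) t \<partial>count_space UNIV) \<partial>lborel)"
    proof (rule nn_integral_mono)
      fix t :: real
      show "epow (F t) r * ennreal (1 / t) * indicator {0<..} t
          \<le> (\<integral>\<^sup>+k. c k * indicator (dyadic_interval k) t \<partial>count_space UNIV)"
      proof (cases "0 < t")
        case True
        then show ?thesis
          unfolding nn_integral_dyadic_step[OF True] c_def
          using up[OF True] up'[OF True] r by (auto intro!: mult_mono epow_mono ennreal_leI)
      qed simp
    qed
    \<comment> \<open>The interval has length 2^(k-1), which cancels the bound 2 / 2^k on 1/t
      exactly.\<close>
    also have "\<dots> = (\<integral>\<^sup>+k. epow (ennreal K * F (2 powr real_of_int k)) r \<partial>count_space UNIV)"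
    proof -
      have "ennreal (2 / 2 powr real_of_int k) * ennreal (2 powr (real_of_int k - 1)) = 1" for k
        by (simp add: powr_diff flip: ennreal_mult)
      then show ?thesis
        unfolding nn_integral_dyadic_steps by (simp add: c_def mult.assoc)
    qed
    finally have "dt_norm q F \<le> lq q (\<lambda>k. ennreal K * F (2 powr real_of_int k))"
      using r False by (auto simp: dt_norm_def lq_def r_def intro!: epow_mono)
    then show ?thesis
      using q by (simp add: lq_cmult)
  qed
qed

text \<open>\<open>K\<close> compares the two ends of an octave; 2^(1/q) arises because the bound
  1/t \<ge> 1/2^k gives each dyadic interval at least the mass 1/2 for dt/t.\<close>

definition lq_const :: "ennreal \<Rightarrow> real \<Rightarrow> real" where
  "lq_const q K = (if q = \<infinity> then 1 else K * 2 powr (1 / enn2real q))"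

lemma lq_le_dt_norm:
  assumes q: "0 < q" and K: "0 < K"
    and F: "\<And>t t'. 0 < t \<Longrightarrow> t \<le> t' \<Longrightarrow> t' \<le> 2 * t \<Longrightarrow> F t \<le> ennreal K * F t'"
  shows "lq q (\<lambda>k. F (2 powr real_of_int k)) \<le> ennreal (lq_const q K) * dt_norm q F"
proof (cases "q = \<infinity>")
  case True
  then show ?thesis
    by (auto simp: dt_norm_def lq_def lq_const_def intro!: SUP_mono)
next
  case False
  define r where "r = enn2real q"
  have r: "0 < r"
    using q False by (simp add: r_def enn2real_positive_iff top.not_eq_extremum)
  \<comment> \<open>The sample sits at the left end 2^(k-1), from where \<open>F\<close> is carried
    up to any t of the interval; the shift by one index is undone at the end by
    \<open>lq_shift\<close>.\<close>
  define G where "G k = F (2 powr (real_of_int k - 1))" for k :: int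
  define c where "c k = epow (ennreal (1 / K) * G k) r * ennreal (1 / 2 powr real_of_int k)" for k :: int
  have low: "ennreal (1 / K) * G \<lceil>log 2 t\<rceil> \<le> F t"
    and low': "1 / 2 powr real_of_int \<lceil>log 2 t\<rceil> \<le> 1 / t" if "0 < t" for t
  proof -
    have "t \<in> dyadic_interval \<lceil>log 2 t\<rceil>"
      using that in_dyadic_interval_iff by blast
    then have *: "t \<le> 2 powr real_of_int \<lceil>log 2 t\<rceil>" "2 powr (real_of_int \<lceil>log 2 t\<rceil> - 1) \<le> t"
      "t \<le> 2 * 2 powr (real_of_int \<lceil>log 2 t\<rceil> - 1)"
      by (auto simp: powr_diff)
    then have "G \<lceil>log 2 t\<rceil> \<le> ennreal K * F t"
      unfolding G_def using that by (intro F) auto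
    then have "ennreal (1 / K) * G \<lceil>log 2 t\<rceil> \<le> ennreal (1 / K) * (ennreal K * F t)"
      by (rule mult_left_mono) simp
    also have "\<dots> = F t"
      using K by (simp add: mult.assoc[symmetric] flip: ennreal_mult)
    finally show "ennreal (1 / K) * G \<lceil>log 2 t\<rceil> \<le> F t" .
    show "1 / 2 powr real_of_int \<lceil>log 2 t\<rceil> \<le> 1 / t"
      using * that by (simp add: divide_simps)
  qed
  have "(\<integral>\<^sup>+k. epow (ennreal (1 / K) * G k) r * ennreal (1 / 2) \<partial>count_space UNIV)
      = (\<integral>\<^sup>+t. (\<integral>\<^sup>+k. c k * indicator (dyadic_interval k) t \<partial>count_space UNIV) \<partial>lborel)"
  proof -
    have "ennreal (1 / 2 powr real_of_int k) * ennreal (2 powr (real_of_int k - 1)) = ennreal (1 / 2)" for k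
      by (simp add: powr_diff flip: ennreal_mult)
    then show ?thesis
      unfolding nn_integral_dyadic_steps by (simp add: c_def mult.assoc)
  qed
  also have "\<dots> \<le> (\<integral>\<^sup>+t\<in>{0<..}. epow (F t) r * ennreal (1 / t) \<partial>lborel)"
  proof (rule nn_integral_mono)
    fix t :: real
    show "(\<integral>\<^sup>+k. c k * indicator (dyadic_interval k) t \<partial>count_space UNIV)
        \<le> epow (F t) r * ennreal (1 / t) * indicator {0<..} t"
    proof (cases "0 < t")
      case True
      then show ?thesis
        unfolding nn_integral_dyadic_step[OF True] c_def
        using low[OF True] low'[OF True] r by (auto intro!: mult_mono epow_mono ennreal_leI)
    next
      case nonpos: False
      have "t \<notin> dyadic_interval k" for k
        using nonpos by (intro notin_dyadic_interval) simp
      then show ?thesis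
        by (simp del: greaterThanAtMost_iff)
    qed
  qed
  finally have "epow (\<integral>\<^sup>+k. epow (ennreal (1 / K) * G k) r * ennreal (1 / 2) \<partial>count_space UNIV) (1 / r)
      \<le> dt_norm q F"
    using r False by (simp add: dt_norm_def r_def epow_mono)
  then have *: "lq q (\<lambda>k. ennreal (1 / K) * G k) * ennreal ((1 / 2) powr (1 / r)) \<le> dt_norm q F"
    using r False epow_ennreal[of "1 / 2" "1 / r"]
    by (simp add: lq_def r_def nn_integral_multc epow_mult del: ennreal_half)
  have "lq q (\<lambda>k. F (2 powr real_of_int k)) = lq q G"
    using lq_shift[of q "\<lambda>k. F (2 powr real_of_int k)" "-1"] by (simp add: G_def[abs_def])
  also have "\<dots> = ennreal (lq_const q K) * (lq q (\<lambda>k. ennreal (1 / K) * G k) * ennreal ((1 / 2) powr (1 / r)))"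
  proof -
    have "lq_const q K * (1 / K) * (1 / 2) powr (1 / r) = 1"
      using K r False by (simp add: lq_const_def r_def powr_divide)
    then have "ennreal (lq_const q K) * (ennreal (1 / K) * ennreal ((1 / 2) powr (1 / r))) = 1"
      using K by (simp add: lq_const_def flip: ennreal_mult)
    moreover have "ennreal (lq_const q K) * (lq q (\<lambda>k. ennreal (1 / K) * G k) * ennreal ((1 / 2) powr (1 / r)))
        = (ennreal (lq_const q K) * (ennreal (1 / K) * ennreal ((1 / 2) powr (1 / r)))) * lq q G"
      unfolding lq_cmult[OF q] by (simp only: mult_ac)
    ultimately show ?thesis
      by simp
  qed
  also have "\<dots> \<le> ennreal (lq_const q K) * dt_norm q F"
    using * by (rule mult_left_mono) simp
  finally show ?thesis .
qed

section \<open>Doubling measures and averages\<close>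

context doubling_metric_measure
begin

lemma space_M [simp]: "space M = UNIV"
proof -
  have "UNIV \<in> sets M"
    using borel_sets space_in_borel by blast
  then show ?thesis
    using sets.sets_into_space by blast
qed

lemma open_in_sets: "open S \<Longrightarrow> S \<in> sets M"
  using borel_sets by auto

lemma ball_in_sets [measurable, simp]: "ball x r \<in> sets M"
  by (simp add: open_in_sets)

text \<open>The factor 2 L is the ratio of radii after recentring: a ball of radius t' \<le> L t
  whose centre is at distance at most t' from x lies in the ball of radius 2 L t about x.\<close>

definition dbl :: "real \<Rightarrow> real" where
  "dbl L = C1 * (2 * L) powr n"

lemma dbl_pos: "0 < L \<Longrightarrow> 0 < dbl L"
  using C1_gt_1 by (simp add: dbl_def)

lemma emeasure_ball_compare:
  assumes t: "0 < t" and t': "t' \<le> L * t" and L: "1 \<le> L" and d: "dist x x' \<le> t'"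
  shows "emeasure M (ball x' t') \<le> ennreal (dbl L) * emeasure M (ball x t)"
proof -
  have "ball x' t' \<subseteq> ball x (2 * L * t)"
  proof
    fix y assume "y \<in> ball x' t'"
    then show "y \<in> ball x (2 * L * t)"
      using dist_triangle[of x y x'] t' d by auto
  qed
  then have "emeasure M (ball x' t') \<le> emeasure M (ball x (2 * L * t))"
    by (rule emeasure_mono) simp
  also have "\<dots> \<le> ennreal (dbl L) * emeasure M (ball x t)"
    using doubling[of t "2 * L" x] t L by (simp add: dbl_def)
  finally show ?thesis .
qed

lemma emeasure_ball_neq [simp]:
  "0 < r \<Longrightarrow> emeasure M (ball x r) \<noteq> 0" "emeasure M (ball x r) \<noteq> top"
proof -
  show "0 < r \<Longrightarrow> emeasure M (ball x r) \<noteq> 0"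
    using ball_pos[of r x] by auto
  show "emeasure M (ball x r) \<noteq> top"
    using ball_finite[of r x] by (cases "0 < r") (auto simp: ball_empty not_less)
qed

lemma emeasure_ball_divide_self [simp]:
  "0 < r \<Longrightarrow> emeasure M (ball x r) / emeasure M (ball x r) = 1"
  by (rule ennreal_divide_self) (simp_all add: less_top[symmetric] ball_pos)

lemma measure_ball_pos: "0 < r \<Longrightarrow> 0 < measure M (ball x r)"
  using ball_pos[of r x] ball_finite[of r x] by (simp add: measure_def enn2real_positive_iff)

lemma not_AE_notin_ball:
  assumes "0 < r"
  shows "\<not> (AE y in M. y \<notin> ball x r)"
proof
  assume "AE y in M. y \<notin> ball x r"
  then have "ball x r \<in> null_sets M"
    by (subst (asm) AE_iff_null_sets[symmetric]) auto
  then show False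
    using assms by (auto simp: null_sets_def)
qed

lemma AE_obtain_in_ball:
  assumes "AE y in M. Q y" "0 < r"
  obtains y where "y \<in> ball x r" "Q y"
proof (rule ccontr)
  assume "\<not> thesis"
  with that have "Q y \<Longrightarrow> y \<notin> ball x r" for y by blast
  with assms(1) have "AE y in M. y \<notin> ball x r"
    by (rule eventually_mono)
  then show False
    using not_AE_notin_ball[OF assms(2)] by blast
qed

lemma ball_in_fmeasurable [simp]: "ball x r \<in> fmeasurable M"
  by (simp add: fmeasurable_def less_top[symmetric])

section \<open>Sigma-finiteness, separability and joint measurability\<close>

sublocale sigma_finite_measure M
proof
  have "(\<Union>i::nat. ball undefined (real i)) = (UNIV :: 'a set)"
    by (auto simp: reals_Archimedean2)
  then show "\<exists>A. countable A \<and> A \<subseteq> sets M \<and> \<Union> A = space M \<and> (\<forall>a\<in>A. emeasure M a \<noteq> \<infinity>)"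
    by (intro exI[of _ "range (\<lambda>i::nat. ball undefined (real i))"]) auto
qed

lemma measurable_nn_integral_snd:
  "(\<lambda>z. g (fst z) (snd z)) \<in> borel_measurable (N \<Otimes>\<^sub>M M) \<Longrightarrow> (\<lambda>x. \<integral>\<^sup>+y. g x y \<partial>M) \<in> borel_measurable N"
  using borel_measurable_nn_integral[of g N] by (simp add: split_beta')

lemma measurable_lebesgue_integral_snd:
  fixes g :: "'b \<Rightarrow> 'a \<Rightarrow> real"
  shows "(\<lambda>z. g (fst z) (snd z)) \<in> borel_measurable (N \<Otimes>\<^sub>M M) \<Longrightarrow> (\<lambda>x. \<integral>y. g x y \<partial>M) \<in> borel_measurable N"
  using borel_measurable_lebesgue_integral[of g N] by (simp add: split_beta')

sublocale pair_sigma_finite M M ..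

text \<open>Volume packing. Without a finite net one selects infinitely many points of
  \<open>ball a R\<close> at mutual distance at least r; the balls of radius r/2 about them are
  disjoint, lie in \<open>ball a (R + r)\<close> and by doubling have measure at least a common c >
  0, which contradicts the finiteness of the measure of that ball.\<close>

lemma finite_net:
  fixes a :: 'a
  assumes r: "0 < r" and R: "0 < R"
  shows "\<exists>F. finite F \<and> ball a R \<subseteq> (\<Union>x\<in>F. ball x r)"
proof (rule ccontr)
  assume *: "\<not> ?thesis"
  have "\<exists>x :: nat \<Rightarrow> 'a. \<forall>i. x i \<in> ball a R \<and> (\<forall>m<i. r \<le> dist (x m) (x i))"
  proof (rule dependent_wellorder_choice)
    fix i :: nat and x :: "nat \<Rightarrow> 'a"
    have "\<not> ball a R \<subseteq> (\<Union>z\<in>x ` {..<i}. ball z r)"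
      using * by blast
    then obtain y where y: "y \<in> ball a R" "y \<notin> (\<Union>z\<in>x ` {..<i}. ball z r)"
      by blast
    then show "\<exists>y. y \<in> ball a R \<and> (\<forall>m<i. r \<le> dist (x m) y)"
      by (intro exI[of _ y]) (auto simp: not_less)
  qed auto
  then obtain x :: "nat \<Rightarrow> 'a" where x: "\<And>i. x i \<in> ball a R" "\<And>i m. m < i \<Longrightarrow> r \<le> dist (x m) (x i)"
    by blast
  \<comment> \<open>Large enough that R \<le> L (r/2), so that doubling compares
    \<open>ball a R\<close> with the small balls.\<close>
  define L where "L = max 1 (R / (r / 2))"
  define c where "c = measure M (ball a R) / dbl L"
  have L: "1 \<le> L" "R \<le> L * (r / 2)"
    using r by (auto simp: L_def max_def divide_simps)
  have c: "0 < c"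
    using R dbl_pos[of L] L measure_ball_pos by (simp add: c_def)
  have lower: "c \<le> measure M (ball (x i) (r / 2))" for i
  proof -
    have "emeasure M (ball a R) \<le> ennreal (dbl L) * emeasure M (ball (x i) (r / 2))"
      using r L x(1)[of i] by (intro emeasure_ball_compare) (auto simp: dist_commute)
    then have "ennreal (measure M (ball a R)) \<le> ennreal (dbl L * measure M (ball (x i) (r / 2)))"
      using dbl_pos[of L] L by (simp add: emeasure_eq_ennreal_measure ennreal_mult)
    then show ?thesis
      using dbl_pos[of L] L by (simp add: c_def divide_simps mult.commute)
  qed
  have disj: "disjoint_family_on (\<lambda>i. ball (x i) (r / 2)) UNIV"
  proof -
    have *: "ball (x i) (r / 2) \<inter> ball (x j) (r / 2) = {}" if "i < j" for i j
    proof (rule equals0I)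
      fix y assume "y \<in> ball (x i) (r / 2) \<inter> ball (x j) (r / 2)"
      then show False
        using x(2)[OF that] dist_triangle2[of "x i" "x j" y] by auto
    qed
    have "ball (x i) (r / 2) \<inter> ball (x j) (r / 2) = {}" if "i \<noteq> j" for i j
      using *[of i j] *[of j i] that by (cases i j rule: linorder_cases) (simp_all add: Int_commute)
    then show ?thesis
      by (simp add: disjoint_family_on_def)
  qed
  have "real N * c \<le> measure M (ball a (R + r))" for N
  proof -
    have "real N * c \<le> (\<Sum>i<N. measure M (ball (x i) (r / 2)))"
      using sum_mono[of "{..<N}" "\<lambda>_. c"] lower by simp
    also have "\<dots> = measure M (\<Union>i<N. ball (x i) (r / 2))"
      by (rule measure_finite_Union[symmetric]) (auto intro: disjoint_family_on_mono[OF _ disj])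
    also have "\<dots> \<le> measure M (ball a (R + r))"
    proof (rule measure_mono_fmeasurable)
      show "(\<Union>i<N. ball (x i) (r / 2)) \<subseteq> ball a (R + r)"
      proof safe
        fix y i assume "y \<in> ball (x i) (r / 2)"
        then show "y \<in> ball a (R + r)"
          using x(1)[of i] dist_triangle[of a y "x i"] r by auto
      qed
    qed auto
    finally show ?thesis .
  qed
  moreover obtain N :: nat where "measure M (ball a (R + r)) < real N * c"
    using reals_Archimedean3[OF c] by blast
  ultimately show False
    by (metis not_less)
qed

text \<open>Finite nets of mesh 1/(m+1) in the balls of radius i+1 about one fixed point, collected
  over all i and m.\<close>

lemma countable_dense:
  obtains D :: "'a set" where "countable D" "\<And>x e. 0 < e \<Longrightarrow> \<exists>d\<in>D. dist d x < e"
proof -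
  obtain F :: "nat \<Rightarrow> nat \<Rightarrow> 'a set" where F: "\<And>i m. finite (F i m)"
    "\<And>i m. ball undefined (real (Suc i)) \<subseteq> (\<Union>x\<in>F i m. ball x (1 / real (Suc m)))"
  proof -
    have "\<forall>i m. \<exists>F :: 'a set. finite F \<and> ball undefined (real (Suc i)) \<subseteq> (\<Union>x\<in>F. ball x (1 / real (Suc m)))"
      by (intro allI finite_net) auto
    then show ?thesis
      unfolding choice_iff using that by blast
  qed
  show ?thesis
  proof (rule that)
    show "countable (\<Union>i m. F i m)"
      by (intro countable_UN[OF countableI_type] countable_finite F(1))
    fix x :: 'a and e :: real assume "0 < e"
    then obtain m where m: "1 / real (Suc m) < e"
      using nat_approx_posE by blast
    obtain i where "dist undefined x < real i"
      using reals_Archimedean2 by blast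
    then have "x \<in> ball undefined (real (Suc i))" by simp
    then obtain d where "d \<in> F i m" "x \<in> ball d (1 / real (Suc m))"
      using F(2)[of i m] by auto
    then have "d \<in> (\<Union>i m. F i m)" "dist d x < e"
      using m by (blast, simp)
    then show "\<exists>d\<in>\<Union>i m. F i m. dist d x < e"
      by blast
  qed
qed

text \<open>In a product sigma-algebra the set has to be assembled from countably many rectangles;
  their centres come from the countable dense set and their sides from the rationals.\<close>

lemma near_pairs_in_sets: "{z. dist (fst z) (snd z) < t} \<in> sets (M \<Otimes>\<^sub>M M)"
proof -
  obtain D :: "'a set" where D: "countable D" "\<And>x e. 0 < e \<Longrightarrow> \<exists>d\<in>D. dist d x < e"
    by (rule countable_dense) (rule that)
  have "{z. dist (fst z) (snd z) < t} = (\<Union>d\<in>D. \<Union>r\<in>\<rat>. ball d r \<times> ball d (t - r))"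
  proof safe
    fix x y :: 'a assume "dist (fst (x, y)) (snd (x, y)) < t"
    \<comment> \<open>Half the gap leaves room on both sides: dist d x < r gives dist d y < r + (t -
      2 r) = t - r.\<close>
    then have "0 < (t - dist x y) / 2" by simp
    then obtain r where r: "r \<in> \<rat>" "0 < r" "r < (t - dist x y) / 2"
      using Rats_dense_in_real by blast
    obtain d where d: "d \<in> D" "dist d x < r"
      using D(2)[OF r(2)] by blast
    have "dist d y < t - r"
      using dist_triangle[of d y x] d r by auto
    then show "(x, y) \<in> (\<Union>d\<in>D. \<Union>r\<in>\<rat>. ball d r \<times> ball d (t - r))"
      using d r by auto
  next
    fix x y d r assume "x \<in> ball d r" "y \<in> ball d (t - r)"
    then show "dist (fst (x, y)) (snd (x, y)) < t"
      using dist_triangle[of x y d] by (auto simp: dist_commute)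
  qed
  also have "\<dots> \<in> sets (M \<Otimes>\<^sub>M M)"
    by (rule sets.countable_UN''[OF D(1)], rule sets.countable_UN''[OF countable_rat], rule pair_measureI)
      simp_all
  finally show ?thesis .
qed

lemma measurable_indicator_ball [measurable]:
  "(\<lambda>z. indicator (ball (fst z) t) (snd z) :: ennreal) \<in> borel_measurable (M \<Otimes>\<^sub>M M)"
  "(\<lambda>z. indicator (ball (fst z) t) (snd z) :: real) \<in> borel_measurable (M \<Otimes>\<^sub>M M)"
proof -
  have *: "indicator (ball (fst z) t) (snd z) = (indicator {z. dist (fst z) (snd z) < t} z :: 'b::zero_neq_one)" for z
    by (auto simp: indicator_def)
  show "(\<lambda>z. indicator (ball (fst z) t) (snd z) :: ennreal) \<in> borel_measurable (M \<Otimes>\<^sub>M M)"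
    "(\<lambda>z. indicator (ball (fst z) t) (snd z) :: real) \<in> borel_measurable (M \<Otimes>\<^sub>M M)"
    unfolding * using near_pairs_in_sets by (auto intro!: borel_measurable_indicator)
qed

lemma measurable_emeasure_ball [measurable]: "(\<lambda>x. emeasure M (ball x t)) \<in> borel_measurable M"
proof -
  have "(\<lambda>x. \<integral>\<^sup>+y. indicator (ball x t) y \<partial>M) \<in> borel_measurable M"
    by (rule measurable_nn_integral_snd) measurable
  then show ?thesis
    by simp
qed

section \<open>Averages over balls\<close>

lemma measurable_avg:
  assumes [measurable]: "(\<lambda>z. f (fst z) (snd z)) \<in> borel_measurable (M \<Otimes>\<^sub>M M)"
  shows "(\<lambda>x. avg M (ball x t) (f x)) \<in> borel_measurable M"
proof -
  have [measurable]: "(\<lambda>x. \<integral>\<^sup>+y. f x y * indicator (ball x t) y \<partial>M) \<in> borel_measurable M"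
    by (rule measurable_nn_integral_snd) measurable
  show ?thesis
    unfolding avg_def by measurable
qed

lemma avg_mono_AE:
  assumes "AE y in M. y \<in> E \<longrightarrow> f y \<le> g y"
  shows "avg M E f \<le> avg M E g"
  unfolding avg_def using assms
  by (intro divide_right_mono_ennreal nn_integral_mono_AE) (auto split: split_indicator)

lemma avg_mono: "(\<And>y. y \<in> E \<Longrightarrow> f y \<le> g y) \<Longrightarrow> avg M E f \<le> avg M E g"
  by (rule avg_mono_AE) simp

lemma avg_const [simp]: "0 < r \<Longrightarrow> avg M (ball x r) (\<lambda>_. c) = c"
  by (simp add: avg_def nn_integral_cmult_indicator ennreal_mult_divide_eq)

lemma avg_cmult:
  assumes "f \<in> borel_measurable M" "E \<in> sets M"
  shows "avg M E (\<lambda>y. c * f y) = c * avg M E f"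
  using assms by (simp add: avg_def mult.assoc nn_integral_cmult ennreal_times_divide)

lemma avg_add:
  assumes [measurable]: "f \<in> borel_measurable M" "g \<in> borel_measurable M" "E \<in> sets M"
  shows "avg M E (\<lambda>y. f y + g y) = avg M E f + avg M E g"
  by (simp add: avg_def distrib_right nn_integral_add add_divide_distrib_ennreal)

text \<open>The integral grows with the ball, and the ratio of the two measures is bounded by
  doubling; the centre of the smaller ball lies in the larger one, which gives the distance bound
  required by \<open>emeasure_ball_compare\<close>.\<close>

lemma avg_le_avg:
  assumes t: "0 < t" and t': "t' \<le> L * t" and L: "1 \<le> L" and sub: "ball x t \<subseteq> ball x' t'"
  shows "avg M (ball x t) f \<le> ennreal (dbl L) * avg M (ball x' t') f"
proof -
  have "x \<in> ball x' t'"
    using sub t centre_in_ball by blast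
  then have "0 < t'" and "dist x x' \<le> t'"
    using zero_le_dist[of x' x] by (auto simp: dist_commute simp del: zero_le_dist)
  then have *: "emeasure M (ball x' t') \<le> ennreal (dbl L) * emeasure M (ball x t)"
    using assms by (intro emeasure_ball_compare)
  let ?I = "\<integral>\<^sup>+y\<in>ball x' t'. f y \<partial>M"
  have "(\<integral>\<^sup>+y\<in>ball x t. f y \<partial>M) \<le> ?I"
    using sub by (intro nn_integral_mono) (auto split: split_indicator)
  then have "avg M (ball x t) f \<le> ?I / emeasure M (ball x t)"
    unfolding avg_def by (rule divide_right_mono_ennreal)
  also have "\<dots> = ?I * (1 / emeasure M (ball x t))"
    by (simp add: ennreal_times_divide)
  also have "?I * (1 / emeasure M (ball x t)) \<le> ?I * (ennreal (dbl L) * (1 / emeasure M (ball x' t')))"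
  proof (rule mult_left_mono)
    show "1 / emeasure M (ball x t) \<le> ennreal (dbl L) * (1 / emeasure M (ball x' t'))"
  proof -
    have "1 / emeasure M (ball x t) = (emeasure M (ball x' t') / emeasure M (ball x' t')) / emeasure M (ball x t)"
      using \<open>0 < t'\<close> by simp
    also have "\<dots> \<le> ((ennreal (dbl L) * emeasure M (ball x t)) / emeasure M (ball x' t')) / emeasure M (ball x t)"
      using * by (intro divide_right_mono_ennreal)
    also have "\<dots> = ennreal (dbl L) * (1 / emeasure M (ball x' t')) * (emeasure M (ball x t) / emeasure M (ball x t))"
      by (simp add: divide_ennreal_def mult_ac)
    also have "\<dots> = ennreal (dbl L) * (1 / emeasure M (ball x' t'))"
      using t by simp
    finally show ?thesis .
  qed
  qed simp
  also have "\<dots> = ennreal (dbl L) * avg M (ball x' t') f"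
    by (simp add: avg_def divide_ennreal_def mult_ac)
  finally show ?thesis .
qed

text \<open>Tonelli together with the symmetry of y \<in> \<open>ball x t\<close>: for such pairs
  the measures of \<open>ball x t\<close> and \<open>ball y t\<close> are comparable, so the
  averaging kernel has bounded integral in x. This boundedness on L^1 serves in place of a maximal
  theorem.\<close>

lemma nn_integral_avg_le:
  assumes t: "0 < t" and f [measurable]: "f \<in> borel_measurable M"
  shows "(\<integral>\<^sup>+x. avg M (ball x t) f \<partial>M) \<le> ennreal (dbl 1) * (\<integral>\<^sup>+x. f x \<partial>M)"
proof -
  have "(\<integral>\<^sup>+x. avg M (ball x t) f \<partial>M)
      = (\<integral>\<^sup>+x. \<integral>\<^sup>+y. f y * indicator (ball x t) y / emeasure M (ball x t) \<partial>M \<partial>M)"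
    by (simp add: avg_def nn_integral_divide)
  also have "\<dots> = (\<integral>\<^sup>+y. \<integral>\<^sup>+x. f y * indicator (ball x t) y / emeasure M (ball x t) \<partial>M \<partial>M)"
    using Fubini[of "\<lambda>z. f (snd z) * indicator (ball (fst z) t) (snd z) / emeasure M (ball (fst z) t)"]
    by simp
  also have "\<dots> \<le> (\<integral>\<^sup>+y. \<integral>\<^sup>+x. (f y * (ennreal (dbl 1) / emeasure M (ball y t))) * indicator (ball y t) x \<partial>M \<partial>M)"
  proof (intro nn_integral_mono)
    fix x y
    show "f y * indicator (ball x t) y / emeasure M (ball x t)
        \<le> f y * (ennreal (dbl 1) / emeasure M (ball y t)) * indicator (ball y t) x"
    proof (cases "y \<in> ball x t")
      case True
      then have "emeasure M (ball y t) \<le> ennreal (dbl 1) * emeasure M (ball x t)"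
        using t by (intro emeasure_ball_compare) auto
      then have "emeasure M (ball y t) / emeasure M (ball y t) / emeasure M (ball x t)
          \<le> ennreal (dbl 1) * emeasure M (ball x t) / emeasure M (ball y t) / emeasure M (ball x t)"
        by (intro divide_right_mono_ennreal)
      also have "\<dots> = ennreal (dbl 1) / emeasure M (ball y t) * (emeasure M (ball x t) / emeasure M (ball x t))"
        by (simp add: divide_ennreal_def mult_ac)
      finally have "1 / emeasure M (ball x t) \<le> ennreal (dbl 1) / emeasure M (ball y t)"
        using t by simp
      then have "f y * (1 / emeasure M (ball x t)) \<le> f y * (ennreal (dbl 1) / emeasure M (ball y t))"
        by (rule mult_left_mono) simp
      then show ?thesis
        using True by (simp add: ennreal_times_divide dist_commute)
    qed (simp add: dist_commute)
  qed
  also have "\<dots> = (\<integral>\<^sup>+y. ennreal (dbl 1) * f y \<partial>M)"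
  proof (rule nn_integral_cong)
    fix y
    have "(\<integral>\<^sup>+x\<in>ball y t. f y * (ennreal (dbl 1) / emeasure M (ball y t)) \<partial>M)
        = f y * (ennreal (dbl 1) / emeasure M (ball y t)) * emeasure M (ball y t)"
      by (simp add: nn_integral_cmult_indicator)
    also have "\<dots> = ennreal (dbl 1) * f y * (emeasure M (ball y t) / emeasure M (ball y t))"
      by (simp add: divide_ennreal_def mult_ac)
    finally show "(\<integral>\<^sup>+x\<in>ball y t. f y * (ennreal (dbl 1) / emeasure M (ball y t)) \<partial>M)
        = ennreal (dbl 1) * f y"
      using t by simp
  qed
  also have "\<dots> = ennreal (dbl 1) * (\<integral>\<^sup>+x. f x \<partial>M)"
    by (simp add: nn_integral_cmult)
  finally show ?thesis .
qed

end

section \<open>A weak Lebesgue differentiation theorem\<close>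

text \<open>The closed sets collect the points at distance at least 1/(i+1) from the complement. The
  whole space is treated apart because \<open>infdist\<close> to the empty set is 0.\<close>

lemma closed_exhaustion_of_open:
  fixes U :: "'a::metric_space set"
  assumes "open U"
  obtains F :: "nat \<Rightarrow> 'a set" where "\<And>i. closed (F i)" "incseq F" "(\<Union>i. F i) = U"
proof (cases "U = UNIV")
  case True
  show ?thesis
    by (rule that[of "\<lambda>_. UNIV"]) (auto simp: True incseq_def)
next
  case False
  define F where "F i = {x. 1 / real (Suc i) \<le> infdist x (- U)}" for i
  show ?thesis
  proof (rule that)
    show "closed (F i)" for i
      unfolding F_def by (intro closed_Collect_le continuous_intros)
    have "1 / real (Suc j) \<le> 1 / real (Suc i)" if "i \<le> j" for i j
      using that by (simp add: divide_simps)
    then show "incseq F"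
      by (auto simp: incseq_def F_def intro: order_trans)
    show "(\<Union>i. F i) = U"
    proof (intro equalityI subsetI)
      fix x assume "x \<in> (\<Union>i. F i)"
      then obtain i where "1 / real (Suc i) \<le> infdist x (- U)"
        by (auto simp: F_def)
      moreover have "0 < 1 / real (Suc i)" by simp
      ultimately have "0 < infdist x (- U)" by linarith
      then show "x \<in> U"
        using infdist_zero[of x "- U"] by (cases "x \<in> U") auto
    next
      fix x assume "x \<in> U"
      then have "infdist x (- U) \<noteq> 0"
        using assms False in_closed_iff_infdist_zero[of "- U" x] by (auto simp: closed_Compl)
      then have "0 < infdist x (- U)"
        using infdist_nonneg[of x "- U"] by linarith
      then obtain i where "1 / real (Suc i) < infdist x (- U)"
        using nat_approx_posE by blast
      then show "x \<in> (\<Union>i. F i)"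
        by (auto simp: F_def intro: less_imp_le)
    qed
  qed
qed

text \<open>The sets with this approximation property contain the open sets and form a
  sigma-algebra. Countable unions take the work: a union of infinitely many closed sets may fail to
  be closed, so it is truncated by continuity from above, where finiteness of the measure
  enters.\<close>

lemma borel_closed_open_regular:
  fixes M :: "'b::metric_space measure"
  assumes "finite_measure M" and sets: "sets M = sets borel"
    and B: "B \<in> sets borel" and e: "0 < (e::real)"
  shows "\<exists>F U. closed F \<and> open U \<and> F \<subseteq> B \<and> B \<subseteq> U \<and> measure M (U - F) < e"
proof -
  interpret finite_measure M by fact
  have sp: "space M = UNIV"
    using sets_eq_imp_space_eq[OF sets] by simp
  have [measurable]: "open S \<Longrightarrow> S \<in> sets M" "closed S \<Longrightarrow> S \<in> sets M" for S
    using sets by auto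
  have "B \<in> sigma_sets UNIV {S :: 'b set. open S}"
    using B by (simp add: borel_def)
  then show ?thesis
    using e
  proof (induction arbitrary: e rule: sigma_sets.induct)
    case (Basic U)
    then have "open U" by simp
    then obtain F :: "nat \<Rightarrow> 'b set" where F: "\<And>i. closed (F i)" "incseq F" "(\<Union>i. F i) = U"
      using closed_exhaustion_of_open by blast
    have "(\<lambda>i. measure M (F i)) \<longlonglongrightarrow> measure M (\<Union>i. F i)"
      using F by (intro finite_Lim_measure_incseq) auto
    then have "\<forall>\<^sub>F i in sequentially. measure M U - e < measure M (F i)"
      using F(3) Basic(2) by (intro order_tendstoD) auto
    then obtain i where i: "measure M U - e < measure M (F i)"
      by (auto simp: eventually_sequentially)
    have "measure M (U - F i) = measure M U - measure M (F i)"
      using F \<open>open U\<close> by (intro finite_measure_Diff) auto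
    then show ?case
      using i F \<open>open U\<close> by (intro exI[of _ "F i"] exI[of _ U]) auto
  next
    case Empty
    then show ?case
      by (intro exI[of _ "{}"]) auto
  next
    case (Compl B)
    from Compl(2)[OF Compl(3)] obtain F U where FU:
      "closed F" "open U" "F \<subseteq> B" "B \<subseteq> U" "measure M (U - F) < e"
      by blast
    moreover have "- F - (- U) = U - F" by blast
    ultimately show ?case
      by (intro exI[of _ "- U"] exI[of _ "- F"]) (auto simp: closed_Compl open_Compl)
  next
    case (Union B)
    \<comment> \<open>The errors add up to e/2, which leaves a strict margin below e for truncating
      the union of the closed sets.\<close>
    have pos: "0 < e / 2 * (1 / 2) ^ Suc i" for i
      using Union(3) by simp
    have "\<forall>i. \<exists>F U. closed F \<and> open U \<and> F \<subseteq> B i \<and> B i \<subseteq> U \<and> measure M (U - F) < e / 2 * (1 / 2) ^ Suc i"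
      using Union(2)[OF pos] by blast
    then obtain F U where FU: "\<And>i. closed (F i)" "\<And>i. open (U i)" "\<And>i. F i \<subseteq> B i" "\<And>i. B i \<subseteq> U i"
      "\<And>i. measure M (U i - F i) < e / 2 * (1 / 2) ^ Suc i"
      unfolding choice_iff by blast
    let ?U = "\<Union>i. U i" and ?G = "\<lambda>m. \<Union>i\<le>m. F i"
    have U: "?U \<in> sets M"
      using FU(2) by auto
    have G: "closed (?G m)" for m
      using FU(1) by auto
    have "(\<lambda>i. e / 2 * (1 / 2) ^ Suc i) sums (e / 2 * 1)"
      by (intro sums_mult power_half_series)
    then have sums: "summable (\<lambda>i. e / 2 * (1 / 2) ^ Suc i)" "(\<Sum>i. e / 2 * (1 / 2) ^ Suc i) = e / 2"
      by (auto simp: sums_iff)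
    have summ: "summable (\<lambda>i. measure M (U i - F i))"
      using FU(5) by (intro summable_comparison_test'[OF sums(1), of 0]) (auto intro: less_imp_le)
    have "measure M (?U - (\<Union>i. F i)) \<le> measure M (\<Union>i. U i - F i)"
      using FU by (intro finite_measure_mono) auto
    also have "\<dots> \<le> (\<Sum>i. measure M (U i - F i))"
      using FU summ by (intro finite_measure_subadditive_countably) auto
    also have "\<dots> \<le> (\<Sum>i. e / 2 * (1 / 2) ^ Suc i)"
      using FU(5) summ sums(1) by (intro suminf_le) (auto intro: less_imp_le)
    finally have lim: "measure M (?U - (\<Union>i. F i)) < e"
      using sums(2) Union(3) by simp
    have "(\<lambda>m. measure M (?U - ?G m)) \<longlonglongrightarrow> measure M (\<Inter>m. ?U - ?G m)"
    proof (rule finite_Lim_measure_decseq)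
      show "range (\<lambda>m. ?U - ?G m) \<subseteq> sets M"
        using U G by auto
      show "decseq (\<lambda>m. ?U - ?G m)"
        by (fastforce simp: decseq_def intro: order_trans)
    qed
    moreover have "(\<Inter>m. ?U - ?G m) = ?U - (\<Union>i. F i)"
      by auto
    ultimately have "\<forall>\<^sub>F m in sequentially. measure M (?U - ?G m) < e"
      using lim by (auto intro: order_tendstoD)
    then obtain m where "measure M (?U - ?G m) < e"
      by (auto simp: eventually_sequentially)
    then show ?case
      using FU G by (intro exI[of _ "?G m"] exI[of _ ?U]) (auto, blast+)
  qed
qed

context doubling_metric_measure
begin

text \<open>Two reductions lead to \<open>borel_closed_open_regular\<close>: a Borel envelope
  replaces E, since M may have more measurable sets than the Borel ones, and the measure is cut down
  to \<open>ball a R\<close> to become finite. The envelope exceeds E by a null set because E has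
  finite measure.\<close>

lemma open_superset_small:
  assumes E: "E \<in> sets M" "E \<subseteq> ball a R" and e: "0 < (e::real)"
  obtains U where "open U" "E \<subseteq> U" "emeasure M (U - E) \<le> ennreal e"
proof -
  obtain B where B: "B \<in> sets borel" "E \<subseteq> B" "emeasure M B = emeasure M E"
    using borel_regular[OF E(1)] by blast
  have BM: "B \<in> sets M"
    using B(1) borel_sets by blast
  have fin: "emeasure M E \<noteq> top"
    using emeasure_mono[OF E(2) ball_in_sets] emeasure_ball_neq(2)[of a R] by (auto simp: top_unique)
  \<comment> \<open>\<open>density\<close> with the indicator makes the measure finite, and
    \<open>distr\<close> to \<open>borel\<close> restricts it to the Borel sets.\<close>
  define N where "N = distr (density M (indicator (ball a R))) borel (\<lambda>x. x)"
  have meas: "(\<lambda>x. x) \<in> density M (indicator (ball a R)) \<rightarrow>\<^sub>M borel"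
    using borel_sets by (auto simp: measurable_def)
  have N: "emeasure N A = emeasure M (ball a R \<inter> A)" if "A \<in> sets borel" for A
    unfolding N_def using that borel_sets meas
    by (subst emeasure_distr) (auto simp: emeasure_density subsetD indicator_inter_arith[symmetric]
        intro!: nn_integral_indicator)
  interpret N: finite_measure N
    by (rule finite_measureI) (simp add: N_def N[unfolded N_def] top.not_eq_extremum less_top[symmetric])
  have "sets N = sets borel"
    by (simp add: N_def)
  then obtain F U where FU: "closed F" "open U" "F \<subseteq> B" "B \<subseteq> U" "measure N (U - F) < e"
    using borel_closed_open_regular[OF N.finite_measure_axioms _ B(1) e] by blast
  show ?thesis
  proof (rule that)
    show "open (U \<inter> ball a R)" "E \<subseteq> U \<inter> ball a R"
      using FU B E by auto
    have UF: "U - F \<in> sets M"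
      using FU by (intro open_in_sets open_Diff)
    have "emeasure M (B - E) = 0"
      using B fin E(1) BM by (subst emeasure_Diff) auto
    have "emeasure M (U \<inter> ball a R - E) \<le> emeasure M ((ball a R \<inter> (U - F)) \<union> (B - E))"
      using FU UF BM E(1) by (intro emeasure_mono) auto
    also have "\<dots> \<le> emeasure M (ball a R \<inter> (U - F)) + emeasure M (B - E)"
      using UF BM E(1) by (intro emeasure_subadditive) auto
    also have "\<dots> = emeasure N (U - F)"
      using FU \<open>emeasure M (B - E) = 0\<close> by (simp add: N)
    also have "\<dots> \<le> ennreal e"
      using FU(5) by (simp add: N.emeasure_eq_measure ennreal_leI)
    finally show "emeasure M (U \<inter> ball a R - E) \<le> ennreal e" .
  qed
qed

lemma measurable_avg_indicator [measurable]:
  assumes [measurable]: "A \<in> sets M"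
  shows "(\<lambda>x. avg M (ball x r) (indicator A)) \<in> borel_measurable M"
  by (rule measurable_avg) measurable

text \<open>A weak form of the Lebesgue density theorem, for which outer regularity and the boundedness of
  averages on \<open>L\<^sup>1\<close> suffice, without covering arguments.\<close>

lemma weak_density_bounded:
  assumes E [measurable]: "E \<in> sets M" and g: "0 < g"
  shows "AE x in M. x \<in> E \<inter> ball a R \<longrightarrow>
    (\<exists>k\<ge>N::nat. avg M (ball x (2 powr - real k)) (indicator (- E)) \<le> ennreal g)"
proof -
  have [measurable]: "- E \<in> sets M"
    using sets.compl_sets[OF E] by (simp add: Compl_eq_Diff_UNIV)
  \<comment> \<open>The exceptional points: from the scale \<open>N\<close> on, the complement of E
    keeps density above g at every dyadic radius.\<close>
  define Z where "Z = {x \<in> space M. x \<in> E \<inter> ball a R \<and>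
    (\<forall>k\<in>{N..}. ennreal g < avg M (ball x (2 powr - real k)) (indicator (- E)))}"
  have Z [measurable]: "Z \<in> sets M"
    unfolding Z_def by measurable
  have "emeasure M Z \<le> 0 + ennreal e" if e: "0 < e" for e :: real
  proof -
    \<comment> \<open>Markov's inequality costs 1/g and averaging costs \<open>dbl 1\<close>, so an
      excess of this size makes the final bound equal to e.\<close>
    have "0 < e * g / dbl 1"
      using e g dbl_pos[of 1] by simp
    then obtain U where U: "open U" "E \<inter> ball a R \<subseteq> U"
      "emeasure M (U - E \<inter> ball a R) \<le> ennreal (e * g / dbl 1)"
      using open_superset_small[of "E \<inter> ball a R" a R] by auto
    define V where "V = U \<inter> ball a R - E"
    have [measurable]: "V \<in> sets M"
      unfolding V_def using open_in_sets[OF U(1)] by measurable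
    have V: "emeasure M V \<le> ennreal (e * g / dbl 1)"
    proof -
      have "emeasure M V \<le> emeasure M (U - E \<inter> ball a R)"
        using open_in_sets[OF U(1)] by (intro emeasure_mono) (auto simp: V_def)
      with U(3) show ?thesis by simp
    qed
    define h where "h k x = avg M (ball x (2 powr - real k)) (indicator V)" for k :: nat and x
    have h [measurable]: "h k \<in> borel_measurable M" for k
      unfolding h_def by measurable
    \<comment> \<open>The sets increase with \<open>K\<close>, and each lies in a superlevel set of
      the single average \<open>h K\<close>. Markov's inequality at that one radius bounds its
      measure, and continuity from below passes to the union, so that no supremum over radii has to
      be controlled.\<close>
    define A where "A K = {x \<in> space M. \<forall>k\<in>{K..}. 1 \<le> ennreal (1 / g) * h k x}" for K :: nat
    have A [measurable]: "A K \<in> sets M" for K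
      unfolding A_def by measurable
    have "Z \<subseteq> (\<Union>K. A K)"
    proof
      fix x assume x: "x \<in> Z"
      then have "x \<in> U \<inter> ball a R"
        using U(2) by (auto simp: Z_def)
      moreover have "open (U \<inter> ball a R)"
        using U(1) by auto
      ultimately obtain r where r: "0 < r" "ball x r \<subseteq> U \<inter> ball a R"
        by (metis open_contains_ball)
      obtain K :: nat where K: "(1 / 2) ^ K < r"
        using real_arch_pow_inv[OF r(1), of "1 / 2"] by auto
      have "1 \<le> ennreal (1 / g) * h k x" if k: "max K N \<le> k" for k
      proof -
        have "2 powr - real k = (1 / 2) ^ k"
          by (simp add: powr_minus powr_realpow power_one_over field_simps)
        also have "\<dots> \<le> (1 / 2) ^ K"
          using k by (intro power_decreasing) auto
        finally have "ball x (2 powr - real k) \<subseteq> ball x r"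
          using K by auto
        then have "avg M (ball x (2 powr - real k)) (indicator (- E)) \<le> h k x"
          unfolding h_def using r(2) by (intro avg_mono) (fastforce simp: V_def indicator_def)
        moreover have "ennreal g < avg M (ball x (2 powr - real k)) (indicator (- E))"
          using x k by (auto simp: Z_def)
        ultimately have "ennreal (1 / g) * ennreal g \<le> ennreal (1 / g) * h k x"
          by (intro mult_left_mono) auto
        then show ?thesis
          using g by (simp flip: ennreal_mult)
      qed
      then show "x \<in> (\<Union>K. A K)"
        by (auto simp: A_def intro!: exI[of _ "max K N"])
    qed
    then have "emeasure M Z \<le> emeasure M (\<Union>K. A K)"
      by (intro emeasure_mono) auto
    also have "\<dots> = (SUP K. emeasure M (A K))"
    proof (rule SUP_emeasure_incseq[symmetric])
      show "range A \<subseteq> sets M" using A by blast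
      show "incseq A" by (auto simp: incseq_def A_def)
    qed
    also have "\<dots> \<le> ennreal e"
    proof (rule SUP_least)
      fix K :: nat
      have "emeasure M (A K) \<le> emeasure M {x \<in> space M. 1 \<le> ennreal (1 / g) * h K x}"
      proof (rule emeasure_mono)
        show "{x \<in> space M. 1 \<le> ennreal (1 / g) * h K x} \<in> sets M" by measurable
      qed (auto simp: A_def)
      also have "\<dots> \<le> ennreal (1 / g) * (\<integral>\<^sup>+x. h K x \<partial>M)"
        using nn_integral_Markov_inequality[of "h K" UNIV M "ennreal (1 / g)"] h sets.top[of M] by simp
      also have "\<dots> \<le> ennreal (1 / g) * (ennreal (dbl 1) * (\<integral>\<^sup>+x. indicator V x \<partial>M))"
        unfolding h_def by (intro mult_left_mono nn_integral_avg_le) auto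
      also have "\<dots> \<le> ennreal (1 / g) * (ennreal (dbl 1) * ennreal (e * g / dbl 1))"
        using V by (auto intro!: mult_left_mono)
      also have "\<dots> = ennreal e"
        using g e dbl_pos[of 1] by (simp flip: ennreal_mult)
      finally show "emeasure M (A K) \<le> ennreal e" .
    qed
    finally show ?thesis by simp
  qed
  then have "emeasure M Z = 0"
    using ennreal_le_epsilon[of 0 "emeasure M Z"] by auto
  then have "AE x in M. x \<notin> Z"
    by (intro AE_not_in) (auto simp: null_sets_def)
  then show ?thesis
    by eventually_elim (auto simp: Z_def not_less)
qed

text \<open>The density statement is applied to the countably many level sets of \<lfloor>(m+1)
  u\<rfloor>, intersected with balls that exhaust the space. On one level set u varies by less than
  1/(m+1), so the points where u is farther than d from u(x) lie outside it.\<close>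

lemma weak_Lebesgue_differentiation:
  fixes u :: "'a \<Rightarrow> real"
  assumes u [measurable]: "u \<in> borel_measurable M" and g: "0 < g"
  shows "AE x in M. \<forall>d>0. \<forall>N::nat. \<exists>k\<ge>N.
    avg M (ball x (2 powr - real k)) (indicator {y. d < \<bar>u y - u x\<bar>}) \<le> ennreal g"
proof -
  define E where "E m i = {x \<in> space M. \<lfloor>real (Suc m) * u x\<rfloor> = i}" for m :: nat and i :: int
  have "AE x in M. \<forall>m i N j. x \<in> E m i \<inter> ball undefined (real j) \<longrightarrow>
      (\<exists>k\<ge>N::nat. avg M (ball x (2 powr - real k)) (indicator (- E m i)) \<le> ennreal g)"
    unfolding AE_all_countable E_def
    by (intro allI weak_density_bounded g) measurable
  then show ?thesis
  proof eventually_elim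
    case (elim x)
    show ?case
    proof (intro allI impI)
      fix d :: real and N :: nat assume "0 < d"
      then obtain m where m: "1 / real (Suc m) < d"
        using nat_approx_posE by blast
      define i where "i = \<lfloor>real (Suc m) * u x\<rfloor>"
      obtain j :: nat where "dist undefined x < real j"
        using reals_Archimedean2 by blast
      then have "x \<in> E m i \<inter> ball undefined (real j)"
        by (auto simp: E_def i_def)
      then obtain k where k: "N \<le> k" "avg M (ball x (2 powr - real k)) (indicator (- E m i)) \<le> ennreal g"
        using elim by blast
      have "y \<notin> E m i" if y: "d < \<bar>u y - u x\<bar>" for y
      proof
        assume "y \<in> E m i"
        then have "\<lfloor>real (Suc m) * u y\<rfloor> = \<lfloor>real (Suc m) * u x\<rfloor>"
          by (simp add: E_def i_def)
        then have "\<bar>real (Suc m) * u y - real (Suc m) * u x\<bar> < 1"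
          by linarith
        then have "real (Suc m) * \<bar>u y - u x\<bar> < 1"
          by (simp add: abs_mult flip: right_diff_distrib)
        moreover have "1 < real (Suc m) * d"
          using m by (simp add: field_simps)
        moreover have "real (Suc m) * d \<le> real (Suc m) * \<bar>u y - u x\<bar>"
          using y by (intro mult_left_mono) auto
        ultimately show False by linarith
      qed
      then have "avg M (ball x (2 powr - real k)) (indicator {y. d < \<bar>u y - u x\<bar>})
          \<le> avg M (ball x (2 powr - real k)) (indicator (- E m i))"
        by (intro avg_mono) (auto split: split_indicator)
      then show "\<exists>k\<ge>N. avg M (ball x (2 powr - real k)) (indicator {y. d < \<bar>u y - u x\<bar>}) \<le> ennreal g"
        using k by (intro exI[of _ k]) auto
    qed
  qed
qed

end

section \<open>Oscillation functionals\<close>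

lemma ennreal_le_cmult_iff: "0 < K \<Longrightarrow> x \<le> ennreal K * y \<longleftrightarrow> ennreal (1 / K) * x \<le> y"
proof
  assume K: "0 < K"
  have 1: "ennreal (1 / K) * (ennreal K * z) = z" "ennreal K * (ennreal (1 / K) * z) = z" for z
    using K by (simp_all add: mult.assoc[symmetric] flip: ennreal_mult)
  show "x \<le> ennreal K * y \<Longrightarrow> ennreal (1 / K) * x \<le> y"
    using mult_left_mono[of x "ennreal K * y" "ennreal (1 / K)"] by (simp add: 1)
  show "ennreal (1 / K) * x \<le> y \<Longrightarrow> x \<le> ennreal K * y"
    using mult_left_mono[of "ennreal (1 / K) * x" y "ennreal K"] by (simp add: 1)
qed

lemma le_cmult_INF:
  assumes "0 < K" "\<And>c. c \<in> I \<Longrightarrow> x \<le> ennreal K * f c"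
  shows "x \<le> ennreal K * (INF c\<in>I. f c)"
  using assms by (simp add: ennreal_le_cmult_iff INF_greatest)

lemma Lp_norm_cmult_eq:
  assumes "0 < p" "f \<in> borel_measurable M" "0 < c"
  shows "Lp_norm M p (\<lambda>x. ennreal c * f x) = ennreal c * Lp_norm M p f"
proof (rule antisym)
  have "Lp_norm M p (\<lambda>x. ennreal (1 / c) * (ennreal c * f x))
      \<le> ennreal (1 / c) * Lp_norm M p (\<lambda>x. ennreal c * f x)"
    using assms by (intro Lp_norm_cmult) auto
  then show "ennreal c * Lp_norm M p f \<le> Lp_norm M p (\<lambda>x. ennreal c * f x)"
    using assms(3) ennreal_le_cmult_iff[of "1 / c" "Lp_norm M p f"]
    by (simp add: mult.assoc[symmetric] flip: ennreal_mult)
qed (rule Lp_norm_cmult[OF assms(1,2)])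

lemma Lp_norm_finite_AE:
  assumes "0 < p" and [measurable]: "f \<in> borel_measurable M" and "Lp_norm M p f < \<infinity>"
  shows "AE x in M. f x < \<infinity>"
proof (cases "p = \<infinity>")
  case True
  then have "esssup M f < \<infinity>"
    using assms(3) by (simp add: Lp_norm_def)
  then show ?thesis
    using esssup_AE[of f M] by (auto intro: le_less_trans elim: eventually_mono)
next
  case False
  then have "(\<integral>\<^sup>+x. epow (f x) (enn2real p) \<partial>M) < \<infinity>"
    using assms(3) by (simp add: Lp_norm_def epow_less_top_iff)
  then have "AE x in M. epow (f x) (enn2real p) \<noteq> \<infinity>"
    by (intro nn_integral_PInf_AE) auto
  then show ?thesis
    by eventually_elim (metis epow_top infinity_ennreal_def top.not_eq_extremum)
qed

lemma abs_add_powr_le: "0 < a \<Longrightarrow> \<bar>x + y\<bar> powr a \<le> 2 powr a * (\<bar>x\<bar> powr a + \<bar>y\<bar> powr (a::real))"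
proof -
  assume a: "0 < a"
  have "\<bar>x + y\<bar> powr a \<le> (2 * max \<bar>x\<bar> \<bar>y\<bar>) powr a"
    using a by (intro powr_mono2) auto
  also have "\<dots> = 2 powr a * (max \<bar>x\<bar> \<bar>y\<bar>) powr a"
    by (simp add: powr_mult)
  also have "(max \<bar>x\<bar> \<bar>y\<bar>) powr a \<le> \<bar>x\<bar> powr a + \<bar>y\<bar> powr a"
    by (auto simp: max_def)
  finally show ?thesis by simp
qed

lemma ennreal_abs_diff_powr_le:
  assumes "0 < a"
  shows "ennreal (\<bar>x - z\<bar> powr a) \<le> ennreal (2 powr a) * (ennreal (\<bar>x - y\<bar> powr a) + ennreal (\<bar>y - z\<bar> powr a))"
  using abs_add_powr_le[OF assms, of "x - y" "y - z"]
  by (simp flip: ennreal_plus ennreal_mult add: ennreal_leI)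

context doubling_metric_measure
begin

text \<open>The functional without the weight t^(-s), and with the point as last argument so that
  \<open>oscC \<sigma> u t\<close> is a function on the space; likewise for the other oscillations
  below.\<close>

definition oscC :: "real \<Rightarrow> ('a \<Rightarrow> real) \<Rightarrow> real \<Rightarrow> 'a \<Rightarrow> ennreal" where
  "oscC \<sigma> u t x = epow (avg M (ball x t) (\<lambda>y. ennreal (\<bar>u x - u y\<bar> powr \<sigma>))) (1 / \<sigma>)"

definition oscI :: "real \<Rightarrow> ('a \<Rightarrow> real) \<Rightarrow> real \<Rightarrow> 'a \<Rightarrow> ennreal" where
  "oscI \<sigma> u t x = epow (INF c::real. avg M (ball x t) (\<lambda>y. ennreal (\<bar>u y - c\<bar> powr \<sigma>))) (1 / \<sigma>)"

lemma vecC_eq: "vecC M s \<sigma> u x t = ennreal (t powr - s) * oscC \<sigma> u t x"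
  and vecI_eq: "vecI M s \<sigma> u x t = ennreal (t powr - s) * oscI \<sigma> u t x"
  and vecS_eq: "vecS M s \<epsilon> \<sigma> u x t
    = ennreal (t powr (\<epsilon> - s)) * (SUP r\<in>{0<..t}. ennreal (r powr - \<epsilon>) * oscI \<sigma> u r x)"
  by (simp_all add: vecC_def oscC_def vecI_def oscI_def vecS_def)

lemma measurable_oscC [measurable]:
  assumes [measurable]: "u \<in> borel_measurable M"
  shows "oscC \<sigma> u t \<in> borel_measurable M"
  unfolding oscC_def by (intro measurable_epow measurable_avg) measurable

text \<open>Measurability in x asks for a countable infimum. Rational constants tending to c from
  above approximate the average by dominated convergence when it is finite at c; when it is
  infinite, or when the ball is empty and all averages vanish, there is nothing to
  approximate.\<close>

lemma INF_avg_eq_INF_rat: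
  assumes u [measurable]: "u \<in> borel_measurable M" and \<sigma>: "0 < \<sigma>"
  shows "(INF c::real. avg M (ball x r) (\<lambda>y. ennreal (\<bar>u y - c\<bar> powr \<sigma>)))
    = (INF c\<in>\<rat>. avg M (ball x r) (\<lambda>y. ennreal (\<bar>u y - c\<bar> powr \<sigma>)))" (is "?L = ?R")
proof (rule antisym)
  show "?L \<le> ?R"
    by (rule INF_superset_mono) auto
  show "?R \<le> ?L"
  proof (rule INF_greatest)
    fix c :: real
    let ?f = "\<lambda>c y. ennreal (\<bar>u y - c\<bar> powr \<sigma>) * indicator (ball x r) y"
    let ?m = "emeasure M (ball x r)"
    show "?R \<le> avg M (ball x r) (\<lambda>y. ennreal (\<bar>u y - c\<bar> powr \<sigma>))"
    proof (cases "0 < r \<and> (\<integral>\<^sup>+y. ?f c y \<partial>M) < \<infinity>")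
      case False
      then have "r \<le> 0 \<or> (\<integral>\<^sup>+y. ?f c y \<partial>M) = \<infinity>"
        by (auto simp: top.not_eq_extremum)
      then show ?thesis
      proof
        assume "r \<le> 0"
        then have "?R \<le> avg M (ball x r) (\<lambda>y. ennreal (\<bar>u y - 0\<bar> powr \<sigma>))"
          by (intro INF_lower) auto
        with \<open>r \<le> 0\<close> show ?thesis
          by (simp add: ball_empty avg_def)
      next
        assume "(\<integral>\<^sup>+y. ?f c y \<partial>M) = \<infinity>"
        then show ?thesis
          by (simp add: avg_def ennreal_top_divide)
      qed
    next
      case True
      then have r: "0 < r" and fin: "(\<integral>\<^sup>+y. ?f c y \<partial>M) < \<infinity>" by auto
      have "\<exists>q\<in>\<rat>. c < q \<and> q < c + 1 / real (Suc i)" for i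
        by (rule Rats_dense_in_real) simp
      then obtain q where q: "\<And>i. q i \<in> \<rat>" "\<And>i. c < q i" "\<And>i. q i < c + 1 / real (Suc i)"
        by metis
      have lim: "q \<longlonglongrightarrow> c"
      proof (rule tendsto_sandwich[OF _ _ tendsto_const])
        show "(\<lambda>i. c + 1 / real (Suc i)) \<longlonglongrightarrow> c"
          using tendsto_add[OF tendsto_const LIMSEQ_inverse_real_of_nat, of c] by (simp add: inverse_eq_divide)
        show "\<forall>\<^sub>F i in sequentially. c \<le> q i" "\<forall>\<^sub>F i in sequentially. q i \<le> c + 1 / real (Suc i)"
          using q by (intro always_eventually allI less_imp_le; simp)+
      qed
      have "(\<lambda>i. \<integral>\<^sup>+y. ?f (q i) y \<partial>M) \<longlonglongrightarrow> (\<integral>\<^sup>+y. ?f c y \<partial>M)"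
      proof (rule nn_integral_dominated_convergence)
        \<comment> \<open>The rational constants stay within distance 1 of c, whence the summand 1
          on the ball.\<close>
        let ?w = "\<lambda>y. ennreal (2 powr \<sigma>) * (?f c y + indicator (ball x r) y)"
        show "?w \<in> borel_measurable M" by measurable
        show "(\<integral>\<^sup>+y. ?w y \<partial>M) < \<infinity>"
          using fin by (simp add: nn_integral_cmult nn_integral_add ennreal_mult_eq_top_iff less_top[symmetric])
        show "AE y in M. ?f (q i) y \<le> ?w y" for i
        proof (rule AE_I2)
          fix y
          have "1 / real (Suc i) \<le> 1" by simp
          then have "\<bar>c - q i\<bar> \<le> 1"
            using q(2,3)[of i] by linarith
          then have "\<bar>c - q i\<bar> powr \<sigma> \<le> 1 powr \<sigma>"
            using \<sigma> by (intro powr_mono2) auto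
          then have "ennreal (\<bar>c - q i\<bar> powr \<sigma>) \<le> 1"
            by simp
          then have "ennreal (\<bar>u y - q i\<bar> powr \<sigma>) \<le> ennreal (2 powr \<sigma>) * (ennreal (\<bar>u y - c\<bar> powr \<sigma>) + 1)"
            using ennreal_abs_diff_powr_le[OF \<sigma>, of "u y" "q i" c]
            by (meson add_left_mono mult_left_mono order_trans zero_le)
          then show "?f (q i) y \<le> ?w y"
            by (auto split: split_indicator)
        qed
        show "AE y in M. (\<lambda>i. ?f (q i) y) \<longlonglongrightarrow> ?f c y"
        proof (rule AE_I2)
          fix y
          have "(\<lambda>i. \<bar>u y - q i\<bar> powr \<sigma>) \<longlonglongrightarrow> \<bar>u y - c\<bar> powr \<sigma>"
            using \<sigma> lim by (intro tendsto_powr' tendsto_intros) auto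
          then show "(\<lambda>i. ?f (q i) y) \<longlonglongrightarrow> ?f c y"
            by (auto intro!: tendsto_ennrealI split: split_indicator)
        qed
      qed measurable
      moreover have "?R * ?m \<le> (\<integral>\<^sup>+y. ?f (q i) y \<partial>M)" for i
      proof -
        have "?R * ?m \<le> avg M (ball x r) (\<lambda>y. ennreal (\<bar>u y - q i\<bar> powr \<sigma>)) * ?m"
          using q(1)[of i] by (intro mult_right_mono INF_lower) auto
        also have "\<dots> = (\<integral>\<^sup>+y. ?f (q i) y \<partial>M)"
          using r by (simp add: avg_def ennreal_divide_times ennreal_mult_divide_eq)
        finally show ?thesis .
      qed
      ultimately have "?R * ?m \<le> (\<integral>\<^sup>+y. ?f c y \<partial>M)"
        by (intro LIMSEQ_le_const) auto
      then have "?R * ?m / ?m \<le> avg M (ball x r) (\<lambda>y. ennreal (\<bar>u y - c\<bar> powr \<sigma>))"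
        unfolding avg_def by (rule divide_right_mono_ennreal)
      then show ?thesis
        using r by (simp add: ennreal_mult_divide_eq)
    qed
  qed
qed

lemma measurable_oscI [measurable]:
  assumes [measurable]: "u \<in> borel_measurable M" and \<sigma>: "0 < \<sigma>"
  shows "oscI \<sigma> u t \<in> borel_measurable M"
proof -
  have "(\<lambda>x. INF c\<in>\<rat>. avg M (ball x t) (\<lambda>y. ennreal (\<bar>u y - c\<bar> powr \<sigma>))) \<in> borel_measurable M"
    by (intro borel_measurable_INF countable_rat measurable_avg) measurable
  then show ?thesis
    unfolding oscI_def INF_avg_eq_INF_rat[OF assms] by (rule measurable_epow)
qed

definition root_dbl :: "real \<Rightarrow> real \<Rightarrow> real" where
  "root_dbl L \<sigma> = dbl L powr (1 / \<sigma>)"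

lemma root_dbl_pos: "0 < L \<Longrightarrow> 0 < root_dbl L \<sigma>"
  using dbl_pos[of L] by (simp add: root_dbl_def)

lemma epow_root_dbl:
  assumes "0 < L" "0 < \<sigma>" "A \<le> ennreal (dbl L) * B"
  shows "epow A (1 / \<sigma>) \<le> ennreal (root_dbl L \<sigma>) * epow B (1 / \<sigma>)"
proof -
  have "epow A (1 / \<sigma>) \<le> epow (ennreal (dbl L) * B) (1 / \<sigma>)"
    using assms by (intro epow_mono) auto
  then show ?thesis
    using assms dbl_pos[of L] by (simp add: epow_mult epow_ennreal root_dbl_def)
qed

lemma oscC_scale:
  assumes "0 < \<sigma>" "0 < t" "t \<le> t'" "t' \<le> L * t" "1 \<le> L"
  shows "oscC \<sigma> u t x \<le> ennreal (root_dbl L \<sigma>) * oscC \<sigma> u t' x"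
  unfolding oscC_def using assms by (intro epow_root_dbl avg_le_avg) auto

lemma oscI_le_oscI:
  assumes "0 < \<sigma>" "0 < t" "t' \<le> L * t" "1 \<le> L" "ball x t \<subseteq> ball x' t'"
  shows "oscI \<sigma> u t x \<le> ennreal (root_dbl L \<sigma>) * oscI \<sigma> u t' x'"
proof -
  have "(INF c::real. avg M (ball x t) (\<lambda>y. ennreal (\<bar>u y - c\<bar> powr \<sigma>)))
      \<le> ennreal (dbl L) * (INF c::real. avg M (ball x' t') (\<lambda>y. ennreal (\<bar>u y - c\<bar> powr \<sigma>)))"
    (is "?A \<le> _")
  proof (rule le_cmult_INF)
    fix c :: real
    have "?A \<le> avg M (ball x t) (\<lambda>y. ennreal (\<bar>u y - c\<bar> powr \<sigma>))"
      by (rule INF_lower) simp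
    also have "\<dots> \<le> ennreal (dbl L) * avg M (ball x' t') (\<lambda>y. ennreal (\<bar>u y - c\<bar> powr \<sigma>))"
      using assms by (intro avg_le_avg) auto
    finally show "?A \<le> ennreal (dbl L) * avg M (ball x' t') (\<lambda>y. ennreal (\<bar>u y - c\<bar> powr \<sigma>))" .
  qed (use assms dbl_pos in auto)
  then show ?thesis
    unfolding oscI_def using assms by (intro epow_root_dbl) auto
qed

lemma oscI_scale:
  assumes "0 < \<sigma>" "0 < t" "t \<le> t'" "t' \<le> L * t" "1 \<le> L"
  shows "oscI \<sigma> u t x \<le> ennreal (root_dbl L \<sigma>) * oscI \<sigma> u t' x"
  using assms by (intro oscI_le_oscI) auto

lemma oscI_le_oscC: "0 < \<sigma> \<Longrightarrow> oscI \<sigma> u t x \<le> oscC \<sigma> u t x"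
  unfolding oscI_def oscC_def
  by (intro epow_mono INF_lower2[of "u x"]) (auto simp: abs_minus_commute)

text \<open>Hoelder's inequality up to a constant: split according to whether \<open>f\<close> exceeds its
  \<open>b\<close>-average.\<close>

lemma avg_powr_le:
  assumes [measurable]: "f \<in> borel_measurable M" and ab: "0 < a" "a \<le> b" and r: "0 < r"
  shows "epow (avg M (ball x r) (\<lambda>y. ennreal (\<bar>f y\<bar> powr a))) (1 / a)
    \<le> ennreal (2 powr (1 / a)) * epow (avg M (ball x r) (\<lambda>y. ennreal (\<bar>f y\<bar> powr b))) (1 / b)"
proof -
  let ?B = "avg M (ball x r) (\<lambda>y. ennreal (\<bar>f y\<bar> powr b))"
  let ?A = "avg M (ball x r) (\<lambda>y. ennreal (\<bar>f y\<bar> powr a))"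
  have b: "0 < b" using ab by simp
  have A: "?A \<le> ennreal (2 * l powr a)" if l: "0 < l" "?B \<le> ennreal (l powr b)" for l
  proof -
    \<comment> \<open>Below the level l the first summand dominates; above it |f|^a = |f|^(a-b)
      |f|^b, and the exponent a - b is nonpositive.\<close>
    have "\<bar>f y\<bar> powr a \<le> l powr a + l powr (a - b) * \<bar>f y\<bar> powr b" for y
    proof (cases "\<bar>f y\<bar> \<le> l")
      case True
      then have "\<bar>f y\<bar> powr a \<le> l powr a"
        using ab by (intro powr_mono2) auto
      then show ?thesis by (simp add: add_increasing2)
    next
      case False
      then have "\<bar>f y\<bar> powr (a - b) \<le> l powr (a - b)"
        using ab l by (intro powr_mono2') auto
      moreover have "\<bar>f y\<bar> powr a = \<bar>f y\<bar> powr (a - b) * \<bar>f y\<bar> powr b"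
        by (simp flip: powr_add)
      ultimately have "\<bar>f y\<bar> powr a \<le> l powr (a - b) * \<bar>f y\<bar> powr b"
        by (simp add: mult_right_mono)
      then show ?thesis by (simp add: add_increasing)
    qed
    then have "?A \<le> avg M (ball x r) (\<lambda>y. ennreal (l powr a) + ennreal (l powr (a - b)) * ennreal (\<bar>f y\<bar> powr b))"
      by (intro avg_mono) (simp add: ennreal_leI flip: ennreal_mult ennreal_plus)
    also have "\<dots> = ennreal (l powr a) + ennreal (l powr (a - b)) * ?B"
      using r by (simp add: avg_add avg_cmult)
    also have "\<dots> \<le> ennreal (l powr a) + ennreal (l powr (a - b)) * ennreal (l powr b)"
      using l by (intro add_left_mono mult_left_mono) auto
    also have "\<dots> = ennreal (2 * l powr a)"
      by (simp flip: ennreal_mult ennreal_plus powr_add)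
    finally show ?thesis .
  qed
  show ?thesis
  proof (cases "?B = \<infinity>")
    case True
    then show ?thesis by (simp add: ennreal_mult_top)
  next
    case False
    define l where "l = enn2real (epow ?B (1 / b))"
    have l: "epow ?B (1 / b) = ennreal l" "0 \<le> l"
      using False epow_less_top_iff[of ?B "1 / b"] by (auto simp: l_def less_top[symmetric])
    then have B: "?B = ennreal (l powr b)"
      using epow_inverse'[of b ?B] b by (simp add: epow_ennreal)
    have "epow ?A (1 / a) \<le> ennreal (2 powr (1 / a) * l) + ennreal e" if e: "0 < e" for e :: real
    proof -
      \<comment> \<open>The bound \<open>A\<close> asks for a positive level, and l may vanish; the
        increment is scaled so that the final excess is exactly e.\<close>
      define l' where "l' = l + e / 2 powr (1 / a)"
      have l': "0 < l'" "?B \<le> ennreal (l' powr b)"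
        using e l b unfolding B by (auto simp: l'_def intro!: ennreal_leI powr_mono2 add_nonneg_pos)
      have "epow ?A (1 / a) \<le> epow (ennreal (2 * l' powr a)) (1 / a)"
        using A[OF l'] ab by (intro epow_mono) auto
      also have "\<dots> = ennreal (2 powr (1 / a) * l + e)"
        using l' ab by (simp add: epow_ennreal powr_mult powr_powr) (simp add: l'_def distrib_left)
      finally show ?thesis
        using e l by simp
    qed
    then have "epow ?A (1 / a) \<le> ennreal (2 powr (1 / a) * l)"
      by (rule ennreal_le_epsilon)
    then show ?thesis
      using l by (simp add: ennreal_mult)
  qed
qed

lemma oscC_mono_exponent:
  assumes "u \<in> borel_measurable M" "0 < \<sigma>" "\<sigma> \<le> \<tau>" "0 < t"
  shows "oscC \<sigma> u t x \<le> ennreal (2 powr (1 / \<sigma>)) * oscC \<tau> u t x"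
  unfolding oscC_def using assms by (intro avg_powr_le) auto

lemma oscI_mono_exponent:
  assumes "u \<in> borel_measurable M" "0 < \<sigma>" "\<sigma> \<le> \<tau>" "0 < t"
  shows "oscI \<sigma> u t x \<le> ennreal (2 powr (1 / \<sigma>)) * oscI \<tau> u t x"
proof -
  have "oscI \<sigma> u t x \<le> ennreal (2 powr (1 / \<sigma>)) * epow (avg M (ball x t) (\<lambda>y. ennreal (\<bar>u y - c\<bar> powr \<tau>))) (1 / \<tau>)" for c
  proof -
    have "oscI \<sigma> u t x \<le> epow (avg M (ball x t) (\<lambda>y. ennreal (\<bar>u y - c\<bar> powr \<sigma>))) (1 / \<sigma>)"
      unfolding oscI_def using assms by (intro epow_mono INF_lower) auto
    also have "\<dots> \<le> ennreal (2 powr (1 / \<sigma>)) * epow (avg M (ball x t) (\<lambda>y. ennreal (\<bar>u y - c\<bar> powr \<tau>))) (1 / \<tau>)"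
      using assms by (intro avg_powr_le) auto
    finally show ?thesis .
  qed
  then have "epow (ennreal (1 / 2 powr (1 / \<sigma>)) * oscI \<sigma> u t x) \<tau>
      \<le> (INF c. avg M (ball x t) (\<lambda>y. ennreal (\<bar>u y - c\<bar> powr \<tau>)))"
    using assms by (intro INF_greatest) (simp add: ennreal_le_cmult_iff flip: epow_le_iff[of "1 / \<tau>" "epow _ \<tau>"])
  then show ?thesis
    using assms epow_le_iff[of "1 / \<tau>" "epow _ \<tau>"]
    by (subst ennreal_le_cmult_iff) (auto simp: oscI_def[of \<tau>])
qed

end

lemma epow_max: "0 < a \<Longrightarrow> epow (max x y) a = max (epow x a) (epow y a)"
  by (simp add: max_def epow_le_iff)

lemma enn2real_exponent_pos: "0 < p \<Longrightarrow> p \<noteq> \<infinity> \<Longrightarrow> 0 < enn2real p"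
  by (simp add: enn2real_positive_iff top.not_eq_extremum)

context doubling_metric_measure
begin

text \<open>The inner essential supremum of the Besov functional for p = \<infinity>, where it takes
  the place of \<open>oscC\<close>.\<close>

definition local_osc :: "('a \<Rightarrow> real) \<Rightarrow> real \<Rightarrow> 'a \<Rightarrow> ennreal" where
  "local_osc u t x = esssup (restrict_space M (ball x t)) (\<lambda>y. ennreal \<bar>u x - u y\<bar>)"

lemma local_osc_le_iff:
  assumes [measurable]: "u \<in> borel_measurable M"
  shows "local_osc u t x \<le> a \<longleftrightarrow> (AE y in M. y \<in> ball x t \<longrightarrow> ennreal \<bar>u x - u y\<bar> \<le> a)"
proof -
  let ?R = "restrict_space M (ball x t)"
  have meas: "(\<lambda>y. ennreal \<bar>u x - u y\<bar>) \<in> borel_measurable ?R"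
    by (intro measurable_restrict_space1) measurable
  have "local_osc u t x \<le> a \<longleftrightarrow> (AE y in ?R. ennreal \<bar>u x - u y\<bar> \<le> a)"
  proof
    assume "local_osc u t x \<le> a"
    then show "AE y in ?R. ennreal \<bar>u x - u y\<bar> \<le> a"
      using esssup_AE[of "\<lambda>y. ennreal \<bar>u x - u y\<bar>" ?R] unfolding local_osc_def
      by (auto elim!: eventually_mono)
  qed (unfold local_osc_def, rule esssup_I[OF meas])
  also have "\<dots> \<longleftrightarrow> (AE y in M. y \<in> ball x t \<longrightarrow> ennreal \<bar>u x - u y\<bar> \<le> a)"
    by (rule AE_restrict_space_iff) simp
  finally show ?thesis .
qed

text \<open>The bound \<open>local_osc u t x \<le> a\<close> says that the points y of the ball with
  |u(x) - u(y)| > a form a null set, that is, that an integral in y vanishes; such an integral is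
  measurable in x by Tonelli.\<close>

lemma measurable_local_osc [measurable]:
  assumes [measurable]: "u \<in> borel_measurable M"
  shows "local_osc u t \<in> borel_measurable M"
proof (rule borel_measurableI_le)
  fix a :: ennreal
  have "(\<lambda>x. \<integral>\<^sup>+y. indicator {a<..} (ennreal \<bar>u x - u y\<bar>) * indicator (ball x t) y \<partial>M)
      \<in> borel_measurable M"
    by (rule measurable_nn_integral_snd) measurable
  then have "{x \<in> space M. (\<integral>\<^sup>+y. indicator {a<..} (ennreal \<bar>u x - u y\<bar>) * indicator (ball x t) y \<partial>M) = 0} \<in> sets M"
    by measurable
  moreover have "(\<integral>\<^sup>+y. indicator {a<..} (ennreal \<bar>u x - u y\<bar>) * indicator (ball x t) y \<partial>M) = 0
      \<longleftrightarrow> local_osc u t x \<le> a" for x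
  proof -
    have "(\<lambda>y. indicator {a<..} (ennreal \<bar>u x - u y\<bar>) * indicator (ball x t) y :: ennreal) \<in> borel_measurable M"
      by measurable
    from nn_integral_0_iff_AE[OF this] show ?thesis
      unfolding local_osc_le_iff[OF assms] by (auto simp: indicator_def not_le[symmetric] cong: if_cong)
  qed
  ultimately show "{x \<in> space M. local_osc u t x \<le> a} \<in> sets M"
    by simp
qed

lemma Besov_osc_infinity: "Besov_osc M top u t = esssup M (local_osc u t)"
  by (simp add: Besov_osc_def local_osc_def[abs_def])

lemma Besov_osc_finite:
  assumes "0 < p" "p \<noteq> \<infinity>"
  shows "Besov_osc M p u t = Lp_norm M p (oscC (enn2real p) u t)"
  using assms enn2real_exponent_pos[OF assms] by (simp add: Besov_osc_def Lp_norm_def oscC_def)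

lemma Besov_osc_scale:
  assumes [measurable]: "u \<in> borel_measurable M" and p: "0 < p" and t: "0 < t" "t \<le> t'" "t' \<le> 2 * t"
  shows "Besov_osc M p u t \<le> ennreal (if p = \<infinity> then 1 else root_dbl 2 (enn2real p)) * Besov_osc M p u t'"
proof (cases "p = \<infinity>")
  case True
  have "local_osc u t x \<le> local_osc u t' x" for x
  proof -
    have "AE y in M. y \<in> ball x t' \<longrightarrow> ennreal \<bar>u x - u y\<bar> \<le> local_osc u t' x"
      using local_osc_le_iff[of u t' x "local_osc u t' x"] by simp
    then show ?thesis
      unfolding local_osc_le_iff[OF assms(1)] by eventually_elim (use t in auto)
  qed
  then show ?thesis
    using True by (auto simp: Besov_osc_infinity intro!: esssup_mono)
next
  case False
  note P = enn2real_exponent_pos[OF p False]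
  have "Lp_norm M p (oscC (enn2real p) u t)
      \<le> Lp_norm M p (\<lambda>x. ennreal (root_dbl 2 (enn2real p)) * oscC (enn2real p) u t' x)"
    using p t P False by (intro Lp_norm_mono) (auto intro!: oscC_scale)
  also have "\<dots> \<le> ennreal (root_dbl 2 (enn2real p)) * Lp_norm M p (oscC (enn2real p) u t')"
    using p by (intro Lp_norm_cmult) auto
  finally show ?thesis
    using False p by (simp add: Besov_osc_finite)
qed

text \<open>Hoelder's inequality on each ball; for p = \<infinity> an average is bounded by the
  essential supremum.\<close>

lemma Lp_norm_oscC_le_Besov_osc:
  assumes [measurable]: "u \<in> borel_measurable M" and \<sigma>: "0 < \<sigma>" "ennreal \<sigma> \<le> p" and t: "0 < t"
  shows "Lp_norm M p (oscC \<sigma> u t) \<le> ennreal (2 powr (1 / \<sigma>)) * Besov_osc M p u t"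
proof (cases "p = \<infinity>")
  case True
  have "oscC \<sigma> u t x \<le> local_osc u t x" for x
  proof -
    have "AE y in M. y \<in> ball x t \<longrightarrow> ennreal \<bar>u x - u y\<bar> \<le> local_osc u t x"
      using local_osc_le_iff[of u t x "local_osc u t x"] by simp
    then have "avg M (ball x t) (\<lambda>y. ennreal (\<bar>u x - u y\<bar> powr \<sigma>)) \<le> avg M (ball x t) (\<lambda>y. epow (local_osc u t x) \<sigma>)"
      by (intro avg_mono_AE, eventually_elim)
        (use \<sigma> in \<open>auto simp: epow_ennreal_abs_powr[symmetric] intro!: epow_mono\<close>)
    then show ?thesis
      using t \<sigma> by (simp add: oscC_def epow_le_iff_root)
  qed
  then have "esssup M (oscC \<sigma> u t) \<le> 1 * esssup M (local_osc u t)"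
    by (auto intro!: esssup_mono)
  also have "\<dots> \<le> ennreal (2 powr (1 / \<sigma>)) * esssup M (local_osc u t)"
    using \<sigma> by (intro mult_right_mono) (auto simp: ge_one_powr_ge_zero)
  finally show ?thesis
    using True by (simp add: Besov_osc_infinity Lp_norm_def)
next
  case False
  have p: "0 < p"
    using less_le_trans[of 0 "ennreal \<sigma>" p] \<sigma> by simp
  have \<sigma>p: "\<sigma> \<le> enn2real p"
    using \<sigma> False enn2real_mono[of "ennreal \<sigma>" p] by (simp add: less_top[symmetric])
  have "Lp_norm M p (oscC \<sigma> u t) \<le> Lp_norm M p (\<lambda>x. ennreal (2 powr (1 / \<sigma>)) * oscC (enn2real p) u t x)"
    using p \<sigma> t \<sigma>p False by (intro Lp_norm_mono) (auto intro!: oscC_mono_exponent)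
  also have "\<dots> \<le> ennreal (2 powr (1 / \<sigma>)) * Lp_norm M p (oscC (enn2real p) u t)"
    using p by (intro Lp_norm_cmult) auto
  finally show ?thesis
    using False p by (simp add: Besov_osc_finite)
qed

definition pair_const :: "real \<Rightarrow> real" where
  "pair_const \<sigma> = (2 * 2 powr \<sigma> * dbl 2) powr (1 / \<sigma>)"

lemma pair_const_pos: "0 < \<sigma> \<Longrightarrow> 0 < pair_const \<sigma>"
  using dbl_pos[of 2] by (simp add: pair_const_def)

text \<open>The triangle inequality through an intermediate point averaged over
  \<open>ball x t\<close>, which is contained in the doubled balls about both x and y. As the left
  side is the bare difference, it can afterwards be raised to any power p, however small \<sigma>
  is.\<close>

lemma abs_diff_le_oscC:
  assumes [measurable]: "u \<in> borel_measurable M" and \<sigma>: "0 < \<sigma>" and t: "0 < t" and y: "y \<in> ball x t"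
  shows "ennreal \<bar>u x - u y\<bar> \<le> ennreal (pair_const \<sigma>) * max (oscC \<sigma> u (2 * t) x) (oscC \<sigma> u (2 * t) y)"
proof -
  let ?m = "\<lambda>z t v. avg M (ball z t) (\<lambda>w. ennreal (\<bar>u v - u w\<bar> powr \<sigma>))"
  have "ennreal (\<bar>u x - u y\<bar> powr \<sigma>) = avg M (ball x t) (\<lambda>_. ennreal (\<bar>u x - u y\<bar> powr \<sigma>))"
    using t by simp
  also have "\<dots> \<le> avg M (ball x t) (\<lambda>z. ennreal (2 powr \<sigma>) * (ennreal (\<bar>u x - u z\<bar> powr \<sigma>) + ennreal (\<bar>u y - u z\<bar> powr \<sigma>)))"
    using ennreal_abs_diff_powr_le[OF \<sigma>, of "u x" "u y"]
    by (intro avg_mono) (simp add: abs_minus_commute[of "u y"])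
  also have "\<dots> = ennreal (2 powr \<sigma>) * (?m x t x + ?m x t y)"
    by (simp add: avg_cmult avg_add)
  also have "\<dots> \<le> ennreal (2 powr \<sigma>) * (ennreal (dbl 2) * ?m x (2 * t) x + ennreal (dbl 2) * ?m y (2 * t) y)"
  proof (intro mult_left_mono add_mono avg_le_avg)
    show "ball x t \<subseteq> ball y (2 * t)"
      using y dist_triangle[of y _ x] by (auto simp: dist_commute) (smt (verit) dist_commute dist_triangle)
  qed (use t in auto)
  also have "\<dots> \<le> ennreal (2 powr \<sigma>) * (ennreal (dbl 2) * max (?m x (2 * t) x) (?m y (2 * t) y)
      + ennreal (dbl 2) * max (?m x (2 * t) x) (?m y (2 * t) y))"
    by (intro mult_left_mono add_mono) auto
  also have "\<dots> = ennreal (2 * 2 powr \<sigma> * dbl 2) * max (?m x (2 * t) x) (?m y (2 * t) y)"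
    using dbl_pos[of 2] by (simp add: ennreal_mult mult_2[symmetric] mult_ac)
  finally have "epow (ennreal (\<bar>u x - u y\<bar> powr \<sigma>)) (1 / \<sigma>)
      \<le> epow (ennreal (2 * 2 powr \<sigma> * dbl 2) * max (?m x (2 * t) x) (?m y (2 * t) y)) (1 / \<sigma>)"
    using \<sigma> by (intro epow_mono) auto
  also have "\<dots> = ennreal (pair_const \<sigma>) * epow (max (?m x (2 * t) x) (?m y (2 * t) y)) (1 / \<sigma>)"
    using \<sigma> dbl_pos[of 2] by (simp add: epow_mult epow_ennreal pair_const_def)
  also have "epow (max (?m x (2 * t) x) (?m y (2 * t) y)) (1 / \<sigma>) = max (oscC \<sigma> u (2 * t) x) (oscC \<sigma> u (2 * t) y)"
    using \<sigma> by (simp add: oscC_def epow_max)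
  finally show ?thesis
    using \<sigma> by (simp add: epow_ennreal_abs_powr[symmetric])
qed

text \<open>The 1 accounts for the contribution of x, \<open>dbl 1\<close> for that of y, which is
  averaged over a ball before being integrated.\<close>

definition C_const :: "real \<Rightarrow> ennreal \<Rightarrow> real" where
  "C_const \<sigma> p = pair_const \<sigma> * (if p = \<infinity> then 1 else (1 + dbl 1) powr (1 / enn2real p))"

lemma C_const_pos: "0 < \<sigma> \<Longrightarrow> 0 < C_const \<sigma> p"
  using dbl_pos[of 1] pair_const_pos by (simp add: C_const_def)

text \<open>For finite p the pointwise bound \<open>abs_diff_le_oscC\<close> is raised to the power
  p, with the maximum replaced by a sum; the part in y is an average of p-th powers of
  \<open>oscC\<close>, integrated by \<open>nn_integral_avg_le\<close>.\<close>

lemma Besov_osc_le_Lp_norm_oscC: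
  assumes [measurable]: "u \<in> borel_measurable M" and \<sigma>: "0 < \<sigma>" and p: "0 < p" and t: "0 < t"
  shows "Besov_osc M p u t \<le> ennreal (C_const \<sigma> p) * Lp_norm M p (oscC \<sigma> u (2 * t))"
proof (cases "p = \<infinity>")
  case True
  let ?a = "esssup M (oscC \<sigma> u (2 * t))"
  have ae: "AE x in M. oscC \<sigma> u (2 * t) x \<le> ?a"
    by (rule esssup_AE)
  then have "AE x in M. local_osc u t x \<le> ennreal (pair_const \<sigma>) * ?a"
  proof eventually_elim
    case (elim x)
    show ?case
      unfolding local_osc_le_iff[OF assms(1)]
      using ae
    proof eventually_elim
      case (elim y)
      show ?case
      proof
        assume "y \<in> ball x t"
        then have "ennreal \<bar>u x - u y\<bar> \<le> ennreal (pair_const \<sigma>) * max (oscC \<sigma> u (2 * t) x) (oscC \<sigma> u (2 * t) y)"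
          using \<sigma> t by (intro abs_diff_le_oscC) auto
        also have "\<dots> \<le> ennreal (pair_const \<sigma>) * ?a"
          using \<open>oscC \<sigma> u (2 * t) x \<le> ?a\<close> elim by (intro mult_left_mono) auto
        finally show "ennreal \<bar>u x - u y\<bar> \<le> ennreal (pair_const \<sigma>) * ?a" .
      qed
    qed
  qed
  then show ?thesis
    using True by (auto simp: Besov_osc_infinity Lp_norm_def C_const_def intro!: esssup_I)
next
  case False
  define P where "P = enn2real p"
  have P: "0 < P"
    using enn2real_exponent_pos[OF p False] by (simp add: P_def)
  define f where "f x = epow (oscC \<sigma> u (2 * t) x) P" for x
  have [measurable]: "f \<in> borel_measurable M"
    unfolding f_def by measurable
  have le: "avg M (ball x t) (\<lambda>y. ennreal (\<bar>u x - u y\<bar> powr P))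
      \<le> ennreal (pair_const \<sigma> powr P) * (f x + avg M (ball x t) f)" for x
  proof -
    have "avg M (ball x t) (\<lambda>y. ennreal (\<bar>u x - u y\<bar> powr P))
        \<le> avg M (ball x t) (\<lambda>y. ennreal (pair_const \<sigma> powr P) * (f x + f y))"
    proof (rule avg_mono)
      fix y assume "y \<in> ball x t"
      then have "epow (ennreal \<bar>u x - u y\<bar>) P
          \<le> epow (ennreal (pair_const \<sigma>) * max (oscC \<sigma> u (2 * t) x) (oscC \<sigma> u (2 * t) y)) P"
        using \<sigma> t P by (intro epow_mono abs_diff_le_oscC) auto
      also have "\<dots> = ennreal (pair_const \<sigma> powr P) * max (f x) (f y)"
        using P \<sigma> pair_const_pos[of \<sigma>] by (simp add: epow_mult epow_ennreal f_def epow_max)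
      also have "\<dots> \<le> ennreal (pair_const \<sigma> powr P) * (f x + f y)"
        by (intro mult_left_mono) (auto simp: max_def add_increasing add_increasing2)
      finally show "ennreal (\<bar>u x - u y\<bar> powr P) \<le> ennreal (pair_const \<sigma> powr P) * (f x + f y)"
        by (simp add: epow_ennreal_abs_powr)
    qed
    also have "\<dots> = ennreal (pair_const \<sigma> powr P) * (f x + avg M (ball x t) f)"
      using t by (simp add: avg_cmult avg_add)
    finally show ?thesis .
  qed
  have [measurable]: "(\<lambda>x. avg M (ball x t) f) \<in> borel_measurable M"
    by (rule measurable_avg) measurable
  have "(\<integral>\<^sup>+x. avg M (ball x t) (\<lambda>y. ennreal (\<bar>u x - u y\<bar> powr P)) \<partial>M)
      \<le> (\<integral>\<^sup>+x. ennreal (pair_const \<sigma> powr P) * (f x + avg M (ball x t) f) \<partial>M)"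
    by (intro nn_integral_mono le)
  also have "\<dots> = ennreal (pair_const \<sigma> powr P) * ((\<integral>\<^sup>+x. f x \<partial>M) + (\<integral>\<^sup>+x. avg M (ball x t) f \<partial>M))"
    by (simp add: nn_integral_cmult nn_integral_add)
  also have "\<dots> \<le> ennreal (pair_const \<sigma> powr P) * ((\<integral>\<^sup>+x. f x \<partial>M) + ennreal (dbl 1) * (\<integral>\<^sup>+x. f x \<partial>M))"
    using t by (intro mult_left_mono add_left_mono nn_integral_avg_le) auto
  also have "\<dots> = ennreal (pair_const \<sigma> powr P * (1 + dbl 1)) * (\<integral>\<^sup>+x. f x \<partial>M)"
    using dbl_pos[of 1] by (simp add: ennreal_mult distrib_right mult.assoc)
  finally have "Besov_osc M p u t \<le> epow (ennreal (pair_const \<sigma> powr P * (1 + dbl 1)) * (\<integral>\<^sup>+x. f x \<partial>M)) (1 / P)"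
    using False P by (simp add: Besov_osc_def P_def epow_mono)
  also have "\<dots> = ennreal (C_const \<sigma> p) * Lp_norm M p (oscC \<sigma> u (2 * t))"
    using False P dbl_pos[of 1] pair_const_pos[OF \<sigma>]
    by (simp add: epow_mult epow_ennreal Lp_norm_def C_const_def P_def f_def powr_mult powr_powr)
  finally show ?thesis .
qed

end

section \<open>Telescoping\<close>

text \<open>A number l strictly above S leaves room for near-minimisers in the infimum over
  constants and is positive even where the oscillation vanishes; letting l decrease to S loses
  nothing.\<close>

lemma le_cmult_by_approx:
  assumes K: "0 < K" and le: "\<And>l. 0 < l \<Longrightarrow> S < ennreal l \<Longrightarrow> A \<le> ennreal (K * l)"
  shows "A \<le> ennreal K * S"
proof (cases S)
  case (real r)
  have "A \<le> ennreal (K * r) + ennreal e" if e: "0 < e" for e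
  proof -
    have "A \<le> ennreal (K * (r + e / K))"
      using real e K by (intro le) (auto simp: ennreal_less_iff add_nonneg_pos)
    also have "\<dots> = ennreal (K * r) + ennreal e"
      using real e K by (simp add: distrib_left)
    finally show ?thesis .
  qed
  then have "A \<le> ennreal (K * r)"
    by (rule ennreal_le_epsilon)
  then show ?thesis
    using real K by (simp add: ennreal_mult)
qed (use K in \<open>simp add: ennreal_mult_top\<close>)

context doubling_metric_measure
begin

text \<open>Two sets whose densities in a ball add up to less than 1 cannot cover it; the point left
  over is what links two nearly optimal constants.\<close>

lemma avg_indicator_add_less_one:
  assumes r: "0 < r" and [measurable]: "A \<in> sets M" "B \<in> sets M"
    and less: "avg M (ball x r) (indicator A) + avg M (ball x r) (indicator B) < 1"
  obtains y where "y \<in> ball x r" "y \<notin> A" "y \<notin> B"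
proof (rule ccontr)
  assume "\<not> thesis"
  then have "avg M (ball x r) (\<lambda>_. 1) \<le> avg M (ball x r) (\<lambda>y. indicator A y + indicator B y)"
    using that by (intro avg_mono) (auto split: split_indicator)
  also have "\<dots> = avg M (ball x r) (indicator A) + avg M (ball x r) (indicator B)"
    by (intro avg_add) auto
  finally show False
    using less r by simp
qed

lemma avg_Chebyshev:
  assumes [measurable]: "u \<in> borel_measurable M" and pos: "0 < \<sigma>" "0 < a" "0 < L"
    and le: "avg M (ball x r) (\<lambda>y. ennreal (\<bar>u y - c\<bar> powr \<sigma>)) \<le> ennreal (a powr \<sigma>)"
  shows "avg M (ball x r) (indicator {y. L * a < \<bar>u y - c\<bar>}) \<le> ennreal (L powr - \<sigma>)"
proof -
  have "avg M (ball x r) (indicator {y. L * a < \<bar>u y - c\<bar>})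
      \<le> avg M (ball x r) (\<lambda>y. ennreal ((L * a) powr - \<sigma>) * ennreal (\<bar>u y - c\<bar> powr \<sigma>))"
  proof (rule avg_mono)
    fix y
    show "indicator {y. L * a < \<bar>u y - c\<bar>} y \<le> ennreal ((L * a) powr - \<sigma>) * ennreal (\<bar>u y - c\<bar> powr \<sigma>)"
    proof (cases "L * a < \<bar>u y - c\<bar>")
      case True
      have "1 = (L * a) powr - \<sigma> * (L * a) powr \<sigma>"
        using pos by (simp flip: powr_add)
      also have "\<dots> \<le> (L * a) powr - \<sigma> * \<bar>u y - c\<bar> powr \<sigma>"
        using True pos by (intro mult_left_mono powr_mono2) auto
      finally show ?thesis
        using True by (simp flip: ennreal_mult add: ennreal_1[symmetric] ennreal_leI del: ennreal_1)
    qed simp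
  qed
  also have "\<dots> \<le> ennreal ((L * a) powr - \<sigma>) * ennreal (a powr \<sigma>)"
    using le by (simp add: avg_cmult mult_left_mono)
  also have "\<dots> = ennreal (L powr - \<sigma>)"
    using pos by (simp add: powr_mult mult.assoc flip: ennreal_mult powr_add)
  finally show ?thesis .
qed

text \<open>Chosen so that the exceptional set of a near-optimal constant has density at most 1/(4
  (\<open>dbl 2\<close> + 1)). Halving the radius multiplies this by \<open>dbl 2\<close> at most,
  and the two densities met at each step still add up to only 1/4.\<close>

definition cheb :: "real \<Rightarrow> real" where
  "cheb \<sigma> = (4 * (dbl 2 + 1)) powr (1 / \<sigma>)"

lemma cheb_pos: "0 < cheb \<sigma>"
  using dbl_pos[of 2] by (simp add: cheb_def)

lemma cheb_powr: "0 < \<sigma> \<Longrightarrow> cheb \<sigma> powr - \<sigma> = 1 / (4 * (dbl 2 + 1))"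
  using dbl_pos[of 2] by (simp add: cheb_def powr_powr powr_minus_divide)

text \<open>In the order of the summands: from u(x) to a good point in a tiny ball, from there to
  the constant of that ball, and the geometric series of differences of consecutive
  constants.\<close>

definition tele :: "real \<Rightarrow> real \<Rightarrow> real" where
  "tele \<sigma> \<eta> = 1 + cheb \<sigma> + 2 * cheb \<sigma> / (1 - 2 powr - \<eta>)"

lemma tele_pos: "0 < \<eta> \<Longrightarrow> 0 < tele \<sigma> \<eta>"
proof -
  assume "0 < \<eta>"
  then have "2 powr - \<eta> < (1::real)"
    by (simp add: powr_less_one)
  then have "0 \<le> 2 * cheb \<sigma> / (1 - 2 powr - \<eta>)"
    using cheb_pos[of \<sigma>] by simp
  then show ?thesis
    using cheb_pos[of \<sigma>] by (simp add: tele_def)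
qed

lemma near_optimal_constant:
  assumes "0 < \<sigma>" "0 < a" "oscI \<sigma> u r x < ennreal a"
  obtains c where "avg M (ball x r) (\<lambda>y. ennreal (\<bar>u y - c\<bar> powr \<sigma>)) \<le> ennreal (a powr \<sigma>)"
proof -
  let ?I = "INF c::real. avg M (ball x r) (\<lambda>y. ennreal (\<bar>u y - c\<bar> powr \<sigma>))"
  have "?I < ennreal (a powr \<sigma>)"
  proof (rule ccontr)
    assume "\<not> ?thesis"
    then have "epow (ennreal (a powr \<sigma>)) (1 / \<sigma>) \<le> epow ?I (1 / \<sigma>)"
      using assms by (intro epow_mono) auto
    then show False
      using assms by (simp add: oscI_def epow_ennreal powr_powr)
  qed
  then show ?thesis
    using that by (auto simp: INF_less_iff intro: less_imp_le)
qed

text \<open>The constant c belongs to the largest ball and serves twice: the chain of constants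
  brings it close to u(x), and it is nearly optimal on that ball. Together the two bounds control
  the deviation of u from u(x).\<close>

lemma telescoping:
  assumes u [measurable]: "u \<in> borel_measurable M" and pos: "0 < \<sigma>" "0 < \<eta>" "0 < l"
    and density: "\<And>d N. 0 < d \<Longrightarrow>
      \<exists>m\<ge>N::nat. avg M (ball x (2 powr - real m)) (indicator {y. d < \<bar>u y - u x\<bar>}) \<le> ennreal (1 / 4)"
    and osc: "\<And>j::nat. ennreal (2 powr (\<eta> * real j)) * oscI \<sigma> u (2 powr (real_of_int k - real j)) x < ennreal l"
  shows "\<exists>c. \<bar>u x - c\<bar> \<le> tele \<sigma> \<eta> * l \<and>
    avg M (ball x (2 powr real_of_int k)) (\<lambda>y. ennreal (\<bar>u y - c\<bar> powr \<sigma>)) \<le> ennreal (l powr \<sigma>)"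
proof -
  define \<rho> where "\<rho> j = 2 powr (real_of_int k - real j)" for j
  \<comment> \<open>The admissible deviation at radius 2^(k-j): the weight in \<open>osc\<close>
    makes it decay like 2^(-\<eta> j).\<close>
  define a where "a j = 2 powr (- \<eta> * real j) * l" for j
  define L where "L = cheb \<sigma>"
  have L: "0 < L" "L powr - \<sigma> = 1 / (4 * (dbl 2 + 1))"
    using cheb_pos cheb_powr pos by (simp_all add: L_def)
  have a: "0 < a j" "a (Suc j) \<le> a j" for j
    using pos by (simp_all add: a_def)
  have \<rho>: "0 < \<rho> j" "\<rho> j = 2 * \<rho> (Suc j)" for j
    by (simp_all add: \<rho>_def powr_diff powr_add)
  have "\<exists>c. avg M (ball x (\<rho> j)) (\<lambda>y. ennreal (\<bar>u y - c\<bar> powr \<sigma>)) \<le> ennreal (a j powr \<sigma>)" for j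
  proof -
    have "oscI \<sigma> u (\<rho> j) x < ennreal (a j)"
    proof (rule ccontr)
      assume "\<not> ?thesis"
      then have "ennreal (2 powr (\<eta> * real j)) * ennreal (a j)
          \<le> ennreal (2 powr (\<eta> * real j)) * oscI \<sigma> u (\<rho> j) x"
        by (intro mult_left_mono) auto
      moreover have "2 powr (\<eta> * real j) * a j = l"
        by (simp add: a_def mult.assoc[symmetric] flip: powr_add)
      ultimately show False
        using osc[of j] a(1)[of j] by (simp add: \<rho>_def flip: ennreal_mult)
    qed
    then show ?thesis
      using near_optimal_constant[OF pos(1) a(1)] by metis
  qed
  then obtain c where c: "\<And>j. avg M (ball x (\<rho> j)) (\<lambda>y. ennreal (\<bar>u y - c j\<bar> powr \<sigma>)) \<le> ennreal (a j powr \<sigma>)"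
    by metis
  define bad where "bad j = {y \<in> space M. L * a j < \<bar>u y - c j\<bar>}" for j
  have [measurable]: "bad j \<in> sets M" for j
    unfolding bad_def by measurable
  have bad: "avg M (ball x (\<rho> j)) (indicator (bad j)) \<le> ennreal (1 / (4 * (dbl 2 + 1)))" for j
    using avg_Chebyshev[OF u pos(1) a(1) L(1) c[of j]] L by (simp add: bad_def)
  have step: "\<bar>c j - c (Suc j)\<bar> \<le> 2 * L * a j" for j
  proof -
    \<comment> \<open>Both exceptional sets are viewed in the smaller ball, where the one of the
      larger radius gains the factor \<open>dbl 2\<close>.\<close>
    have "avg M (ball x (\<rho> (Suc j))) (indicator (bad j)) \<le> ennreal (dbl 2) * avg M (ball x (\<rho> j)) (indicator (bad j))"
      using \<rho>[of j] \<rho>(1)[of "Suc j"] by (intro avg_le_avg) auto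
    also have "\<dots> \<le> ennreal (dbl 2) * ennreal (1 / (4 * (dbl 2 + 1)))"
      by (intro mult_left_mono bad) auto
    also have "\<dots> = ennreal (dbl 2 / (4 * (dbl 2 + 1)))"
      using dbl_pos[of 2] by (simp flip: ennreal_mult)
    finally have "avg M (ball x (\<rho> (Suc j))) (indicator (bad j)) + avg M (ball x (\<rho> (Suc j))) (indicator (bad (Suc j)))
        \<le> ennreal (dbl 2 / (4 * (dbl 2 + 1))) + ennreal (1 / (4 * (dbl 2 + 1)))"
      by (intro add_mono bad)
    also have "\<dots> = ennreal (1 / 4)"
    proof -
      have "dbl 2 / (4 * (dbl 2 + 1)) + 1 / (4 * (dbl 2 + 1)) = 1 / 4"
        using dbl_pos[of 2] by (simp add: divide_simps)
      then show ?thesis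
        using dbl_pos[of 2] by (simp flip: ennreal_plus)
    qed
    also have "\<dots> < 1"
      by (simp add: ennreal_less_one_iff)
    finally obtain y where "y \<notin> bad j" "y \<notin> bad (Suc j)"
      using \<rho>(1)[of "Suc j"] by (auto elim: avg_indicator_add_less_one[rotated 3])
    then have "\<bar>u y - c j\<bar> \<le> L * a j" "\<bar>u y - c (Suc j)\<bar> \<le> L * a (Suc j)"
      by (auto simp: bad_def)
    moreover have "L * a (Suc j) \<le> L * a j"
      using L a by (intro mult_left_mono) auto
    ultimately show ?thesis
      by linarith
  qed
  have chain: "\<bar>c 0 - c J\<bar> \<le> 2 * L * l / (1 - 2 powr - \<eta>)" for J
  proof -
    have q: "2 powr - \<eta> < (1::real)"
      using pos by (simp add: powr_less_one)
    have "\<bar>c 0 - c J\<bar> \<le> (\<Sum>j<J. 2 * L * a j)"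
    proof (induction J)
      case (Suc J)
      then show ?case
        using step[of J] by simp
    qed simp
    also have "\<dots> = 2 * L * l * (\<Sum>j<J. (2 powr - \<eta>) ^ j)"
      by (simp add: a_def sum_distrib_left powr_powr mult_ac flip: powr_realpow)
    also have "(\<Sum>j<J. (2 powr - \<eta>) ^ j) \<le> 1 / (1 - 2 powr - \<eta>)"
      using q pos(2) by (simp add: sum_gp_strict divide_right_mono)
    finally show ?thesis
      using L pos by (simp add: mult_left_mono)
  qed
  \<comment> \<open>The density hypothesis holds along a subsequence of radii only, so the end of
    the chain is read off from it; m \<ge> -k puts the radius 2^(-m) among those of the chain, at
    index J = m + k.\<close>
  obtain m where m: "nat (- k) \<le> m" "avg M (ball x (2 powr - real m)) (indicator {y. l < \<bar>u y - u x\<bar>}) \<le> ennreal (1 / 4)"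
    using density[OF pos(3)] by blast
  define J where "J = nat (int m + k)"
  have J: "\<rho> J = 2 powr - real m"
    using m(1) by (simp add: \<rho>_def J_def nat_le_iff)
  define far where "far = {y \<in> space M. l < \<bar>u y - u x\<bar>}"
  have [measurable]: "far \<in> sets M"
    unfolding far_def by measurable
  have "avg M (ball x (\<rho> J)) (indicator far) + avg M (ball x (\<rho> J)) (indicator (bad J))
      \<le> ennreal (1 / 4) + ennreal (1 / (4 * (dbl 2 + 1)))"
    using m(2) by (intro add_mono bad) (simp add: J far_def)
  also have "\<dots> < 1"
  proof -
    have "1 / (4 * (dbl 2 + 1)) \<le> 1 / 4"
      using dbl_pos[of 2] by (simp add: divide_simps)
    then have "1 / 4 + 1 / (4 * (dbl 2 + 1)) < 1" by linarith
    then show ?thesis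
      using dbl_pos[of 2] by (simp flip: ennreal_plus add: ennreal_less_one_iff)
  qed
  finally obtain y where y: "y \<notin> far" "y \<notin> bad J"
    using \<rho>(1)[of J] by (auto elim: avg_indicator_add_less_one[rotated 3])
  then have "\<bar>u x - c J\<bar> \<le> l + L * a J"
    by (auto simp: bad_def far_def)
  moreover have "L * a J \<le> L * l"
    using L pos by (intro mult_left_mono) (auto simp: a_def powr_le1_neg mult_left_le_one_le)
  ultimately have "\<bar>u x - c 0\<bar> \<le> l + L * l + 2 * L * l / (1 - 2 powr - \<eta>)"
    using chain[of J] by linarith
  then have "\<bar>u x - c 0\<bar> \<le> tele \<sigma> \<eta> * l"
    by (simp add: tele_def L_def distrib_right)
  moreover have "avg M (ball x (2 powr real_of_int k)) (\<lambda>y. ennreal (\<bar>u y - c 0\<bar> powr \<sigma>)) \<le> ennreal (l powr \<sigma>)"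
    using c[of 0] by (simp add: \<rho>_def a_def)
  ultimately show ?thesis by blast
qed

definition IC_const :: "real \<Rightarrow> real \<Rightarrow> real" where
  "IC_const \<sigma> \<eta> = (2 powr \<sigma> * (tele \<sigma> \<eta> powr \<sigma> + 1)) powr (1 / \<sigma>)"

lemma IC_const_pos: "0 < IC_const \<sigma> \<eta>"
proof -
  have "0 < tele \<sigma> \<eta> powr \<sigma> + 1"
    by (rule add_nonneg_pos) auto
  then show ?thesis
    by (simp add: IC_const_def)
qed

text \<open>One null set, that of the differentiation theorem, serves all scales k. At every other
  point \<open>telescoping\<close> gives a constant c, and the oscillation around u(x) splits into
  |u(x) - c| and the deviation of u from c.\<close>

lemma AE_oscC_le_SUP_oscI:
  assumes u [measurable]: "u \<in> borel_measurable M" and pos: "0 < \<sigma>" "0 < \<eta>"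
  shows "AE x in M. \<forall>k::int. oscC \<sigma> u (2 powr real_of_int k) x \<le> ennreal (IC_const \<sigma> \<eta>) *
    (SUP j::nat. ennreal (2 powr (\<eta> * real j)) * oscI \<sigma> u (2 powr (real_of_int k - real j)) x)"
  using weak_Lebesgue_differentiation[OF u, of "1 / 4", simplified]
proof eventually_elim
  case (elim x)
  show ?case
  proof (intro allI le_cmult_by_approx IC_const_pos)
    fix k :: int and l :: real
    assume l: "0 < l" and S: "(SUP j::nat. ennreal (2 powr (\<eta> * real j)) * oscI \<sigma> u (2 powr (real_of_int k - real j)) x) < ennreal l"
    have "ennreal (2 powr (\<eta> * real j)) * oscI \<sigma> u (2 powr (real_of_int k - real j)) x < ennreal l" for j :: nat
      using S by (rule le_less_trans[rotated]) (rule SUP_upper, simp)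
    then obtain c where c: "\<bar>u x - c\<bar> \<le> tele \<sigma> \<eta> * l"
      "avg M (ball x (2 powr real_of_int k)) (\<lambda>y. ennreal (\<bar>u y - c\<bar> powr \<sigma>)) \<le> ennreal (l powr \<sigma>)"
      using telescoping[OF u pos l, of x k] elim by auto
    let ?A = "\<lambda>f. avg M (ball x (2 powr real_of_int k)) f"
    have "?A (\<lambda>y. ennreal (\<bar>u x - u y\<bar> powr \<sigma>))
        \<le> ?A (\<lambda>y. ennreal (2 powr \<sigma>) * (ennreal (\<bar>u x - c\<bar> powr \<sigma>) + ennreal (\<bar>u y - c\<bar> powr \<sigma>)))"
      using ennreal_abs_diff_powr_le[OF pos(1), of "u x" "u _" c]
      by (intro avg_mono) (simp add: abs_minus_commute[of c])
    also have "\<dots> = ennreal (2 powr \<sigma>) * (ennreal (\<bar>u x - c\<bar> powr \<sigma>) + ?A (\<lambda>y. ennreal (\<bar>u y - c\<bar> powr \<sigma>)))"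
      by (simp add: avg_cmult avg_add)
    also have "\<dots> \<le> ennreal (2 powr \<sigma>) * (ennreal ((tele \<sigma> \<eta> * l) powr \<sigma>) + ennreal (l powr \<sigma>))"
      using c pos by (intro mult_left_mono add_mono ennreal_leI powr_mono2) auto
    also have "\<dots> = ennreal (2 powr \<sigma> * (tele \<sigma> \<eta> powr \<sigma> + 1) * l powr \<sigma>)"
      using pos l tele_pos[of \<eta> \<sigma>] by (simp add: powr_mult algebra_simps flip: ennreal_mult ennreal_plus)
    finally have "oscC \<sigma> u (2 powr real_of_int k) x \<le> epow (ennreal (2 powr \<sigma> * (tele \<sigma> \<eta> powr \<sigma> + 1) * l powr \<sigma>)) (1 / \<sigma>)"
      unfolding oscC_def using pos by (intro epow_mono) auto
    also have "\<dots> = ennreal (IC_const \<sigma> \<eta> * l)"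
      using pos l by (simp add: epow_ennreal IC_const_def powr_mult powr_powr)
    finally show "oscC \<sigma> u (2 powr real_of_int k) x \<le> ennreal (IC_const \<sigma> \<eta> * l)" .
  qed
qed

text \<open>Two small losses occur: \<eta> for the telescoping series and \<open>d\<close> for
  moving the supremum out of the L^p norm.\<close>

lemma Lp_norm_oscC_le_SUP_oscI:
  assumes [measurable]: "u \<in> borel_measurable M" and pos: "0 < \<sigma>" "0 < \<eta>" "0 < d" "0 < p"
  shows "Lp_norm M p (oscC \<sigma> u (2 powr real_of_int k)) \<le> ennreal (IC_const \<sigma> \<eta> * sup_const d p) *
    (SUP j::nat. ennreal (2 powr ((\<eta> + d) * real j)) * Lp_norm M p (oscI \<sigma> u (2 powr (real_of_int k - real j))))"
proof -
  have [measurable]: "oscI \<sigma> u t \<in> borel_measurable M" for t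
    using pos by (intro measurable_oscI) auto
  let ?S = "\<lambda>x. SUP j::nat. ennreal (2 powr (\<eta> * real j)) * oscI \<sigma> u (2 powr (real_of_int k - real j)) x"
  have "Lp_norm M p (oscC \<sigma> u (2 powr real_of_int k)) \<le> Lp_norm M p (\<lambda>x. ennreal (IC_const \<sigma> \<eta>) * ?S x)"
    using AE_oscC_le_SUP_oscI[OF assms(1) pos(1,2)] by (intro Lp_norm_mono pos) (auto elim: eventually_mono)
  also have "\<dots> \<le> ennreal (IC_const \<sigma> \<eta>) * Lp_norm M p ?S"
    using pos by (intro Lp_norm_cmult) auto
  also have "\<dots> \<le> ennreal (IC_const \<sigma> \<eta>) * (ennreal (sup_const d p) *
    (SUP j::nat. ennreal (2 powr ((\<eta> + d) * real j)) * Lp_norm M p (oscI \<sigma> u (2 powr (real_of_int k - real j)))))"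
    using pos by (intro mult_left_mono Lp_norm_weighted_SUP) auto
  finally show ?thesis
    using IC_const_pos[of \<sigma> \<eta>] sup_const_pos[of d p] pos by (simp add: ennreal_mult mult.assoc)
qed

end

section \<open>A Sobolev-Poincare inequality\<close>

lemma epow_SUP_le_suminf:
  assumes "0 < a"
  shows "epow (SUP j. f j) a \<le> (\<Sum>j. epow (f j) a)"
  unfolding epow_SUP[OF assms] by (rule SUP_le_suminf_ennreal)

context doubling_metric_measure
begin

lemma avg_suminf:
  assumes [measurable]: "\<And>j. f j \<in> borel_measurable M" "E \<in> sets M"
  shows "avg M E (\<lambda>y. \<Sum>j. f j y) = (\<Sum>j. avg M E (f j))"
proof -
  have "(\<integral>\<^sup>+y\<in>E. (\<Sum>j. f j y) \<partial>M) = (\<Sum>j. \<integral>\<^sup>+y\<in>E. f j y \<partial>M)"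
    by (subst nn_integral_suminf[symmetric]) (auto simp: ennreal_suminf_multc)
  then show ?thesis
    by (simp add: avg_def divide_ennreal_def ennreal_suminf_multc)
qed

lemma epow_oscC: "0 < \<sigma> \<Longrightarrow> epow (oscC \<sigma> u t x) \<sigma> = avg M (ball x t) (\<lambda>y. ennreal (\<bar>u x - u y\<bar> powr \<sigma>))"
  by (simp add: oscC_def)

text \<open>Each z in the ball yields the admissible constant u(z); averaging over z turns the
  infimum into a mean of \<open>P\<close>-th powers of \<open>oscC\<close>, the form in which
  interpolation applies.\<close>

lemma epow_oscI_le_avg_oscC:
  assumes [measurable]: "u \<in> borel_measurable M" and P: "0 < P" and r: "0 < r"
  shows "epow (oscI P u r y) P \<le> ennreal (dbl 2) * avg M (ball y r) (\<lambda>z. epow (oscC P u (2 * r) z) P)"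
proof -
  have "epow (oscI P u r y) P = avg M (ball y r) (\<lambda>_. epow (oscI P u r y) P)"
    using r by simp
  also have "\<dots> \<le> avg M (ball y r) (\<lambda>z. ennreal (dbl 2) * epow (oscC P u (2 * r) z) P)"
  proof (rule avg_mono)
    fix z assume z: "z \<in> ball y r"
    have "ball y r \<subseteq> ball z (2 * r)"
    proof
      fix w assume "w \<in> ball y r"
      then show "w \<in> ball z (2 * r)"
        using z dist_triangle[of z w y] by (simp add: dist_commute)
    qed
    then have "avg M (ball y r) (\<lambda>w. ennreal (\<bar>u z - u w\<bar> powr P))
        \<le> ennreal (dbl 2) * avg M (ball z (2 * r)) (\<lambda>w. ennreal (\<bar>u z - u w\<bar> powr P))"
      using r by (intro avg_le_avg) auto
    moreover have "epow (oscI P u r y) P \<le> avg M (ball y r) (\<lambda>w. ennreal (\<bar>u w - u z\<bar> powr P))"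
      using P by (auto simp: oscI_def intro: INF_lower)
    ultimately show "epow (oscI P u r y) P \<le> ennreal (dbl 2) * epow (oscC P u (2 * r) z) P"
      using P by (simp add: epow_oscC abs_minus_commute[of "u z"])
  qed
  also have "\<dots> = ennreal (dbl 2) * avg M (ball y r) (\<lambda>z. epow (oscC P u (2 * r) z) P)"
    by (simp add: avg_cmult)
  finally show ?thesis .
qed

text \<open>Averages of radius r \<le> 3 t about points of \<open>ball x t\<close> see g only on
  \<open>ball x (4 * t)\<close>, so g may be cut off there before the L^1 bound is applied.\<close>

lemma avg_avg_le:
  assumes [measurable]: "g \<in> borel_measurable M" and t: "0 < t" and r: "0 < r" "r \<le> 3 * t"
  shows "avg M (ball x t) (\<lambda>y. avg M (ball y r) g) \<le> ennreal (dbl 1 * dbl 4) * avg M (ball x (4 * t)) g"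
proof -
  let ?g = "\<lambda>y. g y * indicator (ball x (4 * t)) y"
  have "avg M (ball x t) (\<lambda>y. avg M (ball y r) g) \<le> avg M (ball x t) (\<lambda>y. avg M (ball y r) ?g)"
  proof (intro avg_mono)
    fix y z assume "y \<in> ball x t" "z \<in> ball y r"
    then show "g z \<le> ?g z"
      using r dist_triangle[of x z y] by simp
  qed
  also have "\<dots> \<le> ennreal (dbl 4) * avg M (ball x (4 * t)) (\<lambda>y. avg M (ball y r) ?g)"
    using t by (intro avg_le_avg) auto
  also have "\<dots> \<le> ennreal (dbl 4) * (ennreal (dbl 1) * avg M (ball x (4 * t)) g)"
  proof (rule mult_left_mono)
    have "(\<integral>\<^sup>+y\<in>ball x (4 * t). avg M (ball y r) ?g \<partial>M) \<le> (\<integral>\<^sup>+y. avg M (ball y r) ?g \<partial>M)"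
      by (intro nn_integral_mono) (auto split: split_indicator)
    also have "\<dots> \<le> ennreal (dbl 1) * (\<integral>\<^sup>+y. ?g y \<partial>M)"
      using r by (intro nn_integral_avg_le) auto
    finally show "avg M (ball x (4 * t)) (\<lambda>y. avg M (ball y r) ?g) \<le> ennreal (dbl 1) * avg M (ball x (4 * t)) g"
      unfolding avg_def[of M "ball x (4 * t)"] ennreal_times_divide by (rule divide_right_mono_ennreal)
  qed simp
  finally show ?thesis
    using dbl_pos[of 1] dbl_pos[of 4] by (simp add: ennreal_mult mult_ac)
qed

lemma avg_le_exists:
  assumes r: "0 < r" and b: "0 < b" and le: "avg M (ball x r) f \<le> ennreal b"
  obtains z where "z \<in> ball x r" "f z \<le> ennreal (2 * b)"
proof (rule ccontr)
  assume "\<not> thesis"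
  then have "avg M (ball x r) (\<lambda>_. ennreal (2 * b)) \<le> avg M (ball x r) f"
    using that by (intro avg_mono) (meson linear)
  then have "ennreal (2 * b) \<le> ennreal b"
    using le r by simp
  then show False
    using b by (simp add: ennreal_le_iff)
qed

lemma dbl_two_power: "dbl (2 powr (1 + a)) = C1 * 4 powr n * 2 powr (a * n)"
proof -
  have "2 * 2 powr (1 + a) = (4::real) * 2 powr a"
    by (simp add: powr_add)
  then show ?thesis
    by (simp add: dbl_def powr_mult powr_powr mult.assoc)
qed

text \<open>The three factors come from \<open>epow_oscI_le_avg_oscC\<close>, from the supremum
  bound on the averages, raised to the power \<sigma>/P - 1, and from
  \<open>avg_avg_le\<close>.\<close>

definition interp_const :: "real \<Rightarrow> real \<Rightarrow> real" where
  "interp_const P \<sigma> = dbl 2 powr (\<sigma> / P) * (C1 * 4 powr n) powr (\<sigma> / P - 1) * (dbl 1 * dbl 4)"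

text \<open>Interpolation between the trivial \<open>L\<^sup>\<infinity>\<close> bound on the averages (which costs a power of
  the ratio of the radii) and their \<open>L\<^sup>1\<close> bound; this is where the range of \<open>\<sigma>\<close> enters.\<close>

lemma avg_oscI_powr_le:
  assumes [measurable]: "u \<in> borel_measurable M" and P: "0 < P" "P < \<sigma>" and X: "0 \<le> X"
    and le: "avg M (ball x (2 powr (real_of_int k + 2))) (\<lambda>z. epow (oscC P u (2 powr (real_of_int k + 2 - real j)) z) P) \<le> ennreal X"
  shows "avg M (ball x (2 powr real_of_int k)) (\<lambda>y. epow (oscI P u (2 powr (real_of_int k + 1 - real j)) y) \<sigma>)
    \<le> ennreal (interp_const P \<sigma> * 2 powr (real j * n * (\<sigma> / P - 1)) * X powr (\<sigma> / P))"
proof -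
  define \<rho> where "\<rho> = 2 powr (real_of_int k + 1 - real j)"
  define t where "t = 2 powr real_of_int k"
  define r where "r = \<sigma> / P"
  define g where "g = (\<lambda>z. epow (oscC P u (2 * \<rho>) z) P)"
  define h where "h y = avg M (ball y \<rho>) g" for y
  have r: "1 < r" "\<sigma> = P * r" using P by (simp_all add: r_def)
  have [measurable]: "g \<in> borel_measurable M"
    unfolding g_def by measurable
  have [measurable]: "h \<in> borel_measurable M"
    unfolding h_def by (rule measurable_avg) measurable
  have \<rho>: "0 < \<rho>" "0 < t" "2 * \<rho> = 2 powr (real_of_int k + 2 - real j)" "4 * t = 2 powr (real_of_int k + 2)"
    by (simp_all add: \<rho>_def t_def powr_add powr_diff)
  have \<rho>t: "\<rho> \<le> 2 * t" "4 * t = 2 powr (1 + real j) * \<rho>"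
    by (simp_all add: \<rho>_def t_def powr_add powr_diff ge_one_powr_ge_zero divide_simps)
  have H: "avg M (ball x (4 * t)) g \<le> ennreal X"
    using le by (simp add: \<rho> g_def)
  \<comment> \<open>The supremum bound on \<open>h\<close>: averaging over radius \<rho> instead of
    4 t costs the volume ratio, of order 2^(j n).\<close>
  define b where "b = C1 * 4 powr n * 2 powr (real j * n) * X"
  have b: "0 \<le> b"
    using C1_gt_1 X by (simp add: b_def)
  have hb: "h y \<le> ennreal b" if y: "y \<in> ball x t" for y
  proof -
    have "h y \<le> ennreal (dbl (2 powr (1 + real j))) * avg M (ball x (4 * t)) g"
      unfolding h_def
    proof (rule avg_le_avg)
      show "ball y \<rho> \<subseteq> ball x (4 * t)"
      proof
        fix z assume "z \<in> ball y \<rho>"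
        then show "z \<in> ball x (4 * t)"
          using y \<rho>t(1) \<rho> dist_triangle[of x z y] by simp
      qed
    qed (use \<rho> \<rho>t in \<open>simp_all add: ge_one_powr_ge_zero\<close>)
    also have "\<dots> \<le> ennreal (dbl (2 powr (1 + real j))) * ennreal X"
      using H by (rule mult_left_mono) simp
    also have "\<dots> = ennreal b"
      using dbl_pos[of "2 powr (1 + real j)"] X by (simp add: b_def dbl_two_power flip: ennreal_mult)
    finally show ?thesis .
  qed
  have "avg M (ball x t) (\<lambda>y. epow (oscI P u \<rho> y) \<sigma>)
      \<le> avg M (ball x t) (\<lambda>y. ennreal (dbl 2 powr r * b powr (r - 1)) * h y)"
  proof (rule avg_mono)
    fix y assume y: "y \<in> ball x t"
    obtain v where v: "h y = ennreal v" "0 \<le> v"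
      using hb[OF y] by (cases "h y") (auto simp: top_unique)
    then have "v \<le> b"
      using hb[OF y] b by (simp add: ennreal_le_iff)
    have "epow (oscI P u \<rho> y) \<sigma> = epow (epow (oscI P u \<rho> y) P) r"
      using P r by (simp add: epow_epow)
    also have "\<dots> \<le> epow (ennreal (dbl 2) * h y) r"
      unfolding h_def g_def using r P \<rho> by (intro epow_mono epow_oscI_le_avg_oscC) auto
    also have "\<dots> = ennreal (dbl 2 powr r * v powr r)"
      using r v dbl_pos[of 2] by (simp add: epow_mult epow_ennreal ennreal_mult)
    also have "\<dots> \<le> ennreal (dbl 2 powr r * b powr (r - 1) * v)"
    proof (rule ennreal_leI)
      \<comment> \<open>Only r - 1 of the r powers are estimated by the supremum bound, the last one
        is kept for the L^1 bound; hence the exponent n (\<sigma>/P - 1).\<close>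
      have "v powr r = v powr (r - 1) * v"
        using v r by (cases "v = 0") (simp_all add: powr_diff)
      also have "\<dots> \<le> b powr (r - 1) * v"
        using \<open>v \<le> b\<close> v r by (intro mult_right_mono powr_mono2) auto
      finally show "dbl 2 powr r * v powr r \<le> dbl 2 powr r * b powr (r - 1) * v"
        by (simp add: mult_left_mono mult.assoc)
    qed
    finally show "epow (oscI P u \<rho> y) \<sigma> \<le> ennreal (dbl 2 powr r * b powr (r - 1)) * h y"
      using v by (simp add: ennreal_mult)
  qed
  also have "\<dots> = ennreal (dbl 2 powr r * b powr (r - 1)) * avg M (ball x t) h"
    by (simp add: avg_cmult)
  also have "\<dots> \<le> ennreal (dbl 2 powr r * b powr (r - 1)) * (ennreal (dbl 1 * dbl 4) * ennreal X)"
  proof (rule mult_left_mono)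
    have "avg M (ball x t) h \<le> ennreal (dbl 1 * dbl 4) * avg M (ball x (4 * t)) g"
      unfolding h_def using \<rho> \<rho>t by (intro avg_avg_le) auto
    also have "\<dots> \<le> ennreal (dbl 1 * dbl 4) * ennreal X"
      using H by (rule mult_left_mono) simp
    finally show "avg M (ball x t) h \<le> ennreal (dbl 1 * dbl 4) * ennreal X" .
  qed simp
  also have "\<dots> = ennreal (interp_const P \<sigma> * 2 powr (real j * n * (\<sigma> / P - 1)) * X powr (\<sigma> / P))"
  proof -
    have "b powr (r - 1) = (C1 * 4 powr n) powr (r - 1) * 2 powr (real j * n * (r - 1)) * X powr (r - 1)"
      using C1_gt_1 X by (simp add: b_def powr_mult powr_powr)
    moreover have "X powr (r - 1) * X = X powr r"
      using X r by (cases "X = 0") (simp_all add: powr_diff)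
    ultimately have "dbl 2 powr r * b powr (r - 1) * (dbl 1 * dbl 4 * X)
        = interp_const P \<sigma> * 2 powr (real j * n * (r - 1)) * X powr r"
      by (simp add: interp_const_def r_def mult_ac)
    then show ?thesis
      using X dbl_pos[of 1] dbl_pos[of 4] by (simp add: r_def flip: ennreal_mult)
  qed
  finally show ?thesis
    by (simp add: \<rho>_def t_def)
qed

definition sob_const :: "real \<Rightarrow> real \<Rightarrow> real \<Rightarrow> real" where
  "sob_const P \<sigma> \<eta> = ((2 * 2 powr P * dbl 2) powr (\<sigma> / P) *
    (IC_const P \<eta> powr \<sigma> * interp_const P \<sigma> * (1 / (1 - 2 powr - (\<eta> * \<sigma>))) + (2 * dbl 4) powr (\<sigma> / P))) powr (1 / \<sigma>)"

text \<open>The \<open>P\<close>-oscillation around u(y) is telescoped once more into oscillations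
  over smaller balls, and \<open>avg_oscI_powr_le\<close> raises the integrability of each to
  \<sigma> at the cost n (1/P - 1/\<sigma>) per octave. Of the two \<eta> in \<theta>, one pays for
  the telescoping weight and the other leaves a convergent geometric series.\<close>

lemma Sobolev_Poincare:
  assumes u [measurable]: "u \<in> borel_measurable M" and P: "0 < P" "P < \<sigma>" and \<eta>: "0 < \<eta>"
    and \<theta>: "\<theta> = n * (1 / P - 1 / \<sigma>) + 2 * \<eta>"
  shows "oscI \<sigma> u (2 powr real_of_int k) x \<le> ennreal (sob_const P \<sigma> \<eta>) *
    (SUP j::nat. ennreal (2 powr (\<theta> * real j)) *
      epow (avg M (ball x (2 powr (real_of_int k + 2))) (\<lambda>z. epow (oscC P u (2 powr (real_of_int k + 2 - real j)) z) P)) (1 / P))"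
    (is "_ \<le> _ * ?S")
proof (rule le_cmult_by_approx)
  have \<sigma>: "0 < \<sigma>" using P by simp
  have [measurable]: "oscI P u t \<in> borel_measurable M" for t
    using P by (intro measurable_oscI) auto
  have geo: "0 < 1 / (1 - 2 powr - (\<eta> * \<sigma>))"
    using \<eta> \<sigma> by (simp add: powr_less_one)
  have ic: "0 < interp_const P \<sigma>"
    using C1_gt_1 dbl_pos[of 1] dbl_pos[of 2] dbl_pos[of 4] by (simp add: interp_const_def)
  define A where "A = IC_const P \<eta> powr \<sigma> * interp_const P \<sigma> * (1 / (1 - 2 powr - (\<eta> * \<sigma>)))"
  have A: "0 < A"
    using IC_const_pos[of P \<eta>] ic geo unfolding A_def by (intro mult_pos_pos) auto
  define r where "r = \<sigma> / P"
  have r: "1 < r" "\<sigma> = P * r" using P by (simp_all add: r_def)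
  show "0 < sob_const P \<sigma> \<eta>"
  proof -
    have "0 < A + (2 * dbl 4) powr r"
      using A by (intro add_pos_nonneg) auto
    then have "0 < (2 * 2 powr P * dbl 2) powr r * (A + (2 * dbl 4) powr r)"
      using dbl_pos[of 2] by simp
    then show ?thesis
      unfolding sob_const_def by (metis A_def r_def less_irrefl powr_gt_zero)
  qed
  fix l :: real assume l: "0 < l" and S: "?S < ennreal l"
  define t where "t = 2 powr real_of_int k"
  define H where "H j = avg M (ball x (2 powr (real_of_int k + 2))) (\<lambda>z. epow (oscC P u (2 powr (real_of_int k + 2 - real j)) z) P)" for j :: nat
  have t: "0 < t" "2 * t = 2 powr (real_of_int k + 1)" "4 * t = 2 powr (real_of_int k + 2)"
    by (simp_all add: t_def powr_add)
  have H: "H j \<le> ennreal ((2 powr (- \<theta> * real j) * l) powr P)" for j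
  proof -
    have "ennreal (2 powr (\<theta> * real j)) * epow (H j) (1 / P) \<le> ennreal l"
      using S unfolding H_def by (intro order_trans[OF SUP_upper less_imp_le]) auto
    then have "ennreal (2 powr (- \<theta> * real j)) * (ennreal (2 powr (\<theta> * real j)) * epow (H j) (1 / P))
        \<le> ennreal (2 powr (- \<theta> * real j)) * ennreal l"
      by (rule mult_left_mono) simp
    then have "epow (H j) (1 / P) \<le> ennreal (2 powr (- \<theta> * real j) * l)"
      using l by (simp add: mult.assoc[symmetric] powr_minus flip: ennreal_mult)
    then show ?thesis
      using P l by (simp add: epow_le_iff_root epow_ennreal)
  qed
  define f where "f y = epow (oscC P u (2 * t) y) P" for y
  have [measurable]: "f \<in> borel_measurable M"
    unfolding f_def by measurable
  define D where "D = 2 * dbl 4 * l powr P"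
  have D: "0 < D" using dbl_pos[of 4] l by (simp add: D_def)
  \<comment> \<open>The constant will be u(z) at a point z where \<open>f\<close> is at most twice
    the bound on its average. The radius 2 t in \<open>f\<close> equals 2^(k+2-j) for j = 1, so this
    bound comes from \<open>H 1\<close>.\<close>
  obtain z where z: "z \<in> ball x t" "f z \<le> ennreal D"
  proof -
    have "n * (1 / P - 1 / \<sigma>) \<ge> 0"
      using n_pos P by (intro mult_nonneg_nonneg) (auto simp: frac_le)
    then have "2 powr (- \<theta> * real 1) * l \<le> l"
      using \<theta> \<eta> l by (intro mult_left_le_one_le powr_le1_neg) auto
    then have "(2 powr (- \<theta> * real 1) * l) powr P \<le> l powr P"
      using P l by (intro powr_mono2) auto
    then have "H 1 \<le> ennreal (l powr P)"
      using H[of 1] by (meson ennreal_leI order_trans)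
    then have "avg M (ball x (4 * t)) f \<le> ennreal (l powr P)"
      unfolding H_def f_def[abs_def] t by (simp add: add.commute)
    then have "ennreal (dbl 4) * avg M (ball x (4 * t)) f \<le> ennreal (dbl 4) * ennreal (l powr P)"
      by (rule mult_left_mono) simp
    moreover have "avg M (ball x t) f \<le> ennreal (dbl 4) * avg M (ball x (4 * t)) f"
      using t by (intro avg_le_avg) auto
    ultimately have "avg M (ball x t) f \<le> ennreal (dbl 4 * l powr P)"
      using dbl_pos[of 4] by (simp add: ennreal_mult)
    from avg_le_exists[OF t(1) _ this] that show ?thesis
      using dbl_pos[of 4] l by (auto simp: D_def mult.assoc)
  qed
  define c where "c = u z"
  define B where "B = 2 * 2 powr P * dbl 2"
  have B: "0 < B" using dbl_pos[of 2] by (simp add: B_def)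
  have near: "ball x t \<subseteq> ball y (2 * t)" if "y \<in> ball x t" for y
  proof
    fix w assume "w \<in> ball x t"
    then show "w \<in> ball y (2 * t)"
      using that dist_triangle[of y w x] by (simp add: dist_commute)
  qed
  have sub: "avg M (ball x t) (\<lambda>w. ennreal (\<bar>u y - u w\<bar> powr P)) \<le> ennreal (dbl 2) * f y" if "y \<in> ball x t" for y
    using near[OF that] t P unfolding f_def by (simp add: epow_oscC avg_le_avg)
  have point: "ennreal (\<bar>u y - c\<bar> powr \<sigma>) \<le> ennreal (B powr r) * (epow (f y) r + ennreal (D powr r))"
    if y: "y \<in> ball x t" for y
  proof -
    \<comment> \<open>Averaging over a third point w of the ball replaces |u(y) - u(z)| by
      oscillations around u(y) and around u(z).\<close>
    have "ennreal (\<bar>u y - c\<bar> powr P) = avg M (ball x t) (\<lambda>_. ennreal (\<bar>u y - c\<bar> powr P))"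
      using t by simp
    also have "\<dots> \<le> avg M (ball x t) (\<lambda>w. ennreal (2 powr P) * (ennreal (\<bar>u y - u w\<bar> powr P) + ennreal (\<bar>u z - u w\<bar> powr P)))"
      using ennreal_abs_diff_powr_le[OF P(1), of "u y" c]
      by (intro avg_mono) (simp add: c_def abs_minus_commute[of "u z"])
    also have "\<dots> = ennreal (2 powr P) * (avg M (ball x t) (\<lambda>w. ennreal (\<bar>u y - u w\<bar> powr P))
        + avg M (ball x t) (\<lambda>w. ennreal (\<bar>u z - u w\<bar> powr P)))"
      by (simp add: avg_cmult avg_add)
    also have "\<dots> \<le> ennreal (2 powr P) * (ennreal (dbl 2) * f y + ennreal (dbl 2) * f z)"
      by (intro mult_left_mono add_mono sub y z) auto
    also have "\<dots> \<le> ennreal (2 powr P) * (ennreal (dbl 2) * f y + ennreal (dbl 2) * ennreal D)"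
      using z by (intro mult_left_mono add_left_mono) auto
    also have "\<dots> = ennreal (2 powr P * dbl 2) * (f y + ennreal D)"
      using dbl_pos[of 2] by (simp add: ennreal_mult distrib_left mult.assoc)
    finally have "epow (ennreal (\<bar>u y - c\<bar> powr P)) r \<le> epow (ennreal (2 powr P * dbl 2) * (f y + ennreal D)) r"
      using r by (intro epow_mono) auto
    also have "\<dots> = ennreal ((2 powr P * dbl 2) powr r) * epow (f y + ennreal D) r"
      using r dbl_pos[of 2] by (simp add: epow_mult epow_ennreal)
    also have "\<dots> \<le> ennreal ((2 powr P * dbl 2) powr r) * (ennreal (2 powr r) * (epow (f y) r + epow (ennreal D) r))"
      using r by (intro mult_left_mono epow_add_le) auto
    also have "\<dots> = ennreal (B powr r) * (epow (f y) r + ennreal (D powr r))"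
    proof -
      have "(2 powr P * dbl 2) powr r * 2 powr r = B powr r"
        using dbl_pos[of 2] by (simp add: B_def powr_mult mult_ac)
      then show ?thesis
        using D by (simp add: epow_ennreal mult.assoc[symmetric] flip: ennreal_mult)
    qed
    finally show ?thesis
      by (simp add: epow_ennreal powr_powr r(2))
  qed
  have avgf: "avg M (ball x t) (\<lambda>y. epow (f y) r) \<le> ennreal (A * l powr \<sigma>)"
  proof -
    define F where "F j y = epow (ennreal (2 powr (\<eta> * real j)) * oscI P u (2 powr (real_of_int k + 1 - real j)) y) \<sigma>" for j :: nat and y
    have [measurable]: "F j \<in> borel_measurable M" for j
      unfolding F_def by measurable
    have "AE y in M. epow (f y) r \<le> ennreal (IC_const P \<eta> powr \<sigma>) * (\<Sum>j. F j y)"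
      using AE_oscC_le_SUP_oscI[OF u P(1) \<eta>]
    proof eventually_elim
      case (elim y)
      have "oscC P u (2 * t) y \<le> ennreal (IC_const P \<eta>) *
          (SUP j::nat. ennreal (2 powr (\<eta> * real j)) * oscI P u (2 powr (real_of_int k + 1 - real j)) y)"
        using elim[rule_format, of "k + 1"] by (simp add: t)
      then have "epow (oscC P u (2 * t) y) \<sigma> \<le> epow (ennreal (IC_const P \<eta>) *
          (SUP j::nat. ennreal (2 powr (\<eta> * real j)) * oscI P u (2 powr (real_of_int k + 1 - real j)) y)) \<sigma>"
        using \<sigma> by (intro epow_mono)
      also have "\<dots> = ennreal (IC_const P \<eta> powr \<sigma>) * epow (SUP j::nat. ennreal (2 powr (\<eta> * real j)) * oscI P u (2 powr (real_of_int k + 1 - real j)) y) \<sigma>"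
        using \<sigma> IC_const_pos[of P \<eta>] by (simp add: epow_mult epow_ennreal)
      also have "\<dots> \<le> ennreal (IC_const P \<eta> powr \<sigma>) * (\<Sum>j. F j y)"
        unfolding F_def using \<sigma> by (intro mult_left_mono epow_SUP_le_suminf) auto
      finally show ?case
        using P r by (simp add: f_def epow_epow)
    qed
    then have "avg M (ball x t) (\<lambda>y. epow (f y) r) \<le> avg M (ball x t) (\<lambda>y. ennreal (IC_const P \<eta> powr \<sigma>) * (\<Sum>j. F j y))"
      by (intro avg_mono_AE) (auto elim: eventually_mono)
    also have "\<dots> = ennreal (IC_const P \<eta> powr \<sigma>) * (\<Sum>j. avg M (ball x t) (F j))"
      by (simp add: avg_cmult avg_suminf)
    also have "\<dots> \<le> ennreal (IC_const P \<eta> powr \<sigma>) * (\<Sum>j. ennreal (2 powr (- (\<eta> * \<sigma>) * real j)) * ennreal (interp_const P \<sigma> * l powr \<sigma>))"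
    proof (intro mult_left_mono suminf_le)
      fix j
      have "avg M (ball x t) (F j) = ennreal (2 powr (\<eta> * real j * \<sigma>)) *
          avg M (ball x t) (\<lambda>y. epow (oscI P u (2 powr (real_of_int k + 1 - real j)) y) \<sigma>)"
        unfolding F_def using \<sigma> by (simp add: epow_mult epow_ennreal powr_powr avg_cmult)
      also have "\<dots> \<le> ennreal (2 powr (\<eta> * real j * \<sigma>)) * ennreal (interp_const P \<sigma> * 2 powr (real j * n * (\<sigma> / P - 1))
          * ((2 powr (- \<theta> * real j) * l) powr P) powr (\<sigma> / P))"
        unfolding t_def using P H[of j] by (intro mult_left_mono avg_oscI_powr_le) (auto simp: H_def)
      also have "\<dots> = ennreal (2 powr (- (\<eta> * \<sigma>) * real j) * (interp_const P \<sigma> * l powr \<sigma>))"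
      proof -
        \<comment> \<open>By the choice of \<theta> the exponents collapse: \<eta> + n (1/P -
          1/\<sigma>) - \<theta> = -\<eta>, times j \<sigma>.\<close>
        have e: "\<eta> * real j * \<sigma> + (real j * n * (\<sigma> / P - 1) - \<theta> * real j * \<sigma>) = - (\<eta> * \<sigma>) * real j"
          unfolding \<theta> using P by (simp add: field_simps)
        have "((2 powr (- \<theta> * real j) * l) powr P) powr (\<sigma> / P) = 2 powr (- \<theta> * real j * \<sigma>) * l powr \<sigma>"
          using P l by (simp add: powr_powr powr_mult mult.assoc)
        then have "2 powr (\<eta> * real j * \<sigma>) * (interp_const P \<sigma> * 2 powr (real j * n * (\<sigma> / P - 1))
            * ((2 powr (- \<theta> * real j) * l) powr P) powr (\<sigma> / P))
          = (2 powr (\<eta> * real j * \<sigma>) * (2 powr (real j * n * (\<sigma> / P - 1)) * 2 powr (- \<theta> * real j * \<sigma>))) * (interp_const P \<sigma> * l powr \<sigma>)"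
          by (simp only: mult_ac)
        also have "\<dots> = 2 powr (- (\<eta> * \<sigma>) * real j) * (interp_const P \<sigma> * l powr \<sigma>)"
          unfolding powr_add[symmetric] e[symmetric] by simp
        finally show ?thesis
          using ic by (simp flip: ennreal_mult)
      qed
      finally show "avg M (ball x t) (F j) \<le> ennreal (2 powr (- (\<eta> * \<sigma>) * real j)) * ennreal (interp_const P \<sigma> * l powr \<sigma>)"
        using ic by (simp add: ennreal_mult)
    qed auto
    also have "\<dots> = ennreal (IC_const P \<eta> powr \<sigma>) * (ennreal (1 / (1 - 2 powr - (\<eta> * \<sigma>))) * ennreal (interp_const P \<sigma> * l powr \<sigma>))"
    proof -
      have "(\<Sum>j. ennreal (2 powr (- (\<eta> * \<sigma>) * real j)) * ennreal (interp_const P \<sigma> * l powr \<sigma>))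
          = ennreal (1 / (1 - 2 powr - (\<eta> * \<sigma>))) * ennreal (interp_const P \<sigma> * l powr \<sigma>)"
        by (subst ennreal_suminf_multc, subst suminf_geometric_powr) (use \<eta> \<sigma> in simp_all)
      then show ?thesis by simp
    qed
    also have "\<dots> = ennreal (A * l powr \<sigma>)"
      using geo ic unfolding A_def by (simp add: mult_ac flip: ennreal_mult)
    finally show ?thesis .
  qed
  have "avg M (ball x t) (\<lambda>y. ennreal (\<bar>u y - c\<bar> powr \<sigma>))
      \<le> avg M (ball x t) (\<lambda>y. ennreal (B powr r) * (epow (f y) r + ennreal (D powr r)))"
    by (intro avg_mono point)
  also have "\<dots> = ennreal (B powr r) * (avg M (ball x t) (\<lambda>y. epow (f y) r) + ennreal (D powr r))"
    using t by (simp add: avg_cmult avg_add)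
  also have "\<dots> \<le> ennreal (B powr r) * (ennreal (A * l powr \<sigma>) + ennreal (D powr r))"
    by (intro mult_left_mono add_right_mono avgf) auto
  also have "\<dots> = ennreal (B powr r * (A + (2 * dbl 4) powr r) * l powr \<sigma>)"
  proof -
    have "D powr r = (2 * dbl 4) powr r * l powr \<sigma>"
      using dbl_pos[of 4] l by (simp add: D_def powr_mult powr_powr r(2))
    then show ?thesis
      using A by (simp add: algebra_simps flip: ennreal_mult ennreal_plus)
  qed
  finally have "oscI \<sigma> u t x \<le> epow (ennreal (B powr r * (A + (2 * dbl 4) powr r) * l powr \<sigma>)) (1 / \<sigma>)"
    unfolding oscI_def using \<sigma> by (intro epow_mono INF_lower2[of c]) auto
  also have "\<dots> = ennreal (sob_const P \<sigma> \<eta> * l)"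
    using \<sigma> l A by (simp add: epow_ennreal sob_const_def A_def B_def r_def powr_mult powr_powr)
  finally show "oscI \<sigma> u (2 powr real_of_int k) x \<le> ennreal (sob_const P \<sigma> \<eta> * l)"
    by (simp add: t_def)
qed

end

section \<open>Local integrability and the functionals S and A\<close>

context doubling_metric_measure
begin

section \<open>Local integrability from finite norms\<close>

lemma Lp_loc_finite_iff:
  assumes [measurable]: "u \<in> borel_measurable M" and \<sigma>: "0 < \<sigma>"
  shows "Lp_norm (restrict_space M (ball a R)) (ennreal \<sigma>) (\<lambda>y. ennreal \<bar>u y\<bar>) < \<infinity>
    \<longleftrightarrow> (\<integral>\<^sup>+y\<in>ball a R. ennreal (\<bar>u y\<bar> powr \<sigma>) \<partial>M) < \<infinity>"
  using \<sigma> by (simp add: Lp_norm_def epow_less_top_iff epow_ennreal_abs_powr nn_integral_restrict_space)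

text \<open>A finite L^p norm at a scale larger than the given ball yields one point of that ball
  where the oscillation is finite, hence a constant c for which |u - c| has finite \<sigma>-average
  over a ball covering the given one.\<close>

lemma in_Lp_loc_of_oscI:
  assumes u [measurable]: "u \<in> borel_measurable M" and \<sigma>: "0 < \<sigma>" and p: "0 < p"
    and fin: "\<And>k::int. Lp_norm M p (oscI \<sigma> u (2 powr real_of_int k)) < \<infinity>"
  shows "u \<in> Lp_loc M (ennreal \<sigma>)"
proof -
  have "Lp_norm (restrict_space M (ball a R)) (ennreal \<sigma>) (\<lambda>y. ennreal \<bar>u y\<bar>) < \<infinity>" if R: "0 < R" for a R
  proof -
    \<comment> \<open>A radius of at least 2 R makes the ball about any point of
      \<open>ball a R\<close> contain \<open>ball a R\<close>.\<close>
    define k where "k = \<lceil>log 2 (2 * R)\<rceil>"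
    have k: "2 * R \<le> 2 powr real_of_int k"
      using R unfolding k_def by (simp add: log_le_iff[symmetric])
    have "AE x in M. oscI \<sigma> u (2 powr real_of_int k) x < \<infinity>"
      using \<sigma> by (intro Lp_norm_finite_AE[OF p _ fin]) auto
    then obtain x where x: "x \<in> ball a R" "oscI \<sigma> u (2 powr real_of_int k) x < \<infinity>"
      by (rule AE_obtain_in_ball[OF _ R]) (rule that)
    then have "(INF c::real. avg M (ball x (2 powr real_of_int k)) (\<lambda>y. ennreal (\<bar>u y - c\<bar> powr \<sigma>))) < \<infinity>"
      by (simp add: oscI_def epow_less_top_iff)
    then obtain c where c: "avg M (ball x (2 powr real_of_int k)) (\<lambda>y. ennreal (\<bar>u y - c\<bar> powr \<sigma>)) < \<infinity>"
      by (auto simp: INF_less_iff)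
    have sub: "ball a R \<subseteq> ball x (2 powr real_of_int k)"
    proof
      fix y assume "y \<in> ball a R"
      then show "y \<in> ball x (2 powr real_of_int k)"
        using x(1) k dist_triangle[of x y a] by (simp add: dist_commute)
    qed
    have "(\<integral>\<^sup>+y\<in>ball a R. ennreal (\<bar>u y\<bar> powr \<sigma>) \<partial>M)
        \<le> (\<integral>\<^sup>+y\<in>ball x (2 powr real_of_int k). ennreal (2 powr \<sigma>) * (ennreal (\<bar>u y - c\<bar> powr \<sigma>) + ennreal (\<bar>c\<bar> powr \<sigma>)) \<partial>M)"
      using ennreal_abs_diff_powr_le[OF \<sigma>, of "u _" 0 c] sub
      by (intro nn_integral_mono) (auto split: split_indicator)
    also have "\<dots> = ennreal (2 powr \<sigma>) * ((\<integral>\<^sup>+y\<in>ball x (2 powr real_of_int k). ennreal (\<bar>u y - c\<bar> powr \<sigma>) \<partial>M)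
        + ennreal (\<bar>c\<bar> powr \<sigma>) * emeasure M (ball x (2 powr real_of_int k)))"
      by (simp add: nn_integral_cmult nn_integral_add distrib_right mult.assoc nn_integral_cmult_indicator)
    also have "\<dots> < \<infinity>"
    proof -
      have "(\<integral>\<^sup>+y\<in>ball x (2 powr real_of_int k). ennreal (\<bar>u y - c\<bar> powr \<sigma>) \<partial>M) \<noteq> \<infinity>"
      proof
        assume "(\<integral>\<^sup>+y\<in>ball x (2 powr real_of_int k). ennreal (\<bar>u y - c\<bar> powr \<sigma>) \<partial>M) = \<infinity>"
        with c show False
          by (simp add: avg_def ennreal_top_divide)
      qed
      then show ?thesis
        by (simp add: ennreal_mult_eq_top_iff less_top[symmetric])
    qed
    finally show ?thesis
      unfolding Lp_loc_finite_iff[OF u \<sigma>] .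
  qed
  then show ?thesis
    by (simp add: Lp_loc_def)
qed

text \<open>Supplies the local integrability in the definition of the Besov space when an inclusion
  is derived from a bound on the norm. For finite p the oscillation around constants is below that
  around u(x); for p = \<infinity> a single point with finite \<open>local_osc\<close> bounds u on
  the ball.\<close>

lemma in_Lp_loc_of_Besov_osc:
  assumes u [measurable]: "u \<in> borel_measurable M" and p: "0 < p"
    and fin: "\<And>k::int. Besov_osc M p u (2 powr real_of_int k) < \<infinity>"
  shows "u \<in> Lp_loc M p"
proof (cases "p = \<infinity>")
  case False
  note P = enn2real_exponent_pos[OF p False]
  have "Lp_norm M p (oscI (enn2real p) u (2 powr real_of_int k)) < \<infinity>" for k
  proof -
    have "Lp_norm M p (oscI (enn2real p) u (2 powr real_of_int k)) \<le> Lp_norm M p (oscC (enn2real p) u (2 powr real_of_int k))"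
      using P p by (intro Lp_norm_mono) (auto intro: oscI_le_oscC)
    then show ?thesis
      using fin[of k] False p by (simp add: Besov_osc_finite)
  qed
  then have "u \<in> Lp_loc M (ennreal (enn2real p))"
    by (intro in_Lp_loc_of_oscI[OF u P p])
  then show ?thesis
    using False by (simp add: less_top[symmetric])
next
  case True
  have "Lp_norm (restrict_space M (ball a R)) top (\<lambda>y. ennreal \<bar>u y\<bar>) < \<infinity>" if R: "0 < R" for a R
  proof -
    define k where "k = \<lceil>log 2 (2 * R)\<rceil>"
    have k: "2 * R \<le> 2 powr real_of_int k"
      using R unfolding k_def by (simp add: log_le_iff[symmetric])
    have meas: "(\<lambda>y. ennreal \<bar>u y\<bar>) \<in> borel_measurable (restrict_space M (ball a R))"
      by (intro measurable_restrict_space1) measurable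
    have "esssup M (local_osc u (2 powr real_of_int k)) < \<infinity>"
      using fin[of k] True by (simp add: Besov_osc_infinity)
    then have "AE x in M. local_osc u (2 powr real_of_int k) x < \<infinity>"
      using esssup_AE[of "local_osc u (2 powr real_of_int k)" M] by (auto intro: le_less_trans elim: eventually_mono)
    then obtain x where x: "x \<in> ball a R" "local_osc u (2 powr real_of_int k) x < \<infinity>"
      by (rule AE_obtain_in_ball[OF _ R]) (rule that)
    have sub: "ball a R \<subseteq> ball x (2 powr real_of_int k)"
    proof
      fix y assume "y \<in> ball a R"
      then show "y \<in> ball x (2 powr real_of_int k)"
        using x(1) k dist_triangle[of x y a] by (simp add: dist_commute)
    qed
    have "AE y in M. y \<in> ball x (2 powr real_of_int k) \<longrightarrow> ennreal \<bar>u x - u y\<bar> \<le> local_osc u (2 powr real_of_int k) x"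
      using local_osc_le_iff[OF u, of "2 powr real_of_int k" x] by blast
    then have "AE y in M. y \<in> ball a R \<longrightarrow> ennreal \<bar>u y\<bar> \<le> ennreal \<bar>u x\<bar> + local_osc u (2 powr real_of_int k) x"
    proof eventually_elim
      case (elim y)
      show ?case
      proof
        assume "y \<in> ball a R"
        then have "ennreal \<bar>u x\<bar> + ennreal \<bar>u x - u y\<bar> \<le> ennreal \<bar>u x\<bar> + local_osc u (2 powr real_of_int k) x"
          using elim sub by (intro add_left_mono) auto
        moreover have "ennreal \<bar>u y\<bar> \<le> ennreal \<bar>u x\<bar> + ennreal \<bar>u x - u y\<bar>"
          by (simp flip: ennreal_plus add: ennreal_leI)
        ultimately show "ennreal \<bar>u y\<bar> \<le> ennreal \<bar>u x\<bar> + local_osc u (2 powr real_of_int k) x"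
          by (rule order_trans[rotated])
      qed
    qed
    then have "AE y in restrict_space M (ball a R). ennreal \<bar>u y\<bar> \<le> ennreal \<bar>u x\<bar> + local_osc u (2 powr real_of_int k) x"
      by (subst AE_restrict_space_iff) auto
    then have "esssup (restrict_space M (ball a R)) (\<lambda>y. ennreal \<bar>u y\<bar>) \<le> ennreal \<bar>u x\<bar> + local_osc u (2 powr real_of_int k) x"
      by (rule esssup_I[OF meas])
    also have "\<dots> < \<infinity>"
      using x by (simp add: less_top[symmetric])
    finally show ?thesis
      by (simp add: Lp_norm_def)
  qed
  then show ?thesis
    using True by (simp add: Lp_loc_def)
qed

section \<open>The supremum over radii in the functional S\<close>

definition oscS :: "real \<Rightarrow> real \<Rightarrow> ('a \<Rightarrow> real) \<Rightarrow> real \<Rightarrow> 'a \<Rightarrow> ennreal" where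
  "oscS \<epsilon> \<sigma> u t x = ennreal (t powr \<epsilon>) * (SUP r\<in>{0<..t}. ennreal (r powr - \<epsilon>) * oscI \<sigma> u r x)"

lemma vecS_eq_oscS: "vecS M s \<epsilon> \<sigma> u x t = ennreal (t powr - s) * oscS \<epsilon> \<sigma> u t x"
proof -
  have "ennreal (t powr (\<epsilon> - s)) = ennreal (t powr - s) * ennreal (t powr \<epsilon>)"
    by (cases "t = 0") (simp_all flip: ennreal_mult powr_add)
  then show ?thesis
    by (simp add: vecS_eq oscS_def mult.assoc)
qed

lemma oscI_le_oscS: "0 < t \<Longrightarrow> oscI \<sigma> u t x \<le> oscS \<epsilon> \<sigma> u t x"
proof -
  assume t: "0 < t"
  then have "oscI \<sigma> u t x = ennreal (t powr \<epsilon>) * (ennreal (t powr - \<epsilon>) * oscI \<sigma> u t x)"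
    by (simp add: mult.assoc[symmetric] flip: ennreal_mult powr_add)
  also have "\<dots> \<le> oscS \<epsilon> \<sigma> u t x"
    unfolding oscS_def using t by (intro mult_left_mono SUP_upper) auto
  finally show ?thesis .
qed

text \<open>A radius r \<le> t lies within one octave below some t 2^(-j), which changes the
  oscillation by \<open>root_dbl 2 \<sigma>\<close> and the weight by 2^\<epsilon> at most. The
  dyadic supremum is countable, hence accessible to \<open>Lp_norm_weighted_SUP\<close>.\<close>

lemma oscS_le_SUP_oscI:
  assumes \<epsilon>: "0 \<le> \<epsilon>" and \<sigma>: "0 < \<sigma>" and t: "0 < t"
  shows "oscS \<epsilon> \<sigma> u t x \<le> ennreal (2 powr \<epsilon> * root_dbl 2 \<sigma>) *
    (SUP j::nat. ennreal (2 powr (\<epsilon> * real j)) * oscI \<sigma> u (t * 2 powr - real j) x)" (is "_ \<le> _ * ?S")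
proof -
  have "ennreal (t powr \<epsilon>) * (ennreal (r powr - \<epsilon>) * oscI \<sigma> u r x) \<le> ennreal (2 powr \<epsilon> * root_dbl 2 \<sigma>) * ?S"
    if r: "0 < r" "r \<le> t" for r
  proof -
    define j where "j = nat \<lfloor>log 2 (t / r)\<rfloor>"
    have "0 \<le> log 2 (t / r)"
      using r t by simp
    then have "real j \<le> log 2 (t / r)" "log 2 (t / r) < real j + 1"
      unfolding j_def by (simp_all add: nat_less_real_le)
    then have *: "2 powr real j \<le> t / r" "t / r < 2 powr (real j + 1)"
      using r t by (simp_all add: le_log_iff log_less_iff)
    define \<rho> where "\<rho> = t * 2 powr - real j"
    have \<rho>: "0 < \<rho>" "r \<le> \<rho>" "\<rho> \<le> 2 * r" "t = 2 powr real j * \<rho>"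
      using * r t by (simp_all add: \<rho>_def powr_add powr_minus field_simps)
    have le: "oscI \<sigma> u r x \<le> ennreal (root_dbl 2 \<sigma>) * oscI \<sigma> u \<rho> x"
      using \<sigma> r \<rho> by (intro oscI_scale) auto
    have powr_le: "t powr \<epsilon> * r powr - \<epsilon> \<le> 2 powr \<epsilon> * 2 powr (\<epsilon> * real j)"
    proof -
      have "t powr \<epsilon> * r powr - \<epsilon> = (t / r) powr \<epsilon>"
        using r \<rho> by (simp add: powr_divide powr_minus_divide)
      also have "\<dots> \<le> (2 * 2 powr real j) powr \<epsilon>"
        using r \<rho> \<epsilon> by (intro powr_mono2) (auto simp: divide_simps)
      also have "\<dots> = 2 powr \<epsilon> * 2 powr (\<epsilon> * real j)"
        by (simp add: powr_mult powr_powr mult.commute)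
      finally show ?thesis .
    qed
    have "ennreal (t powr \<epsilon> * r powr - \<epsilon>) * oscI \<sigma> u r x
        \<le> ennreal (2 powr \<epsilon> * 2 powr (\<epsilon> * real j)) * (ennreal (root_dbl 2 \<sigma>) * oscI \<sigma> u \<rho> x)"
      by (rule mult_mono[OF ennreal_leI[OF powr_le] le]) auto
    also have "\<dots> = ennreal (2 powr \<epsilon> * root_dbl 2 \<sigma>) * (ennreal (2 powr (\<epsilon> * real j)) * oscI \<sigma> u \<rho> x)"
      using root_dbl_pos[of 2 \<sigma>] by (simp add: ennreal_mult mult_ac)
    also have "\<dots> \<le> ennreal (2 powr \<epsilon> * root_dbl 2 \<sigma>) * ?S"
      unfolding \<rho>_def by (intro mult_left_mono SUP_upper) auto
    finally show ?thesis
      by (simp add: ennreal_mult mult.assoc)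
  qed
  then show ?thesis
    unfolding oscS_def
    by (subst SUP_mult_left_ennreal) (auto intro: SUP_least)
qed

text \<open>Measurability of the supremum over all radii is only needed for \<open>p = \<infinity>\<close>, where the
  essential supremum of a nonmeasurable function is \<open>\<infinity>\<close>; there \<open>u\<close> is locally bounded.\<close>

lemma oscI_le_SUP_rat_radii:
  assumes u [measurable]: "u \<in> borel_measurable M" and \<sigma>: "0 < \<sigma>" and \<epsilon>: "0 \<le> \<epsilon>" and r: "0 < r"
    and bdd: "AE y in M. y \<in> ball x r \<longrightarrow> \<bar>u y\<bar> \<le> B"
  shows "ennreal (r powr - \<epsilon>) * oscI \<sigma> u r x \<le> (SUP r'\<in>{0<..<r} \<inter> \<rat>. ennreal (r' powr - \<epsilon>) * oscI \<sigma> u r' x)"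
    (is "_ \<le> ?S")
proof (cases "?S = top")
  case False
  let ?I = "\<lambda>r. INF c::real. avg M (ball x r) (\<lambda>y. ennreal (\<bar>u y - c\<bar> powr \<sigma>))"
  have B: "0 \<le> B"
  proof (rule ccontr)
    assume "\<not> 0 \<le> B"
    then have "AE y in M. y \<notin> ball x r"
      using bdd by (auto elim!: eventually_mono)
    then show False
      using not_AE_notin_ball[OF r] by blast
  qed
  define Y where "Y = epow (ennreal (r powr \<epsilon>) * ?S) \<sigma>"
  have Y: "Y < top"
    unfolding Y_def epow_less_top_iff
    using False by (metis ennreal_mult_less_top ennreal_less_top top.not_eq_extremum)
  have "?I r \<le> Y + ennreal e" if e: "0 < e" for e
  proof -
    \<comment> \<open>The relative volume allowed to the shell between the two radii: values up to 2
      B on it then contribute at most e/2 to the average. The summand 1 keeps the denominator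
      positive.\<close>
    define d where "d = e / (2 * ((2 * B) powr \<sigma> + 1))"
    have d: "0 < d" "(2 * B) powr \<sigma> * d \<le> e / 2"
    proof -
      have "0 < (2 * B) powr \<sigma> + 1" by (rule add_nonneg_pos) auto
      then show "0 < d" "(2 * B) powr \<sigma> * d \<le> e / 2"
        using e by (auto simp: d_def divide_simps)
    qed
    let ?m = "measure M (ball x r)"
    have m: "0 < ?m"
      by (rule measure_ball_pos[OF r])
    \<comment> \<open>An open ball is the increasing union of smaller concentric balls, so a
      rational radius just below r misses little of its measure.\<close>
    have "(\<lambda>i. measure M (ball x (r - 1 / real (Suc i)))) \<longlonglongrightarrow> measure M (\<Union>i. ball x (r - 1 / real (Suc i)))"
    proof (rule Lim_measure_incseq)
      have "1 / real (Suc j) \<le> 1 / real (Suc i)" if "i \<le> j" for i j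
        using that by (simp add: divide_simps)
      then show "incseq (\<lambda>i. ball x (r - 1 / real (Suc i)))"
        by (force simp: incseq_def)
      have "(\<Union>i. ball x (r - 1 / real (Suc i))) \<subseteq> ball x r"
      proof safe
        fix i y assume "y \<in> ball x (r - 1 / real (Suc i))"
        moreover have "0 < 1 / real (Suc i)" by simp
        ultimately show "y \<in> ball x r" unfolding mem_ball by linarith
      qed
      then have "emeasure M (\<Union>i. ball x (r - 1 / real (Suc i))) \<le> emeasure M (ball x r)"
        by (intro emeasure_mono) auto
      then show "emeasure M (\<Union>i. ball x (r - 1 / real (Suc i))) \<noteq> \<infinity>"
        using emeasure_ball_neq(2)[of x r] by (auto simp: top_unique)
    qed auto
    also have "(\<Union>i. ball x (r - 1 / real (Suc i))) = ball x r"
    proof safe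
      fix i y assume "y \<in> ball x (r - 1 / real (Suc i))"
      moreover have "0 < 1 / real (Suc i)" by simp
      ultimately show "y \<in> ball x r" unfolding mem_ball by linarith
    next
      fix y assume "y \<in> ball x r"
      then obtain i where "1 / real (Suc i) < r - dist x y"
        using nat_approx_posE[of "r - dist x y"] by auto
      then show "y \<in> (\<Union>i. ball x (r - 1 / real (Suc i)))"
        by (auto intro!: exI[of _ i])
    qed
    finally have "\<forall>\<^sub>F i in sequentially. ?m - d * ?m < measure M (ball x (r - 1 / real (Suc i)))"
      using d m by (intro order_tendstoD) auto
    then obtain i where i: "?m - d * ?m < measure M (ball x (r - 1 / real (Suc i)))"
      by (auto simp: eventually_sequentially)
    have "max 0 (r - 1 / real (Suc i)) < r"
      using r by simp
    then obtain r' where r': "r' \<in> \<rat>" "max 0 (r - 1 / real (Suc i)) < r'" "r' < r"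
      using Rats_dense_in_real by blast
    then have r'': "0 < r'" by simp
    have "measure M (ball x (r - 1 / real (Suc i))) \<le> measure M (ball x r')"
      using r' by (intro measure_mono_fmeasurable) auto
    moreover have "measure M (ball x r - ball x r') = ?m - measure M (ball x r')"
      using r' by (intro measure_Diff) (auto simp: less_top[symmetric])
    ultimately have diff: "measure M (ball x r - ball x r') \<le> d * ?m"
      using i by simp
    have "ennreal (r' powr - \<epsilon>) * oscI \<sigma> u r' x \<le> ?S"
      using r' by (intro SUP_upper) auto
    then have "ennreal (r' powr \<epsilon>) * (ennreal (r' powr - \<epsilon>) * oscI \<sigma> u r' x) \<le> ennreal (r powr \<epsilon>) * ?S"
      using r' \<epsilon> by (intro mult_mono ennreal_leI powr_mono2) auto
    then have "oscI \<sigma> u r' x \<le> ennreal (r powr \<epsilon>) * ?S"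
      using r'' by (simp add: mult.assoc[symmetric] flip: ennreal_mult powr_add)
    then have "?I r' \<le> Y"
      using \<sigma> by (simp add: oscI_def Y_def epow_le_iff_root)
    also have "Y < Y + ennreal (e / 2)"
      using Y e by (cases Y) (auto simp flip: ennreal_plus simp: ennreal_less_iff)
    finally obtain c where c: "avg M (ball x r') (\<lambda>y. ennreal (\<bar>u y - c\<bar> powr \<sigma>)) < Y + ennreal (e / 2)"
      by (auto simp: INF_less_iff)
    \<comment> \<open>Clamping c to [-B, B] moves it no farther from the values of u and keeps the
      difference below 2 B on the shell, however large the near-optimal c may be.\<close>
    define c' where "c' = max (- B) (min B c)"
    have c': "\<bar>u y - c'\<bar> \<le> \<bar>u y - c\<bar>" "\<bar>u y - c'\<bar> \<le> 2 * B" if "\<bar>u y\<bar> \<le> B" for y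
      using that by (auto simp: c'_def)
    have "(\<integral>\<^sup>+y\<in>ball x r. ennreal (\<bar>u y - c'\<bar> powr \<sigma>) \<partial>M)
        \<le> (\<integral>\<^sup>+y. ennreal (\<bar>u y - c\<bar> powr \<sigma>) * indicator (ball x r') y + ennreal ((2 * B) powr \<sigma>) * indicator (ball x r - ball x r') y \<partial>M)"
    proof (rule nn_integral_mono_AE, use bdd in eventually_elim)
      case (elim y)
      have 1: "\<bar>u y\<bar> \<le> B \<Longrightarrow> \<bar>u y - c'\<bar> powr \<sigma> \<le> \<bar>u y - c\<bar> powr \<sigma>" "\<bar>u y\<bar> \<le> B \<Longrightarrow> \<bar>u y - c'\<bar> powr \<sigma> \<le> (2 * B) powr \<sigma>"
        using c' \<sigma> by (auto intro!: powr_mono2)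
      show ?case
        using elim 1 r' by (auto split: split_indicator intro!: ennreal_leI)
    qed
    also have "\<dots> = (\<integral>\<^sup>+y\<in>ball x r'. ennreal (\<bar>u y - c\<bar> powr \<sigma>) \<partial>M) + ennreal ((2 * B) powr \<sigma>) * emeasure M (ball x r - ball x r')"
      by (subst nn_integral_add) (auto simp: nn_integral_cmult_indicator)
    also have "\<dots> \<le> (Y + ennreal (e / 2)) * emeasure M (ball x r) + ennreal (e / 2) * emeasure M (ball x r)"
    proof (rule add_mono)
      have "(\<integral>\<^sup>+y\<in>ball x r'. ennreal (\<bar>u y - c\<bar> powr \<sigma>) \<partial>M)
          = avg M (ball x r') (\<lambda>y. ennreal (\<bar>u y - c\<bar> powr \<sigma>)) * emeasure M (ball x r')"
        using r'' by (simp add: avg_def ennreal_divide_times ennreal_mult_divide_eq)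
      also have "\<dots> \<le> (Y + ennreal (e / 2)) * emeasure M (ball x r)"
        using c r' by (intro mult_mono emeasure_mono) auto
      finally show "(\<integral>\<^sup>+y\<in>ball x r'. ennreal (\<bar>u y - c\<bar> powr \<sigma>) \<partial>M) \<le> (Y + ennreal (e / 2)) * emeasure M (ball x r)" .
      have fin: "emeasure M (ball x r - ball x r') = ennreal (measure M (ball x r - ball x r'))"
        by (intro emeasure_eq_measure2 fmeasurable_Diff) auto
      have "(2 * B) powr \<sigma> * measure M (ball x r - ball x r') \<le> (2 * B) powr \<sigma> * (d * ?m)"
        using diff by (rule mult_left_mono) simp
      also have "\<dots> \<le> e / 2 * ?m"
        using d m by (simp add: mult.assoc[symmetric] mult_right_mono)
      finally show "ennreal ((2 * B) powr \<sigma>) * emeasure M (ball x r - ball x r') \<le> ennreal (e / 2) * emeasure M (ball x r)"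
        using e by (simp add: fin emeasure_eq_measure2 ennreal_leI flip: ennreal_mult)
    qed
    also have "\<dots> = (Y + ennreal e) * emeasure M (ball x r)"
    proof -
      have "ennreal (e / 2) + ennreal (e / 2) = ennreal e"
        using e by (simp flip: ennreal_plus)
      then show ?thesis
        by (simp add: distrib_right[symmetric] add.assoc)
    qed
    finally have "avg M (ball x r) (\<lambda>y. ennreal (\<bar>u y - c'\<bar> powr \<sigma>)) \<le> (Y + ennreal e) * emeasure M (ball x r) / emeasure M (ball x r)"
      unfolding avg_def by (rule divide_right_mono_ennreal)
    also have "\<dots> = Y + ennreal e"
      using r by (simp add: ennreal_mult_divide_eq)
    finally show ?thesis
      by (rule INF_lower2[rotated]) simp
  qed
  then have "?I r \<le> Y"
    by (rule ennreal_le_epsilon)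
  then have "oscI \<sigma> u r x \<le> ennreal (r powr \<epsilon>) * ?S"
    using \<sigma> by (simp add: oscI_def Y_def epow_le_iff_root)
  then have "ennreal (r powr - \<epsilon>) * oscI \<sigma> u r x \<le> ennreal (r powr - \<epsilon>) * (ennreal (r powr \<epsilon>) * ?S)"
    by (rule mult_left_mono) simp
  then show ?thesis
    using r by (simp add: mult.assoc[symmetric] flip: ennreal_mult powr_add)
next
  case True
  show ?thesis unfolding True by simp
qed

text \<open>Local boundedness reduces the supremum over all radii to countably many of them, and
  each single radius contributes a measurable function of x.\<close>

lemma measurable_oscS:
  assumes u [measurable]: "u \<in> borel_measurable M" and \<sigma>: "0 < \<sigma>" and \<epsilon>: "0 \<le> \<epsilon>" and t: "0 < t"
    and bdd: "u \<in> Lp_loc M top"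
  shows "oscS \<epsilon> \<sigma> u t \<in> borel_measurable M"
proof -
  let ?f = "\<lambda>r x. ennreal (r powr - \<epsilon>) * oscI \<sigma> u r x"
  have eq: "(SUP r\<in>{0<..t}. ?f r x) = (SUP r\<in>insert t ({0<..<t} \<inter> \<rat>). ?f r x)" for x
  proof (rule antisym)
    show "(SUP r\<in>{0<..t}. ?f r x) \<le> (SUP r\<in>insert t ({0<..<t} \<inter> \<rat>). ?f r x)"
    proof (rule SUP_least)
      fix r assume r: "r \<in> {0<..t}"
      then have "Lp_norm (restrict_space M (ball x r)) top (\<lambda>y. ennreal \<bar>u y\<bar>) < top"
        using bdd by (auto simp: Lp_loc_def)
      then have "esssup (restrict_space M (ball x r)) (\<lambda>y. ennreal \<bar>u y\<bar>) < top"
        by (simp add: Lp_norm_def)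
      then obtain B where B: "0 \<le> B" "esssup (restrict_space M (ball x r)) (\<lambda>y. ennreal \<bar>u y\<bar>) = ennreal B"
        by (metis less_top_ennreal)
      then have "AE y in restrict_space M (ball x r). ennreal \<bar>u y\<bar> \<le> ennreal B"
        using esssup_AE[of "\<lambda>y. ennreal \<bar>u y\<bar>" "restrict_space M (ball x r)"] by simp
      then have "AE y in M. y \<in> ball x r \<longrightarrow> \<bar>u y\<bar> \<le> B"
        using B by (subst (asm) AE_restrict_space_iff) (auto simp: ennreal_le_iff)
      then have "?f r x \<le> (SUP r'\<in>{0<..<r} \<inter> \<rat>. ?f r' x)"
        using r by (intro oscI_le_SUP_rat_radii u \<sigma> \<epsilon>) auto
      also have "\<dots> \<le> (SUP r\<in>insert t ({0<..<t} \<inter> \<rat>). ?f r x)"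
        using r by (intro SUP_subset_mono) auto
      finally show "?f r x \<le> (SUP r\<in>insert t ({0<..<t} \<inter> \<rat>). ?f r x)" .
    qed
    show "(SUP r\<in>insert t ({0<..<t} \<inter> \<rat>). ?f r x) \<le> (SUP r\<in>{0<..t}. ?f r x)"
      using t by (intro SUP_subset_mono) auto
  qed
  have "(\<lambda>x. SUP r\<in>insert t ({0<..<t} \<inter> \<rat>). ?f r x) \<in> borel_measurable M"
  proof (rule borel_measurable_SUP)
    show "countable (insert t ({0<..<t} \<inter> \<rat>))"
      using countable_rat by auto
    show "?f r \<in> borel_measurable M" for r
      using measurable_oscI[OF u \<sigma>, of r] by measurable
  qed
  then show ?thesis
    unfolding oscS_def[abs_def] eq by measurable
qed

section \<open>Oscillation around the mean\<close>

definition oscA :: "real \<Rightarrow> ('a \<Rightarrow> real) \<Rightarrow> real \<Rightarrow> 'a \<Rightarrow> ennreal" where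
  "oscA \<sigma> u t x = epow (avg M (ball x t) (\<lambda>y. ennreal (\<bar>u y - mean M (ball x t) u\<bar> powr \<sigma>))) (1 / \<sigma>)"

lemma vecA_eq: "vecA M s \<sigma> u x t = ennreal (t powr - s) * oscA \<sigma> u t x"
  by (simp add: vecA_def oscA_def)

lemma oscI_le_oscA: "0 < \<sigma> \<Longrightarrow> oscI \<sigma> u t x \<le> oscA \<sigma> u t x"
  unfolding oscI_def oscA_def by (intro epow_mono INF_lower) auto

lemma measurable_oscA:
  assumes [measurable]: "u \<in> borel_measurable M"
  shows "oscA \<sigma> u t \<in> borel_measurable M"
proof -
  have "(\<lambda>x. \<integral>y. indicator (ball x t) y *\<^sub>R u y \<partial>M) \<in> borel_measurable M"
    by (rule measurable_lebesgue_integral_snd) measurable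
  then have [measurable]: "(\<lambda>x. mean M (ball x t) u) \<in> borel_measurable M"
    unfolding mean_def set_lebesgue_integral_def measure_def by measurable
  show ?thesis
    unfolding oscA_def[abs_def] by (intro measurable_epow measurable_avg) measurable
qed

text \<open>The first factor lowers the exponent from \<tau> to \<sigma>, the second compares the
  mean with an arbitrary constant.\<close>

definition A_const :: "real \<Rightarrow> real \<Rightarrow> real" where
  "A_const \<sigma> \<tau> = 2 powr (1 / \<sigma>) * (2 powr \<tau> * (1 + 2 powr \<tau>)) powr (1 / \<tau>)"

text \<open>Since \<tau> \<ge> 1, a finite \<tau>-average of |u - c| makes u integrable on the ball,
  and the mean differs from c by at most the average of |u - c|, hence by at most
  \<open>2 * epow ?A (1 / \<tau>)\<close>. With an infinite average the bound is trivial.\<close>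

lemma oscA_le_oscI:
  assumes u [measurable]: "u \<in> borel_measurable M" and \<sigma>: "0 < \<sigma>" "\<sigma> \<le> \<tau>" "1 \<le> \<tau>" and t: "0 < t"
  shows "oscA \<sigma> u t x \<le> ennreal (A_const \<sigma> \<tau>) * oscI \<tau> u t x"
proof -
  let ?B = "ball x t" and ?m = "mean M (ball x t) u"
  have \<tau>: "0 < \<tau>" using \<sigma> by simp
  have "avg M ?B (\<lambda>y. ennreal (\<bar>u y - ?m\<bar> powr \<tau>))
      \<le> ennreal (2 powr \<tau> * (1 + 2 powr \<tau>)) * (INF c::real. avg M ?B (\<lambda>y. ennreal (\<bar>u y - c\<bar> powr \<tau>)))"
  proof (rule le_cmult_INF)
    show "0 < 2 powr \<tau> * (1 + 2 powr \<tau>)"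
      by (simp add: add_pos_nonneg)
    fix c :: real
    let ?A = "avg M ?B (\<lambda>y. ennreal (\<bar>u y - c\<bar> powr \<tau>))"
    show "avg M ?B (\<lambda>y. ennreal (\<bar>u y - ?m\<bar> powr \<tau>)) \<le> ennreal (2 powr \<tau> * (1 + 2 powr \<tau>)) * ?A"
    proof (cases "?A = top")
      case True
      have "2 powr \<tau> * (1 + 2 powr \<tau>) \<noteq> 0"
        by (simp add: add_pos_nonneg less_imp_neq[symmetric])
      then show ?thesis
        using True by (simp add: ennreal_mult_top)
    next
      case False
      have avg1: "avg M ?B (\<lambda>y. ennreal \<bar>u y - c\<bar>) \<le> ennreal 2 * epow ?A (1 / \<tau>)"
        using avg_powr_le[of "\<lambda>y. u y - c" 1 \<tau> t x] \<sigma> t by simp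
      also have "\<dots> < top"
        using False epow_less_top_iff[of ?A "1 / \<tau>"] by (simp add: ennreal_mult_eq_top_iff less_top[symmetric])
      finally have "avg M ?B (\<lambda>y. ennreal \<bar>u y - c\<bar>) < top" .
      then have fin: "(\<integral>\<^sup>+y\<in>?B. ennreal \<bar>u y - c\<bar> \<partial>M) < top"
        by (cases "(\<integral>\<^sup>+y\<in>?B. ennreal \<bar>u y - c\<bar> \<partial>M) = top") (auto simp: avg_def ennreal_top_divide less_top[symmetric])
      have int: "set_integrable M ?B (\<lambda>y. u y - c)"
        unfolding set_integrable_def
      proof (rule integrableI_bounded)
        have "(\<integral>\<^sup>+y. ennreal (norm (indicator ?B y *\<^sub>R (u y - c))) \<partial>M) = (\<integral>\<^sup>+y\<in>?B. ennreal \<bar>u y - c\<bar> \<partial>M)"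
          by (intro nn_integral_cong) (auto split: split_indicator)
        then show "(\<integral>\<^sup>+y. ennreal (norm (indicator ?B y *\<^sub>R (u y - c))) \<partial>M) < \<infinity>"
          using fin by simp
      qed measurable
      have intc: "set_integrable M ?B (\<lambda>_. c)"
        by (simp add: set_integrable_def integrable_real_mult_indicator less_top[symmetric] mult.commute)
      have m: "0 < measure M ?B"
        by (rule measure_ball_pos[OF t])
      have "(LINT y:?B|M. u y) = (LINT y:?B|M. (u y - c) + c)"
        by simp
      also have "\<dots> = (LINT y:?B|M. u y - c) + (LINT y:?B|M. c)"
        using int intc by (rule set_integral_add)
      also have "(LINT y:?B|M. c) = c * measure M ?B"
        by (simp add: set_lebesgue_integral_def)
      finally have "?m - c = (LINT y:?B|M. u y - c) / measure M ?B"
        using m by (simp add: mean_def field_simps)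
      then have "ennreal \<bar>?m - c\<bar> = ennreal \<bar>LINT y:?B|M. u y - c\<bar> / emeasure M ?B"
        using m by (simp add: emeasure_eq_measure2 divide_ennreal)
      also have "\<dots> \<le> avg M ?B (\<lambda>y. ennreal \<bar>u y - c\<bar>)"
      proof -
        have "ennreal \<bar>LINT y:?B|M. u y - c\<bar> \<le> (\<integral>\<^sup>+y. ennreal (norm (indicator ?B y *\<^sub>R (u y - c))) \<partial>M)"
          using integral_norm_bound_ennreal[OF int[unfolded set_integrable_def]]
          by (simp add: set_lebesgue_integral_def)
        also have "\<dots> = (\<integral>\<^sup>+y\<in>?B. ennreal \<bar>u y - c\<bar> \<partial>M)"
          by (intro nn_integral_cong) (auto split: split_indicator)
        finally show ?thesis
          unfolding avg_def by (rule divide_right_mono_ennreal)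
      qed
      finally have "ennreal \<bar>?m - c\<bar> \<le> ennreal 2 * epow ?A (1 / \<tau>)"
        using avg1 by (rule order_trans)
      then have "epow (ennreal \<bar>?m - c\<bar>) \<tau> \<le> epow (ennreal 2 * epow ?A (1 / \<tau>)) \<tau>"
        using \<tau> by (intro epow_mono) auto
      then have mc: "ennreal (\<bar>?m - c\<bar> powr \<tau>) \<le> ennreal (2 powr \<tau>) * ?A"
        using \<tau> epow_ennreal[of 2 \<tau>] by (simp add: epow_mult epow_ennreal_abs_powr)
      have "avg M ?B (\<lambda>y. ennreal (\<bar>u y - ?m\<bar> powr \<tau>))
          \<le> avg M ?B (\<lambda>y. ennreal (2 powr \<tau>) * (ennreal (\<bar>u y - c\<bar> powr \<tau>) + ennreal (\<bar>c - ?m\<bar> powr \<tau>)))"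
        by (intro avg_mono ennreal_abs_diff_powr_le \<tau>)
      also have "\<dots> = ennreal (2 powr \<tau>) * (?A + ennreal (\<bar>?m - c\<bar> powr \<tau>))"
        using t by (simp add: avg_cmult avg_add abs_minus_commute[of c])
      also have "\<dots> \<le> ennreal (2 powr \<tau>) * (?A + ennreal (2 powr \<tau>) * ?A)"
        using mc by (intro mult_left_mono add_left_mono) auto
      also have "\<dots> = ennreal (2 powr \<tau> * (1 + 2 powr \<tau>)) * ?A"
        by (simp add: ennreal_mult distrib_right mult.assoc)
      finally show ?thesis .
    qed
  qed
  then have "epow (avg M ?B (\<lambda>y. ennreal (\<bar>u y - ?m\<bar> powr \<tau>))) (1 / \<tau>)
      \<le> epow (ennreal (2 powr \<tau> * (1 + 2 powr \<tau>)) * (INF c::real. avg M ?B (\<lambda>y. ennreal (\<bar>u y - c\<bar> powr \<tau>)))) (1 / \<tau>)"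
    using \<tau> by (intro epow_mono) auto
  also have "\<dots> = ennreal ((2 powr \<tau> * (1 + 2 powr \<tau>)) powr (1 / \<tau>)) * oscI \<tau> u t x"
    using \<tau> by (simp add: epow_mult epow_ennreal oscI_def)
  finally have "ennreal (2 powr (1 / \<sigma>)) * epow (avg M ?B (\<lambda>y. ennreal (\<bar>u y - ?m\<bar> powr \<tau>))) (1 / \<tau>)
      \<le> ennreal (2 powr (1 / \<sigma>)) * (ennreal ((2 powr \<tau> * (1 + 2 powr \<tau>)) powr (1 / \<tau>)) * oscI \<tau> u t x)"
    by (rule mult_left_mono) simp
  moreover have "oscA \<sigma> u t x \<le> ennreal (2 powr (1 / \<sigma>)) * epow (avg M ?B (\<lambda>y. ennreal (\<bar>u y - ?m\<bar> powr \<tau>))) (1 / \<tau>)"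
    unfolding oscA_def using \<sigma> t by (intro avg_powr_le) auto
  ultimately show ?thesis
    by (simp add: A_const_def ennreal_mult mult.assoc)
qed

end

section \<open>Embeddings\<close>

definition almost_mono :: "real \<Rightarrow> (real \<Rightarrow> ennreal) \<Rightarrow> bool" where
  "almost_mono K F \<longleftrightarrow> 0 < K \<and> (\<forall>t t'. 0 < t \<longrightarrow> t \<le> t' \<longrightarrow> t' \<le> 2 * t \<longrightarrow> F t \<le> ennreal K * F t')"

text \<open>The weight decreases, but by no more than the factor 2^s over one octave.\<close>

lemma almost_mono_weight:
  assumes F: "almost_mono K F" and s: "0 < s"
  shows "almost_mono (2 powr s * K) (\<lambda>t. ennreal (t powr - s) * F t)"
  unfolding almost_mono_def
proof (intro conjI allI impI)
  show "0 < 2 powr s * K"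
    using F by (simp add: almost_mono_def)
  fix t t' :: real assume t: "0 < t" "t \<le> t'" "t' \<le> 2 * t"
  have "t powr - s \<le> (t' / 2) powr - s"
    using t s by (intro powr_mono2') auto
  also have "\<dots> = 2 powr s * t' powr - s"
    using t by (simp add: powr_divide powr_minus_divide)
  finally have le: "t powr - s \<le> 2 powr s * t' powr - s" .
  have "ennreal (t powr - s) * F t \<le> ennreal (2 powr s * t' powr - s) * (ennreal K * F t')"
    using F t by (intro mult_mono[OF ennreal_leI[OF le]]) (auto simp: almost_mono_def)
  also have "\<dots> = ennreal (2 powr s * K) * (ennreal (t' powr - s) * F t')"
    using F by (simp add: ennreal_mult mult_ac almost_mono_def)
  finally show "ennreal (t powr - s) * F t \<le> ennreal (2 powr s * K) * (ennreal (t' powr - s) * F t')" .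
qed

lemma almost_mono_cmult:
  assumes "almost_mono K F" "0 < c"
  shows "almost_mono K (\<lambda>t. ennreal c * F t)"
  unfolding almost_mono_def
proof (intro conjI allI impI)
  fix t t' :: real assume "0 < t" "t \<le> t'" "t' \<le> 2 * t"
  then have "ennreal c * F t \<le> ennreal c * (ennreal K * F t')"
    using assms by (intro mult_left_mono) (auto simp: almost_mono_def)
  then show "ennreal c * F t \<le> ennreal K * (ennreal c * F t')"
    by (simp only: mult.left_commute)
qed (use assms in \<open>simp add: almost_mono_def\<close>)

text \<open>In order: from dt/t to dyadic samples, the given estimate with its shift by m scales,
  Hardy's inequality with exponent s - \<theta>, and back from samples to dt/t.\<close>

definition transfer_const :: "ennreal \<Rightarrow> real \<Rightarrow> real \<Rightarrow> int \<Rightarrow> real \<Rightarrow> real \<Rightarrow> real \<Rightarrow> real" where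
  "transfer_const q s \<theta> m KF KG K =
    (2 powr s * KF) * ((K * 2 powr (s * real_of_int m)) * (sup_const (s - \<theta>) q * lq_const q (2 powr s * KG)))"

lemma lq_const_pos: "0 < K \<Longrightarrow> 0 < lq_const q K"
  by (simp add: lq_const_def)

text \<open>After multiplication by 2^(-s k) the j-th term is 2^(s m) 2^(-(s - \<theta>) j) times
  the weighted sample of \<open>G\<close> at scale k + m - j. As \<theta> < s,
  \<open>lq_weighted_SUP\<close> applies after a shift by m.\<close>

lemma dt_norm_transfer:
  assumes q: "0 < q" and s: "0 < s" "\<theta> < s" and F: "almost_mono KF F" and G: "almost_mono KG G" and K: "0 < K"
    and le: "\<And>k. F (2 powr real_of_int k) \<le> ennreal K *
      (SUP j::nat. ennreal (2 powr (\<theta> * real j)) * G (2 powr (real_of_int (k + m) - real j)))"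
  shows "dt_norm q (\<lambda>t. ennreal (t powr - s) * F t)
    \<le> ennreal (transfer_const q s \<theta> m KF KG K) * dt_norm q (\<lambda>t. ennreal (t powr - s) * G t)"
proof -
  define f where "f t = ennreal (t powr - s) * F t" for t
  define g where "g t = ennreal (t powr - s) * G t" for t
  define b where "b k = g (2 powr real_of_int k)" for k :: int
  have f: "almost_mono (2 powr s * KF) f" and g: "almost_mono (2 powr s * KG) g"
    unfolding f_def g_def using F G s by (auto intro: almost_mono_weight)
  have sc: "0 < sup_const (s - \<theta>) q" and lc: "0 < lq_const q (2 powr s * KG)"
    using q s g by (auto simp: almost_mono_def intro: sup_const_pos lq_const_pos)
  have point: "f (2 powr real_of_int k) \<le> ennreal (K * 2 powr (s * real_of_int m)) *
      (SUP j::nat. ennreal (2 powr (- (s - \<theta>) * real j)) * b (k + m - int j))" (is "_ \<le> ?c * ?S") for k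
  proof -
    have eq: "ennreal (2 powr (- s * real_of_int k)) * (ennreal (2 powr (\<theta> * real j)) * G (2 powr (real_of_int (k + m) - real j)))
        = ennreal (2 powr (s * real_of_int m)) * (ennreal (2 powr (- (s - \<theta>) * real j)) * b (k + m - int j))" for j :: nat
    proof -
      have "2 powr (- s * real_of_int k) * 2 powr (\<theta> * real j)
          = 2 powr (s * real_of_int m) * (2 powr (- (s - \<theta>) * real j) * (2 powr real_of_int (k + m - int j)) powr - s)"
        by (simp add: powr_powr flip: powr_add) (simp add: algebra_simps)
      then have "ennreal (2 powr (- s * real_of_int k)) * ennreal (2 powr (\<theta> * real j))
          = ennreal (2 powr (s * real_of_int m)) * (ennreal (2 powr (- (s - \<theta>) * real j)) * ennreal ((2 powr real_of_int (k + m - int j)) powr - s))"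
        by (simp flip: ennreal_mult)
      then show ?thesis
        by (simp add: b_def g_def mult.assoc) (simp flip: mult.assoc)
    qed
    have "f (2 powr real_of_int k) \<le> ennreal (2 powr (- s * real_of_int k)) * (ennreal K *
      (SUP j::nat. ennreal (2 powr (\<theta> * real j)) * G (2 powr (real_of_int (k + m) - real j))))"
      unfolding f_def using le[of k] by (simp add: powr_powr mult_left_mono mult.commute[of s])
    also have "\<dots> = ennreal K * (SUP j::nat. ennreal (2 powr (- s * real_of_int k)) *
        (ennreal (2 powr (\<theta> * real j)) * G (2 powr (real_of_int (k + m) - real j))))"
      by (simp only: SUP_mult_left_ennreal mult.left_commute)
    also have "\<dots> = ?c * ?S"
      unfolding eq using K by (simp add: ennreal_mult mult.assoc flip: SUP_mult_left_ennreal)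
    finally show ?thesis .
  qed
  have "dt_norm q f \<le> ennreal (2 powr s * KF) * lq q (\<lambda>k. f (2 powr real_of_int k))"
    using f q by (intro dt_norm_le_lq) (auto simp: almost_mono_def)
  also have "lq q (\<lambda>k. f (2 powr real_of_int k)) \<le> lq q (\<lambda>k. ennreal (K * 2 powr (s * real_of_int m)) *
      (SUP j::nat. ennreal (2 powr (- (s - \<theta>) * real j)) * b (k + m - int j)))"
    by (intro lq_mono q point)
  also have "\<dots> = ennreal (K * 2 powr (s * real_of_int m)) *
      lq q (\<lambda>k. SUP j::nat. ennreal (2 powr (- (s - \<theta>) * real j)) * b (k + m - int j))"
    by (rule lq_cmult[OF q])
  also have "lq q (\<lambda>k. SUP j::nat. ennreal (2 powr (- (s - \<theta>) * real j)) * b (k + m - int j))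
      = lq q (\<lambda>k. SUP j::nat. ennreal (2 powr (- (s - \<theta>) * real j)) * b (k - int j))"
    by (rule lq_shift)
  also have "\<dots> \<le> ennreal (sup_const (s - \<theta>) q) * lq q b"
    using q s by (intro lq_weighted_SUP) auto
  also have "lq q b \<le> ennreal (lq_const q (2 powr s * KG)) * dt_norm q g"
    unfolding b_def using g q by (intro lq_le_dt_norm) (auto simp: almost_mono_def)
  finally have "dt_norm q f \<le> ennreal (2 powr s * KF) * (ennreal (K * 2 powr (s * real_of_int m)) *
      (ennreal (sup_const (s - \<theta>) q) * (ennreal (lq_const q (2 powr s * KG)) * dt_norm q g)))"
    by (simp add: mult_left_mono)
  also have "\<dots> = ennreal (transfer_const q s \<theta> m KF KG K) * dt_norm q g"
    using K F sc lc by (simp add: transfer_const_def ennreal_mult mult.assoc almost_mono_def)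
  finally show ?thesis
    by (simp only: f_def[abs_def] g_def[abs_def])
qed

lemma dt_norm_cong:
  assumes "0 < q" "\<And>t. 0 < t \<Longrightarrow> F t = G t"
  shows "dt_norm q F = dt_norm q G"
  using assms by (intro antisym dt_norm_mono) auto

text \<open>No term of a finite l^q norm is infinite, so finiteness passes to every single dyadic
  scale, where local integrability is decided.\<close>

lemma dt_norm_dyadic_finite:
  assumes q: "0 < q" and s: "0 < s" and G: "almost_mono K G"
    and fin: "dt_norm q (\<lambda>t. ennreal (t powr - s) * G t) < \<infinity>"
  shows "G (2 powr real_of_int k) < \<infinity>"
proof -
  let ?g = "\<lambda>t. ennreal (t powr - s) * G t"
  have am: "almost_mono (2 powr s * K) ?g"
    using G s by (rule almost_mono_weight)
  have "lq q (\<lambda>k. ?g (2 powr real_of_int k)) \<le> ennreal (lq_const q (2 powr s * K)) * dt_norm q ?g"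
    using am q by (intro lq_le_dt_norm) (auto simp: almost_mono_def)
  also have "\<dots> < \<infinity>"
    using fin by (simp add: ennreal_mult_less_top)
  finally have lq: "lq q (\<lambda>k. ?g (2 powr real_of_int k)) < \<infinity>" .
  have "?g (2 powr real_of_int k) < \<infinity>"
  proof (cases "q = \<infinity>")
    case True
    then have "?g (2 powr real_of_int k) \<le> lq q (\<lambda>k. ?g (2 powr real_of_int k))"
      by (simp add: lq_def SUP_upper2[of k])
    with lq show ?thesis by (rule le_less_trans[rotated])
  next
    case False
    with lq have "(\<integral>\<^sup>+k. epow (?g (2 powr real_of_int k)) (enn2real q) \<partial>count_space UNIV) < \<infinity>"
      by (simp add: lq_def epow_less_top_iff)
    then have "AE k in count_space UNIV. epow (?g (2 powr real_of_int k)) (enn2real q) \<noteq> \<infinity>"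
      by (intro nn_integral_PInf_AE) auto
    then have "epow (?g (2 powr real_of_int k)) (enn2real q) < top"
      by (simp add: AE_count_space less_top[symmetric])
    then show ?thesis
      unfolding epow_less_top_iff by simp
  qed
  then show ?thesis
    by (auto simp: ennreal_mult_less_top)
qed

context doubling_metric_measure
begin

section \<open>L^p norms at a fixed scale and inequalities between the norms\<close>

definition C_fun where "C_fun p \<sigma> u t = Lp_norm M p (oscC \<sigma> u t)"
definition I_fun where "I_fun p \<sigma> u t = Lp_norm M p (oscI \<sigma> u t)"
text \<open>The dyadic supremum stands in for \<open>oscS\<close>: it is measurable in x as a
  countable supremum and almost monotone in t with the constant of \<open>oscI\<close>.\<close>

definition S_fun where "S_fun p \<epsilon> \<sigma> u t =
  Lp_norm M p (\<lambda>x. SUP j::nat. ennreal (2 powr (\<epsilon> * real j)) * oscI \<sigma> u (t * 2 powr - real j) x)"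

lemma Lp_norm_weighted:
  assumes "0 < p" "f \<in> borel_measurable M" "0 < t"
  shows "Lp_norm M p (\<lambda>x. ennreal (t powr - s) * f x) = ennreal (t powr - s) * Lp_norm M p f"
  using assms by (intro Lp_norm_cmult_eq) auto

lemma vec_norm_C:
  assumes "u \<in> borel_measurable M" "0 < p" "0 < q"
  shows "vec_norm M p q (vecC M s \<sigma>) u = dt_norm q (\<lambda>t. ennreal (t powr - s) * C_fun p \<sigma> u t)"
  unfolding vec_norm_eq_dt_norm vecC_eq C_fun_def using assms
  by (intro dt_norm_cong Lp_norm_weighted measurable_oscC)

lemma vec_norm_I:
  assumes "u \<in> borel_measurable M" "0 < p" "0 < q" "0 < \<sigma>"
  shows "vec_norm M p q (vecI M s \<sigma>) u = dt_norm q (\<lambda>t. ennreal (t powr - s) * I_fun p \<sigma> u t)"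
  unfolding vec_norm_eq_dt_norm vecI_eq I_fun_def using assms
  by (intro dt_norm_cong Lp_norm_weighted measurable_oscI)

lemma almost_mono_Lp_norm:
  assumes p: "0 < p" and K: "0 < K" and [measurable]: "\<And>t. f t \<in> borel_measurable M"
    and le: "\<And>t t' x. 0 < t \<Longrightarrow> t \<le> t' \<Longrightarrow> t' \<le> 2 * t \<Longrightarrow> f t x \<le> ennreal K * f t' x"
  shows "almost_mono K (\<lambda>t. Lp_norm M p (f t))"
  unfolding almost_mono_def
proof (intro conjI allI impI K)
  fix t t' :: real assume t: "0 < t" "t \<le> t'" "t' \<le> 2 * t"
  have "Lp_norm M p (f t) \<le> Lp_norm M p (\<lambda>x. ennreal K * f t' x)"
    using p t by (intro Lp_norm_mono) (auto intro: le)
  also have "\<dots> \<le> ennreal K * Lp_norm M p (f t')"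
    using p by (intro Lp_norm_cmult) auto
  finally show "Lp_norm M p (f t) \<le> ennreal K * Lp_norm M p (f t')" .
qed

lemma almost_mono_C:
  assumes "u \<in> borel_measurable M" "0 < p" "0 < \<sigma>"
  shows "almost_mono (root_dbl 2 \<sigma>) (C_fun p \<sigma> u)"
  unfolding C_fun_def[abs_def] using assms
  by (intro almost_mono_Lp_norm root_dbl_pos measurable_oscC oscC_scale) auto

lemma almost_mono_I:
  assumes "u \<in> borel_measurable M" "0 < p" "0 < \<sigma>"
  shows "almost_mono (root_dbl 2 \<sigma>) (I_fun p \<sigma> u)"
  unfolding I_fun_def[abs_def] using assms
  by (intro almost_mono_Lp_norm root_dbl_pos measurable_oscI oscI_scale) auto

definition B_const :: "ennreal \<Rightarrow> real" where
  "B_const p = (if p = \<infinity> then 1 else root_dbl 2 (enn2real p))"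

lemma almost_mono_B:
  assumes "u \<in> borel_measurable M" "0 < p"
  shows "almost_mono (B_const p) (Besov_osc M p u)"
  using assms Besov_osc_scale[OF assms] by (auto simp: almost_mono_def B_const_def root_dbl_pos)

lemma le_SUP_nat: "f (j::nat) \<le> (SUP j. f j :: ennreal)"
  by (rule SUP_upper) simp

text \<open>The shift by one scale reflects the doubled radius in
  \<open>Besov_osc_le_Lp_norm_oscC\<close>; of the supremum only the term j = 0 is used, with
  \<theta> = 0.\<close>

lemma Besov_le_C:
  assumes \<sigma>: "0 < \<sigma>" and p: "0 < p" and q: "0 < q" and s: "0 < s"
  shows "\<exists>K::real. \<forall>u\<in>borel_measurable M. Besov_norm M s p q u \<le> ennreal K * vec_norm M p q (vecC M s \<sigma>) u"
proof (intro exI ballI)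
  fix u :: "'a \<Rightarrow> real" assume u: "u \<in> borel_measurable M"
  have "Besov_osc M p u (2 powr real_of_int k) \<le> ennreal (C_const \<sigma> p) *
      (SUP j::nat. ennreal (2 powr (0 * real j)) * C_fun p \<sigma> u (2 powr (real_of_int (k + 1) - real j)))" for k
  proof -
    have "Besov_osc M p u (2 powr real_of_int k) \<le> ennreal (C_const \<sigma> p) * C_fun p \<sigma> u (2 powr (real_of_int (k + 1) - real 0))"
      using Besov_osc_le_Lp_norm_oscC[OF u \<sigma> p, of "2 powr real_of_int k"] by (simp add: C_fun_def powr_add mult.commute)
    also have "\<dots> \<le> ennreal (C_const \<sigma> p) *
      (SUP j::nat. ennreal (2 powr (0 * real j)) * C_fun p \<sigma> u (2 powr (real_of_int (k + 1) - real j)))"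
      using le_SUP_nat[of "\<lambda>j. ennreal (2 powr (0 * real j)) * C_fun p \<sigma> u (2 powr (real_of_int (k + 1) - real j))" 0]
      by (intro mult_left_mono) auto
    finally show ?thesis .
  qed
  then have "dt_norm q (\<lambda>t. ennreal (t powr - s) * Besov_osc M p u t)
      \<le> ennreal (transfer_const q s 0 1 (B_const p) (root_dbl 2 \<sigma>) (C_const \<sigma> p)) * dt_norm q (\<lambda>t. ennreal (t powr - s) * C_fun p \<sigma> u t)"
    using u \<sigma> p q s by (intro dt_norm_transfer almost_mono_B almost_mono_C C_const_pos)
  then show "Besov_norm M s p q u \<le> ennreal (transfer_const q s 0 1 (B_const p) (root_dbl 2 \<sigma>) (C_const \<sigma> p)) * vec_norm M p q (vecC M s \<sigma>) u"
    using u p q by (simp add: Besov_norm_eq_dt_norm vec_norm_C)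
qed

lemma C_le_Besov:
  assumes \<sigma>: "0 < \<sigma>" "ennreal \<sigma> \<le> p" and q: "0 < q" and s: "0 < s"
  shows "\<exists>K::real. \<forall>u\<in>borel_measurable M. vec_norm M p q (vecC M s \<sigma>) u \<le> ennreal K * Besov_norm M s p q u"
proof (intro exI ballI)
  fix u :: "'a \<Rightarrow> real" assume u: "u \<in> borel_measurable M"
  have p: "0 < p"
    using less_le_trans[of 0 "ennreal \<sigma>" p] \<sigma> by simp
  have "C_fun p \<sigma> u (2 powr real_of_int k) \<le> ennreal (2 powr (1 / \<sigma>)) *
      (SUP j::nat. ennreal (2 powr (0 * real j)) * Besov_osc M p u (2 powr (real_of_int (k + 0) - real j)))" for k
  proof -
    have "C_fun p \<sigma> u (2 powr real_of_int k) \<le> ennreal (2 powr (1 / \<sigma>)) * Besov_osc M p u (2 powr (real_of_int (k + 0) - real 0))"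
      using Lp_norm_oscC_le_Besov_osc[OF u \<sigma>, of "2 powr real_of_int k"] by (simp add: C_fun_def)
    also have "\<dots> \<le> ennreal (2 powr (1 / \<sigma>)) *
      (SUP j::nat. ennreal (2 powr (0 * real j)) * Besov_osc M p u (2 powr (real_of_int (k + 0) - real j)))"
      using le_SUP_nat[of "\<lambda>j. ennreal (2 powr (0 * real j)) * Besov_osc M p u (2 powr (real_of_int (k + 0) - real j))" 0]
      by (intro mult_left_mono) auto
    finally show ?thesis .
  qed
  then have "dt_norm q (\<lambda>t. ennreal (t powr - s) * C_fun p \<sigma> u t)
      \<le> ennreal (transfer_const q s 0 0 (root_dbl 2 \<sigma>) (B_const p) (2 powr (1 / \<sigma>))) * dt_norm q (\<lambda>t. ennreal (t powr - s) * Besov_osc M p u t)"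
    using u \<sigma> p q s by (intro dt_norm_transfer almost_mono_B almost_mono_C) auto
  then show "vec_norm M p q (vecC M s \<sigma>) u \<le> ennreal (transfer_const q s 0 0 (root_dbl 2 \<sigma>) (B_const p) (2 powr (1 / \<sigma>))) * Besov_norm M s p q u"
    using u p q by (simp add: Besov_norm_eq_dt_norm vec_norm_C)
qed

text \<open>The losses \<eta> and \<open>d\<close> of \<open>Lp_norm_oscC_le_SUP_oscI\<close> are
  both set to s/4, so that \<theta> = s/2 stays below s whatever \<sigma> is.\<close>

lemma Besov_le_I:
  assumes \<sigma>: "0 < \<sigma>" and p: "0 < p" and q: "0 < q" and s: "0 < s"
  shows "\<exists>K::real. \<forall>u\<in>borel_measurable M. Besov_norm M s p q u \<le> ennreal K * vec_norm M p q (vecI M s \<sigma>) u"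
proof (intro exI ballI)
  fix u :: "'a \<Rightarrow> real" assume u: "u \<in> borel_measurable M"
  define K where "K = C_const \<sigma> p * (IC_const \<sigma> (s / 4) * sup_const (s / 4) p)"
  have pos: "0 < C_const \<sigma> p" "0 < IC_const \<sigma> (s / 4)" "0 < sup_const (s / 4) p"
    using \<sigma> p s by (simp_all add: C_const_pos IC_const_pos sup_const_pos)
  have "Besov_osc M p u (2 powr real_of_int k) \<le> ennreal K *
      (SUP j::nat. ennreal (2 powr (s / 2 * real j)) * I_fun p \<sigma> u (2 powr (real_of_int (k + 1) - real j)))" for k
  proof -
    have "Besov_osc M p u (2 powr real_of_int k) \<le> ennreal (C_const \<sigma> p) * C_fun p \<sigma> u (2 powr real_of_int (k + 1))"
      using Besov_osc_le_Lp_norm_oscC[OF u \<sigma> p, of "2 powr real_of_int k"] by (simp add: C_fun_def powr_add mult.commute)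
    also have "\<dots> \<le> ennreal (C_const \<sigma> p) * (ennreal (IC_const \<sigma> (s / 4) * sup_const (s / 4) p) *
      (SUP j::nat. ennreal (2 powr ((s / 4 + s / 4) * real j)) * I_fun p \<sigma> u (2 powr (real_of_int (k + 1) - real j))))"
      unfolding C_fun_def I_fun_def using u \<sigma> p s by (intro mult_left_mono Lp_norm_oscC_le_SUP_oscI) auto
    finally show ?thesis
      using pos by (simp add: K_def ennreal_mult mult.assoc)
  qed
  then have "dt_norm q (\<lambda>t. ennreal (t powr - s) * Besov_osc M p u t)
      \<le> ennreal (transfer_const q s (s / 2) 1 (B_const p) (root_dbl 2 \<sigma>) K) * dt_norm q (\<lambda>t. ennreal (t powr - s) * I_fun p \<sigma> u t)"
    using u \<sigma> p q s pos by (intro dt_norm_transfer almost_mono_B almost_mono_I) (auto simp: K_def)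
  then show "Besov_norm M s p q u \<le> ennreal (transfer_const q s (s / 2) 1 (B_const p) (root_dbl 2 \<sigma>)
      (C_const \<sigma> p * (IC_const \<sigma> (s / 4) * sup_const (s / 4) p))) * vec_norm M p q (vecI M s \<sigma>) u"
    using u p q \<sigma> by (simp add: Besov_norm_eq_dt_norm vec_norm_I K_def)
qed

text \<open>Enlarging \<open>\<sigma>\<close> is harmless, and the interpolation estimate requires an exponent above \<open>p\<close>.\<close>

lemma p_star_exponent:
  assumes p: "0 < P" and s: "0 < s" and \<sigma>: "0 < \<sigma>" "ennreal \<sigma> < p_star n s (ennreal P)"
  obtains \<tau> where "P < \<tau>" "\<sigma> \<le> \<tau>" "n * (1 / P - 1 / \<tau>) < s"
proof -
  \<comment> \<open>The condition \<sigma> < p_*(s) in terms of reciprocals; in the range p \<ge>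
    n/s it holds because 1/\<sigma> is positive.\<close>
  have less: "n * (1 / P - 1 / \<sigma>) < s"
  proof (cases "P < n / s")
    case True
    then have pos: "0 < n - P * s"
      using s by (simp add: field_simps)
    have "\<sigma> < n * P / (n - P * s)"
      using \<sigma> True p s n_pos by (simp add: p_star_def ennreal_less_iff)
    then have "\<sigma> * (n - P * s) < n * P"
      using pos by (simp add: field_simps)
    then show ?thesis
      using \<sigma> p by (simp add: field_simps)
  next
    case False
    then have "n \<le> P * s"
      using s by (simp add: field_simps)
    then have "n * (1 / P) \<le> s"
      using p by (simp add: field_simps)
    moreover have "0 < n * (1 / \<sigma>)"
      using n_pos \<sigma> by simp
    ultimately show ?thesis
      by (simp add: right_diff_distrib)
  qed
  show ?thesis
  proof (cases "P < \<sigma>")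
    case True
    then show ?thesis
      using that[of \<sigma>] less by simp
  next
    case False
    \<comment> \<open>The new exponent is given by 1/\<tau> = 1/P - d: the bound d \<le> s/(2n)
      keeps n d below s, and d \<le> 1/(2P) keeps \<tau> finite and positive.\<close>
    define d where "d = min (s / (2 * n)) (1 / (2 * P))"
    have d: "0 < d" "d \<le> s / (2 * n)" "d \<le> 1 / (2 * P)"
      using s n_pos p by (auto simp: d_def)
    have inv: "0 < 1 / P - d" "1 / P - d < 1 / P"
      using d p by (auto simp: field_simps intro: le_less_trans[OF d(3)])
    show ?thesis
    proof (rule that)
      show "P < 1 / (1 / P - d)"
        using divide_strict_left_mono[OF inv(2), of 1] inv(1) p by simp
      then show "\<sigma> \<le> 1 / (1 / P - d)"
        using False by simp
      have "n * (1 / P - 1 / (1 / (1 / P - d))) = n * d"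
        by simp
      also have "\<dots> \<le> n * (s / (2 * n))"
        using d n_pos by (intro mult_left_mono) auto
      also have "\<dots> < s"
        using n_pos s by simp
      finally show "n * (1 / P - 1 / (1 / (1 / P - d))) < s" .
    qed
  qed
qed

text \<open>The L^1 bound for averages, applied to p-th powers and followed by the p-th
  root.\<close>

lemma Lp_norm_root_avg_le:
  assumes [measurable]: "g \<in> borel_measurable M" and p: "0 < p" "p \<noteq> \<infinity>" and r: "0 < r"
  shows "Lp_norm M p (\<lambda>x. epow (avg M (ball x r) (\<lambda>z. epow (g z) (enn2real p))) (1 / enn2real p))
    \<le> ennreal (root_dbl 1 (enn2real p)) * Lp_norm M p g"
proof -
  note P = enn2real_exponent_pos[OF p]
  show ?thesis
    using p P r by (simp add: Lp_norm_def) (intro epow_root_dbl nn_integral_avg_le; simp)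
qed

lemma I_fun_le_SUP_Besov_osc:
  assumes p: "0 < p" and s: "0 < s" and \<sigma>: "0 < \<sigma>" "ennreal \<sigma> < p_star n s p"
  obtains \<theta> K where "\<theta> < s" "0 < K" "\<And>u k. u \<in> borel_measurable M \<Longrightarrow> I_fun p \<sigma> u (2 powr real_of_int k)
    \<le> ennreal K * (SUP j::nat. ennreal (2 powr (\<theta> * real j)) * Besov_osc M p u (2 powr (real_of_int (k + 2) - real j)))"
proof (cases "p = \<infinity>")
  case True
  show ?thesis
  proof (rule that)
    show "0 < s" "0 < 2 powr (1 / \<sigma>)" using s by auto
    fix u :: "'a \<Rightarrow> real" and k :: int assume u: "u \<in> borel_measurable M"
    have "I_fun p \<sigma> u (2 powr real_of_int k) \<le> Lp_norm M p (oscC \<sigma> u (2 powr real_of_int k))"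
      unfolding I_fun_def using u p \<sigma> by (intro Lp_norm_mono) (auto intro: oscI_le_oscC)
    \<comment> \<open>The term j = 2 cancels the shift by two scales, which is dictated by the case
      of finite p.\<close>
    also have "\<dots> \<le> ennreal (2 powr (1 / \<sigma>)) * Besov_osc M p u (2 powr (real_of_int (k + 2) - real 2))"
      using Lp_norm_oscC_le_Besov_osc[OF u \<sigma>(1), of p "2 powr real_of_int k"] True by simp
    also have "\<dots> \<le> ennreal (2 powr (1 / \<sigma>)) *
        (SUP j::nat. ennreal (2 powr (0 * real j)) * Besov_osc M p u (2 powr (real_of_int (k + 2) - real j)))"
      using le_SUP_nat[of "\<lambda>j. ennreal (2 powr (0 * real j)) * Besov_osc M p u (2 powr (real_of_int (k + 2) - real j))" 2]
      by (intro mult_left_mono) auto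
    finally show "I_fun p \<sigma> u (2 powr real_of_int k) \<le> ennreal (2 powr (1 / \<sigma>)) *
        (SUP j::nat. ennreal (2 powr (0 * real j)) * Besov_osc M p u (2 powr (real_of_int (k + 2) - real j)))" .
  qed
next
  case False
  define P where "P = enn2real p"
  have P: "0 < P" "p = ennreal P"
    using enn2real_exponent_pos[OF p False] False by (simp_all add: P_def less_top[symmetric])
  obtain \<tau> where \<tau>: "P < \<tau>" "\<sigma> \<le> \<tau>" "n * (1 / P - 1 / \<tau>) < s"
    using p_star_exponent[OF P(1) s \<sigma>(1)] \<sigma>(2) P(2) by blast
  define \<delta> where "\<delta> = n * (1 / P - 1 / \<tau>)"
  \<comment> \<open>Three portions \<eta> are spent, two inside \<open>Sobolev_Poincare\<close> and
    one for taking the L^p norm of the supremum; a quarter of the gap s - \<delta> therefore leaves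
    \<theta> strictly below s.\<close>
  define \<eta> where "\<eta> = (s - \<delta>) / 4"
  have "\<delta> < s"
    using \<tau>(3) by (simp add: \<delta>_def)
  moreover have "4 * \<eta> = s - \<delta>"
    by (simp add: \<eta>_def)
  ultimately have \<eta>: "0 < \<eta>" "\<delta> + 2 * \<eta> + \<eta> < s"
    by linarith+
  define K where "K = 2 powr (1 / \<sigma>) * (sob_const P \<tau> \<eta> * (sup_const \<eta> p * root_dbl 1 P))"
  have \<sigma>\<tau>: "0 < \<tau>" using \<tau> P by simp
  have sob: "0 \<le> sob_const P \<tau> \<eta>" by (simp add: sob_const_def)
  have sup: "0 < sup_const \<eta> p" using \<eta> p by (simp add: sup_const_pos)
  have rd: "0 < root_dbl 1 P" by (simp add: root_dbl_pos)
  show ?thesis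
  proof (rule that)
    show "\<delta> + 2 * \<eta> + \<eta> < s" by (rule \<eta>)
    \<comment> \<open>Of \<open>sob_const\<close> only nonnegativity is at hand here, hence the
      added 1.\<close>
    show "0 < K + 1"
      using sob sup rd by (simp add: K_def add_nonneg_pos)
    fix u :: "'a \<Rightarrow> real" and k :: int assume u [measurable]: "u \<in> borel_measurable M"
    define h where "h j x = epow (avg M (ball x (2 powr (real_of_int k + 2)))
      (\<lambda>z. epow (oscC P u (2 powr (real_of_int k + 2 - real j)) z) P)) (1 / P)" for j :: nat and x
    have [measurable]: "h j \<in> borel_measurable M" for j
      unfolding h_def by (intro measurable_epow measurable_avg) measurable
    let ?T = "SUP j::nat. ennreal (2 powr ((\<delta> + 2 * \<eta> + \<eta>) * real j)) * Besov_osc M p u (2 powr (real_of_int (k + 2) - real j))"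
    have h: "Lp_norm M p (h j) \<le> ennreal (root_dbl 1 P) * Besov_osc M p u (2 powr (real_of_int (k + 2) - real j))" for j
      using Lp_norm_root_avg_le[of "oscC P u (2 powr (real_of_int k + 2 - real j))" p "2 powr (real_of_int k + 2)"] p False u
      by (simp add: h_def[abs_def] P_def Besov_osc_finite)
    have "I_fun p \<sigma> u (2 powr real_of_int k) \<le> Lp_norm M p (\<lambda>x. ennreal (2 powr (1 / \<sigma>)) *
        (ennreal (sob_const P \<tau> \<eta>) * (SUP j::nat. ennreal (2 powr ((\<delta> + 2 * \<eta>) * real j)) * h j x)))"
      unfolding I_fun_def
    proof (intro Lp_norm_mono p AE_I2)
      fix x
      have "oscI \<sigma> u (2 powr real_of_int k) x \<le> ennreal (2 powr (1 / \<sigma>)) * oscI \<tau> u (2 powr real_of_int k) x"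
        using u \<sigma> \<tau> by (intro oscI_mono_exponent) auto
      also have "\<dots> \<le> ennreal (2 powr (1 / \<sigma>)) *
          (ennreal (sob_const P \<tau> \<eta>) * (SUP j::nat. ennreal (2 powr ((\<delta> + 2 * \<eta>) * real j)) * h j x))"
        unfolding h_def using u P \<tau> \<eta> by (intro mult_left_mono Sobolev_Poincare) (auto simp: \<delta>_def)
      finally show "oscI \<sigma> u (2 powr real_of_int k) x \<le> ennreal (2 powr (1 / \<sigma>)) *
          (ennreal (sob_const P \<tau> \<eta>) * (SUP j::nat. ennreal (2 powr ((\<delta> + 2 * \<eta>) * real j)) * h j x))" .
    qed (use False in simp)
    also have "\<dots> \<le> ennreal (2 powr (1 / \<sigma>)) * Lp_norm M p (\<lambda>x. ennreal (sob_const P \<tau> \<eta>) *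
        (SUP j::nat. ennreal (2 powr ((\<delta> + 2 * \<eta>) * real j)) * h j x))"
      using p by (intro Lp_norm_cmult) auto
    also have "\<dots> \<le> ennreal (2 powr (1 / \<sigma>)) * (ennreal (sob_const P \<tau> \<eta>) *
        Lp_norm M p (\<lambda>x. SUP j::nat. ennreal (2 powr ((\<delta> + 2 * \<eta>) * real j)) * h j x))"
      using p by (intro mult_left_mono Lp_norm_cmult) auto
    also have "\<dots> \<le> ennreal (2 powr (1 / \<sigma>)) * (ennreal (sob_const P \<tau> \<eta>) * (ennreal (sup_const \<eta> p) *
        (SUP j::nat. ennreal (2 powr ((\<delta> + 2 * \<eta> + \<eta>) * real j)) * Lp_norm M p (h j))))"
      using p \<eta> by (intro mult_left_mono Lp_norm_weighted_SUP) auto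
    also have "\<dots> \<le> ennreal (2 powr (1 / \<sigma>)) * (ennreal (sob_const P \<tau> \<eta>) * (ennreal (sup_const \<eta> p) *
        (ennreal (root_dbl 1 P) * ?T)))"
    proof (intro mult_left_mono)
      show "(SUP j::nat. ennreal (2 powr ((\<delta> + 2 * \<eta> + \<eta>) * real j)) * Lp_norm M p (h j)) \<le> ennreal (root_dbl 1 P) * ?T"
      proof (rule SUP_least)
        fix j :: nat
        have "ennreal (2 powr ((\<delta> + 2 * \<eta> + \<eta>) * real j)) * Lp_norm M p (h j)
            \<le> ennreal (2 powr ((\<delta> + 2 * \<eta> + \<eta>) * real j)) * (ennreal (root_dbl 1 P) * Besov_osc M p u (2 powr (real_of_int (k + 2) - real j)))"
          by (intro mult_left_mono h) auto
        also have "\<dots> = ennreal (root_dbl 1 P) * (ennreal (2 powr ((\<delta> + 2 * \<eta> + \<eta>) * real j)) * Besov_osc M p u (2 powr (real_of_int (k + 2) - real j)))"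
          by (simp only: mult.left_commute)
        also have "\<dots> \<le> ennreal (root_dbl 1 P) * ?T"
          by (intro mult_left_mono le_SUP_nat) auto
        finally show "ennreal (2 powr ((\<delta> + 2 * \<eta> + \<eta>) * real j)) * Lp_norm M p (h j) \<le> ennreal (root_dbl 1 P) * ?T" .
      qed
    qed auto
    also have "\<dots> = ennreal K * ?T"
      using sob sup rd by (simp add: K_def ennreal_mult mult.assoc)
    also have "\<dots> \<le> ennreal (K + 1) * ?T"
      by (intro mult_right_mono ennreal_leI) auto
    finally show "I_fun p \<sigma> u (2 powr real_of_int k) \<le> ennreal (K + 1) * ?T" .
  qed
qed

text \<open>The constant \<open>L\<close> sits inside \<open>dt_norm\<close> so that a pointwise
  domination of another functional by \<open>L\<close> times \<open>oscI\<close> feeds into it by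
  monotonicity.\<close>

lemma cmult_I_le_Besov:
  assumes p: "0 < p" and q: "0 < q" and s: "0 < s" and \<sigma>: "0 < \<sigma>" "ennreal \<sigma> < p_star n s p"
    and L: "0 < L"
  shows "\<exists>K::real. \<forall>u\<in>borel_measurable M.
    dt_norm q (\<lambda>t. ennreal (t powr - s) * (ennreal L * I_fun p \<sigma> u t)) \<le> ennreal K * Besov_norm M s p q u"
proof -
  obtain \<theta> K where K: "\<theta> < s" "0 < K" "\<And>u k. u \<in> borel_measurable M \<Longrightarrow> I_fun p \<sigma> u (2 powr real_of_int k)
    \<le> ennreal K * (SUP j::nat. ennreal (2 powr (\<theta> * real j)) * Besov_osc M p u (2 powr (real_of_int (k + 2) - real j)))"
    using I_fun_le_SUP_Besov_osc[OF p s \<sigma>] by blast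
  show ?thesis
  proof (intro exI ballI)
    fix u :: "'a \<Rightarrow> real" assume u: "u \<in> borel_measurable M"
    have "dt_norm q (\<lambda>t. ennreal (t powr - s) * (ennreal L * I_fun p \<sigma> u t))
        \<le> ennreal (transfer_const q s \<theta> 2 (root_dbl 2 \<sigma>) (B_const p) (L * K)) * dt_norm q (\<lambda>t. ennreal (t powr - s) * Besov_osc M p u t)"
    proof (intro dt_norm_transfer q s K almost_mono_cmult almost_mono_I almost_mono_B u p \<sigma> L)
      show "0 < L * K" using L K by simp
      show "ennreal L * I_fun p \<sigma> u (2 powr real_of_int k) \<le> ennreal (L * K) *
        (SUP j::nat. ennreal (2 powr (\<theta> * real j)) * Besov_osc M p u (2 powr (real_of_int (k + 2) - real j)))" for k
        using mult_left_mono[OF K(3)[OF u, of k], of "ennreal L"] L K(2) by (simp add: ennreal_mult mult.assoc)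
    qed
    then show "dt_norm q (\<lambda>t. ennreal (t powr - s) * (ennreal L * I_fun p \<sigma> u t))
        \<le> ennreal (transfer_const q s \<theta> 2 (root_dbl 2 \<sigma>) (B_const p) (L * K)) * Besov_norm M s p q u"
      using q by (simp add: Besov_norm_eq_dt_norm)
  qed
qed

lemma I_le_Besov:
  assumes p: "0 < p" and q: "0 < q" and s: "0 < s" and \<sigma>: "0 < \<sigma>" "ennreal \<sigma> < p_star n s p"
  shows "\<exists>K::real. \<forall>u\<in>borel_measurable M. vec_norm M p q (vecI M s \<sigma>) u \<le> ennreal K * Besov_norm M s p q u"
  using cmult_I_le_Besov[OF assms, of 1] p q \<sigma> by (simp add: vec_norm_I cong: ball_cong)

text \<open>The gap s - \<epsilon> absorbs the loss \<open>d\<close> in moving the weighted supremum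
  out of L^p, since \<theta> = \<epsilon> + d. For p = \<infinity> local boundedness makes
  \<open>oscS\<close> measurable and thereby its essential supremum meaningful.\<close>

lemma S_le_I:
  assumes p: "0 < p" and q: "0 < q" and s: "0 < s" and \<sigma>: "0 < \<sigma>" and \<epsilon>: "0 \<le> \<epsilon>" "\<epsilon> < s"
  shows "\<exists>K::real. \<forall>u\<in>borel_measurable M. (p = \<infinity> \<longrightarrow> u \<in> Lp_loc M \<infinity>) \<longrightarrow>
    vec_norm M p q (vecS M s \<epsilon> \<sigma>) u \<le> ennreal K * vec_norm M p q (vecI M s \<sigma>) u"
proof -
  define d where "d = (s - \<epsilon>) / 2"
  have d: "0 < d" "\<epsilon> + d < s" using \<epsilon> by (auto simp: d_def field_simps)
  define L where "L = 2 powr \<epsilon> * root_dbl 2 \<sigma>"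
  have L: "0 < L" by (simp add: L_def root_dbl_pos)
  define K where "K = L * sup_const d p"
  have K: "0 < K" using d p L by (simp add: K_def sup_const_pos)
  show ?thesis
  proof (intro exI ballI impI)
    fix u :: "'a \<Rightarrow> real" assume u [measurable]: "u \<in> borel_measurable M" and bdd: "p = \<infinity> \<longrightarrow> u \<in> Lp_loc M \<infinity>"
    have [measurable]: "oscI \<sigma> u t \<in> borel_measurable M" for t
      using \<sigma> by (intro measurable_oscI) auto
    have meas: "oscS \<epsilon> \<sigma> u t \<in> borel_measurable M" if "p = \<infinity>" "0 < t" for t
      using that bdd u \<sigma> \<epsilon> by (intro measurable_oscS) auto
    let ?S = "\<lambda>t x. SUP j::nat. ennreal (2 powr (\<epsilon> * real j)) * oscI \<sigma> u (t * 2 powr - real j) x"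
    have am: "almost_mono (root_dbl 2 \<sigma>) (S_fun p \<epsilon> \<sigma> u)"
      unfolding S_fun_def[abs_def]
    proof (intro almost_mono_Lp_norm p)
      fix t t' :: real and x assume t: "0 < t" "t \<le> t'" "t' \<le> 2 * t"
      show "?S t x \<le> ennreal (root_dbl 2 \<sigma>) * ?S t' x"
      proof (rule SUP_least)
        fix j :: nat
        have "oscI \<sigma> u (t * 2 powr - real j) x \<le> ennreal (root_dbl 2 \<sigma>) * oscI \<sigma> u (t' * 2 powr - real j) x"
          using t \<sigma> by (intro oscI_scale) (auto simp: mult_right_mono)
        then have "ennreal (2 powr (\<epsilon> * real j)) * oscI \<sigma> u (t * 2 powr - real j) x
            \<le> ennreal (2 powr (\<epsilon> * real j)) * (ennreal (root_dbl 2 \<sigma>) * oscI \<sigma> u (t' * 2 powr - real j) x)"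
          by (rule mult_left_mono) simp
        also have "\<dots> = ennreal (root_dbl 2 \<sigma>) * (ennreal (2 powr (\<epsilon> * real j)) * oscI \<sigma> u (t' * 2 powr - real j) x)"
          by (rule mult.left_commute)
        also have "\<dots> \<le> ennreal (root_dbl 2 \<sigma>) * ?S t' x"
          by (intro mult_left_mono le_SUP_nat) auto
        finally show "ennreal (2 powr (\<epsilon> * real j)) * oscI \<sigma> u (t * 2 powr - real j) x \<le> ennreal (root_dbl 2 \<sigma>) * ?S t' x" .
      qed
    qed (simp_all add: root_dbl_pos)
    have le: "S_fun p \<epsilon> \<sigma> u (2 powr real_of_int k) \<le> ennreal (sup_const d p) *
        (SUP j::nat. ennreal (2 powr ((\<epsilon> + d) * real j)) * I_fun p \<sigma> u (2 powr (real_of_int (k + 0) - real j)))" for k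
      using Lp_norm_weighted_SUP[of p d "\<lambda>j. oscI \<sigma> u (2 powr real_of_int k * 2 powr - real j)" M \<epsilon>] p d
      by (simp add: S_fun_def I_fun_def powr_diff powr_minus_divide)
    have "vec_norm M p q (vecS M s \<epsilon> \<sigma>) u \<le> dt_norm q (\<lambda>t. ennreal L * (ennreal (t powr - s) * S_fun p \<epsilon> \<sigma> u t))"
      unfolding vec_norm_eq_dt_norm vecS_eq_oscS S_fun_def
    proof (intro dt_norm_mono q)
      fix t :: real assume t: "0 < t"
      \<comment> \<open>The term \<open>t powr - s * L\<close> reads as
        \<open>(t powr (- s)) * L\<close>.\<close>
      have "Lp_norm M p (\<lambda>x. ennreal (t powr - s) * oscS \<epsilon> \<sigma> u t x) \<le> Lp_norm M p (\<lambda>x. ennreal (t powr - s * L) * ?S t x)"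
      proof (intro Lp_norm_mono p AE_I2)
        fix x
        have "ennreal (t powr - s) * oscS \<epsilon> \<sigma> u t x \<le> ennreal (t powr - s) * (ennreal L * ?S t x)"
          unfolding L_def using t \<epsilon> \<sigma> by (intro mult_left_mono oscS_le_SUP_oscI) auto
        then show "ennreal (t powr - s) * oscS \<epsilon> \<sigma> u t x \<le> ennreal (t powr - s * L) * ?S t x"
          using L by (simp add: ennreal_mult mult.assoc)
      qed (use meas t in simp)
      also have "\<dots> \<le> ennreal (t powr - s * L) * Lp_norm M p (?S t)"
        using p by (intro Lp_norm_cmult) auto
      also have "\<dots> = ennreal L * (ennreal (t powr - s) * Lp_norm M p (?S t))"
        using L by (simp add: ennreal_mult mult_ac)
      finally show "Lp_norm M p (\<lambda>x. ennreal (t powr - s) * oscS \<epsilon> \<sigma> u t x)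
        \<le> ennreal L * (ennreal (t powr - s) * Lp_norm M p (?S t))" .
    qed
    also have "\<dots> = dt_norm q (\<lambda>t. ennreal (t powr - s) * (ennreal L * S_fun p \<epsilon> \<sigma> u t))"
      by (simp only: mult.left_commute)
    also have "\<dots> \<le> ennreal (transfer_const q s (\<epsilon> + d) 0 (root_dbl 2 \<sigma>) (root_dbl 2 \<sigma>) K) * dt_norm q (\<lambda>t. ennreal (t powr - s) * I_fun p \<sigma> u t)"
    proof (intro dt_norm_transfer q s d K almost_mono_I u p \<sigma> almost_mono_cmult L am)
      show "ennreal L * S_fun p \<epsilon> \<sigma> u (2 powr real_of_int k) \<le> ennreal K *
        (SUP j::nat. ennreal (2 powr ((\<epsilon> + d) * real j)) * I_fun p \<sigma> u (2 powr (real_of_int (k + 0) - real j)))" for k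
        using mult_left_mono[OF le[of k], of "ennreal L"] L sup_const_pos[OF d(1) p]
        by (simp add: K_def ennreal_mult mult.assoc)
    qed
    finally show "vec_norm M p q (vecS M s \<epsilon> \<sigma>) u \<le> ennreal (transfer_const q s (\<epsilon> + d) 0 (root_dbl 2 \<sigma>) (root_dbl 2 \<sigma>) K) * vec_norm M p q (vecI M s \<sigma>) u"
      using u p q \<sigma> by (simp add: vec_norm_I)
  qed
qed

section \<open>From inequalities between norms to inclusions of spaces\<close>

lemma vec_norm_mono:
  assumes "0 < p" "0 < q" "\<And>x t. 0 < t \<Longrightarrow> E u x t \<le> E' u x t"
    and "\<And>t. 0 < t \<Longrightarrow> (\<lambda>x. E u x t) \<in> borel_measurable M"
  shows "vec_norm M p q E u \<le> vec_norm M p q E' u"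
  unfolding vec_norm_eq_dt_norm using assms by (intro dt_norm_mono Lp_norm_mono) auto

lemma measurable_vecI:
  "u \<in> borel_measurable M \<Longrightarrow> 0 < \<sigma> \<Longrightarrow> (\<lambda>x. vecI M s \<sigma> u x t) \<in> borel_measurable M"
  unfolding vecI_eq using measurable_oscI[of u \<sigma> t] by measurable

lemma in_Lp_loc_of_vecI:
  assumes u: "u \<in> borel_measurable M" and pos: "0 < \<sigma>" "0 < p" "0 < q" "0 < s"
    and fin: "vec_norm M p q (vecI M s \<sigma>) u < \<infinity>"
  shows "u \<in> Lp_loc M (ennreal \<sigma>)"
proof (rule in_Lp_loc_of_oscI[OF u pos(1,2)])
  fix k :: int
  have "I_fun p \<sigma> u (2 powr real_of_int k) < \<infinity>"
    using fin unfolding vec_norm_I[OF u pos(2,3,1)]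
    by (rule dt_norm_dyadic_finite[OF pos(3,4) almost_mono_I[OF u pos(2,1)]])
  then show "Lp_norm M p (oscI \<sigma> u (2 powr real_of_int k)) < \<infinity>"
    by (simp only: I_fun_def)
qed

lemma in_Lp_loc_of_Besov_norm:
  assumes u: "u \<in> borel_measurable M" and pos: "0 < p" "0 < q" "0 < s"
    and fin: "Besov_norm M s p q u < \<infinity>"
  shows "u \<in> Lp_loc M p"
  using fin unfolding Besov_norm_eq_dt_norm[OF pos(2)]
  by (intro in_Lp_loc_of_Besov_osc u pos dt_norm_dyadic_finite[OF pos(2,3) almost_mono_B[OF u pos(1)]])

lemma Lp_loc_measurable: "u \<in> Lp_loc M p \<Longrightarrow> u \<in> borel_measurable M"
  by (simp add: Lp_loc_def)

text \<open>Domination of \<open>vecI\<close> by \<open>E\<close> yields local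
  \<sigma>-integrability from a finite norm. The norm bound is asked for on
  \<open>Lp_loc M p\<close>, which for p = \<infinity> brings in the local boundedness that
  \<open>vecS\<close> relies on.\<close>

lemma embeds_Besov_vec_space:
  assumes pos: "0 < \<sigma>" "0 < p" "0 < q" "0 < s"
    and le: "\<exists>K::real. \<forall>u\<in>Lp_loc M p. vec_norm M p q E u \<le> ennreal K * Besov_norm M s p q u"
    and lower: "\<And>u x t. 0 < t \<Longrightarrow> vecI M s \<sigma> u x t \<le> E u x t"
  shows "embeds (Besov M s p q) (vec_space M \<sigma> p q E)"
proof -
  obtain K :: real where K: "\<And>u. u \<in> Lp_loc M p \<Longrightarrow> vec_norm M p q E u \<le> ennreal K * Besov_norm M s p q u"
    using le by blast
  show ?thesis
    unfolding embeds_def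
  proof (intro exI ballI)
    fix u assume "u \<in> members (Besov M s p q)"
    then have u: "u \<in> Lp_loc M p" "Besov_norm M s p q u < \<infinity>"
      by (auto simp: Besov_def)
    note um = Lp_loc_measurable[OF u(1)]
    have "ennreal K * Besov_norm M s p q u < \<infinity>"
      using u(2) by (simp add: ennreal_mult_less_top)
    then have fin: "vec_norm M p q E u < \<infinity>"
      using K[OF u(1)] by (rule le_less_trans[rotated])
    have "vec_norm M p q (vecI M s \<sigma>) u \<le> vec_norm M p q E u"
      by (intro vec_norm_mono pos lower measurable_vecI um)
    then have "u \<in> Lp_loc M (ennreal \<sigma>)"
      using fin by (intro in_Lp_loc_of_vecI[OF um pos]) (rule le_less_trans)
    then show "u \<in> members (vec_space M \<sigma> p q E) \<and>
        qnorm (vec_space M \<sigma> p q E) u \<le> ennreal K * qnorm (Besov M s p q) u"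
      using fin K[OF u(1)] by (simp add: vec_space_def Besov_def)
  qed
qed

lemma embeds_vec_space_Besov:
  assumes pos: "0 < p" "0 < q" "0 < s"
    and le: "\<exists>K::real. \<forall>u\<in>borel_measurable M. Besov_norm M s p q u \<le> ennreal K * vec_norm M p q E u"
  shows "embeds (vec_space M \<sigma> p q E) (Besov M s p q)"
proof -
  obtain K :: real where K: "\<And>u. u \<in> borel_measurable M \<Longrightarrow> Besov_norm M s p q u \<le> ennreal K * vec_norm M p q E u"
    using le by blast
  show ?thesis
    unfolding embeds_def
  proof (intro exI ballI)
    fix u assume "u \<in> members (vec_space M \<sigma> p q E)"
    then have u: "u \<in> Lp_loc M (ennreal \<sigma>)" "vec_norm M p q E u < \<infinity>"
      by (auto simp: vec_space_def)
    note um = Lp_loc_measurable[OF u(1)]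
    have "ennreal K * vec_norm M p q E u < \<infinity>"
      using u(2) by (simp add: ennreal_mult_less_top)
    then have fin: "Besov_norm M s p q u < \<infinity>"
      using K[OF um] by (rule le_less_trans[rotated])
    then have "u \<in> Lp_loc M p"
      by (rule in_Lp_loc_of_Besov_norm[OF um pos])
    then show "u \<in> members (Besov M s p q) \<and>
        qnorm (Besov M s p q) u \<le> ennreal K * qnorm (vec_space M \<sigma> p q E) u"
      using fin K[OF um] by (simp add: vec_space_def Besov_def)
  qed
qed

lemma Besov_le_of_I_le:
  assumes pos: "0 < \<sigma>" "0 < p" "0 < q" "0 < s"
    and lower: "\<And>u x t. 0 < t \<Longrightarrow> vecI M s \<sigma> u x t \<le> E u x t"
  shows "\<exists>K::real. \<forall>u\<in>borel_measurable M. Besov_norm M s p q u \<le> ennreal K * vec_norm M p q E u"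
proof -
  obtain K :: real where K: "\<And>u. u \<in> borel_measurable M \<Longrightarrow> Besov_norm M s p q u \<le> ennreal K * vec_norm M p q (vecI M s \<sigma>) u"
    using Besov_le_I[OF pos] by blast
  have "Besov_norm M s p q u \<le> ennreal K * vec_norm M p q E u" if u: "u \<in> borel_measurable M" for u
  proof -
    have "vec_norm M p q (vecI M s \<sigma>) u \<le> vec_norm M p q E u"
      by (intro vec_norm_mono pos lower measurable_vecI u)
    then show ?thesis
      using K[OF u] by (meson mult_left_mono order_trans zero_le)
  qed
  then show ?thesis by blast
qed

lemma vecI_le_vecC: "0 < \<sigma> \<Longrightarrow> vecI M s \<sigma> u x t \<le> vecC M s \<sigma> u x t"
  unfolding vecI_eq vecC_eq by (intro mult_left_mono oscI_le_oscC) auto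

lemma vecI_le_vecA: "0 < \<sigma> \<Longrightarrow> vecI M s \<sigma> u x t \<le> vecA M s \<sigma> u x t"
  unfolding vecI_eq vecA_eq by (intro mult_left_mono oscI_le_oscA) auto

lemma vecI_le_vecS: "0 < t \<Longrightarrow> vecI M s \<sigma> u x t \<le> vecS M s \<epsilon> \<sigma> u x t"
  unfolding vecI_eq vecS_eq_oscS by (intro mult_left_mono oscI_le_oscS) auto

theorem Besov_eq_CB:
  assumes "0 < s" "0 < q" and \<sigma>: "0 < \<sigma>" "ennreal \<sigma> \<le> p"
  shows "same_space (Besov M s p q) (CB M s \<sigma> p q)"
proof -
  have p: "0 < p"
    using less_le_trans[of 0 "ennreal \<sigma>" p] \<sigma> by simp
  have "\<exists>K::real. \<forall>u\<in>Lp_loc M p. vec_norm M p q (vecC M s \<sigma>) u \<le> ennreal K * Besov_norm M s p q u"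
    using C_le_Besov[OF \<sigma> assms(2,1)] Lp_loc_measurable by blast
  then show ?thesis
    unfolding same_space_def CB_def using assms p
    by (auto intro!: embeds_Besov_vec_space embeds_vec_space_Besov Besov_le_C vecI_le_vecC)
qed

theorem Besov_eq_IB:
  assumes s: "0 < s" and pq: "0 < p" "0 < q" and \<sigma>: "0 < \<sigma>" "ennreal \<sigma> < p_star n s p"
  shows "same_space (Besov M s p q) (IB M s \<sigma> p q)"
proof -
  have "\<exists>K::real. \<forall>u\<in>Lp_loc M p. vec_norm M p q (vecI M s \<sigma>) u \<le> ennreal K * Besov_norm M s p q u"
    using I_le_Besov[OF pq s \<sigma>] Lp_loc_measurable by blast
  then show ?thesis
    unfolding same_space_def IB_def using assms
    by (auto intro!: embeds_Besov_vec_space embeds_vec_space_Besov Besov_le_I)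
qed

theorem Besov_eq_SB:
  assumes s: "0 < s" and pq: "0 < p" "0 < q" and \<sigma>: "0 < \<sigma>" "ennreal \<sigma> < p_star n s p" and \<epsilon>: "0 \<le> \<epsilon>" "\<epsilon> < s"
  shows "same_space (Besov M s p q) (SB M s \<epsilon> \<sigma> p q)"
proof -
  obtain K :: real where K: "\<And>u. u \<in> borel_measurable M \<Longrightarrow> vec_norm M p q (vecI M s \<sigma>) u \<le> ennreal K * Besov_norm M s p q u"
    using I_le_Besov[OF pq s \<sigma>] by blast
  obtain L :: real where L: "\<And>u. u \<in> borel_measurable M \<Longrightarrow> (p = \<infinity> \<longrightarrow> u \<in> Lp_loc M \<infinity>) \<Longrightarrow>
      vec_norm M p q (vecS M s \<epsilon> \<sigma>) u \<le> ennreal L * vec_norm M p q (vecI M s \<sigma>) u"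
    using S_le_I[OF pq s \<sigma>(1) \<epsilon>] by blast
  \<comment> \<open>The constants obtained above may be negative, and \<open>ennreal\<close> sends
    negative numbers to 0; clipping at 0 makes the map multiplicative on them.\<close>
  have "vec_norm M p q (vecS M s \<epsilon> \<sigma>) u \<le> ennreal (max 0 L * max 0 K) * Besov_norm M s p q u" if "u \<in> Lp_loc M p" for u
  proof -
    note um = Lp_loc_measurable[OF that]
    have "vec_norm M p q (vecS M s \<epsilon> \<sigma>) u \<le> ennreal L * (ennreal K * Besov_norm M s p q u)"
      using L[OF um] that by (intro order_trans[OF _ mult_left_mono[OF K[OF um]]]) auto
    also have "\<dots> = ennreal (max 0 L * max 0 K) * Besov_norm M s p q u"
    proof -
      have "ennreal (max 0 a) = ennreal a" for a
        by (simp add: max_def ennreal_neg)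
      then show ?thesis
        by (simp add: ennreal_mult mult.assoc)
    qed
    finally show ?thesis .
  qed
  then have "\<exists>K::real. \<forall>u\<in>Lp_loc M p. vec_norm M p q (vecS M s \<epsilon> \<sigma>) u \<le> ennreal K * Besov_norm M s p q u"
    by blast
  then show ?thesis
    unfolding same_space_def SB_def using s pq \<sigma>
    by (auto intro!: embeds_Besov_vec_space embeds_vec_space_Besov Besov_le_of_I_le[where \<sigma>=\<sigma>] vecI_le_vecS)
qed

text \<open>The equation n p / (n - p s) = 1 is solved by p = n / (n + s). Above this threshold the
  exponent 1 is admissible, so that functions in the Besov space have means over balls.\<close>

lemma one_less_p_star:
  assumes s: "0 < s" and p: "ennreal (n / (n + s)) < p"
  shows "1 < p_star n s p"
proof (cases "p < ennreal (n / s)")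
  case True
  then obtain P where P: "p = ennreal P" "0 \<le> P"
    by (cases p) auto
  have *: "P < n / s" "n / (n + s) < P"
    using True p P s n_pos by (auto simp: ennreal_less_iff)
  have 1: "n < P * (n + s)"
    using *(2) s n_pos by (simp add: pos_divide_less_eq)
  have 2: "P * s < n"
    using *(1) s by (simp add: pos_less_divide_eq)
  have "1 < n * P / (n - P * s)"
    using 1 2 by (simp add: pos_less_divide_eq algebra_simps)
  then have "ennreal 1 < ennreal (n * P / (n - P * s))"
    by (subst ennreal_less_iff) auto
  then show ?thesis
    using True P by (simp add: p_star_def)
next
  case False
  then show ?thesis by (simp add: p_star_def)
qed

theorem Besov_eq_AB:
  assumes s: "0 < s" and q: "0 < q" and p: "ennreal (n / (n + s)) < p" and \<sigma>: "0 < \<sigma>" "ennreal \<sigma> < p_star n s p"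
  shows "same_space (Besov M s p q) (AB M s \<sigma> p q)"
proof -
  have p0: "0 < p"
    using p by (rule le_less_trans[rotated]) simp
  \<comment> \<open>The mean is compared with constants at an exponent of at least 1; the threshold
    on p keeps this exponent below p_*(s).\<close>
  define \<tau> where "\<tau> = max \<sigma> 1"
  have \<tau>: "0 < \<tau>" "\<sigma> \<le> \<tau>" "1 \<le> \<tau>" "ennreal \<tau> < p_star n s p"
    using \<sigma> one_less_p_star[OF s p] by (auto simp: \<tau>_def max_def)
  obtain K :: real where K: "\<And>u. u \<in> borel_measurable M \<Longrightarrow> vec_norm M p q (vecI M s \<tau>) u \<le> ennreal K * Besov_norm M s p q u"
    using I_le_Besov[OF p0 q s \<tau>(1,4)] by blast
  have L: "0 < A_const \<sigma> \<tau>"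
    by (simp add: A_const_def add_pos_nonneg less_imp_neq[symmetric])
  obtain K' :: real where K': "\<And>u. u \<in> borel_measurable M \<Longrightarrow>
      dt_norm q (\<lambda>t. ennreal (t powr - s) * (ennreal (A_const \<sigma> \<tau>) * I_fun p \<tau> u t)) \<le> ennreal K' * Besov_norm M s p q u"
    using cmult_I_le_Besov[OF p0 q s \<tau>(1,4) L] by blast
  have A: "vec_norm M p q (vecA M s \<sigma>) u \<le> dt_norm q (\<lambda>t. ennreal (t powr - s) * (ennreal (A_const \<sigma> \<tau>) * I_fun p \<tau> u t))"
    if um: "u \<in> borel_measurable M" for u
    unfolding vec_norm_eq_dt_norm vecA_eq I_fun_def
  proof (intro dt_norm_mono q)
    fix t :: real assume t: "0 < t"
    have "Lp_norm M p (\<lambda>x. ennreal (t powr - s) * oscA \<sigma> u t x) \<le> ennreal (t powr - s) * Lp_norm M p (oscA \<sigma> u t)"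
      by (intro Lp_norm_cmult p0 measurable_oscA um)
    also have "\<dots> \<le> ennreal (t powr - s) * Lp_norm M p (\<lambda>x. ennreal (A_const \<sigma> \<tau>) * oscI \<tau> u t x)"
      using \<sigma> \<tau> t by (intro mult_left_mono Lp_norm_mono p0 AE_I2 oscA_le_oscI um measurable_oscA) auto
    also have "\<dots> \<le> ennreal (t powr - s) * (ennreal (A_const \<sigma> \<tau>) * Lp_norm M p (oscI \<tau> u t))"
      using \<tau> by (intro mult_left_mono Lp_norm_cmult p0 measurable_oscI um) auto
    finally show "Lp_norm M p (\<lambda>x. ennreal (t powr - s) * oscA \<sigma> u t x)
        \<le> ennreal (t powr - s) * (ennreal (A_const \<sigma> \<tau>) * Lp_norm M p (oscI \<tau> u t))" .
  qed
  have "\<exists>K::real. \<forall>u\<in>Lp_loc M p. vec_norm M p q (vecA M s \<sigma>) u \<le> ennreal K * Besov_norm M s p q u"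
    using A K' Lp_loc_measurable by (meson order_trans)
  then have emb: "embeds (Besov M s p q) (vec_space M \<sigma> p q (vecA M s \<sigma>))"
    using s p0 q \<sigma> by (intro embeds_Besov_vec_space vecI_le_vecA)
  \<comment> \<open>For \<sigma> < 1 the exponent \<tau> equals 1, so integrability on balls comes
    with the bound for \<open>vecI\<close> at \<tau>.\<close>
  have loc1: "u \<in> Lp_loc M 1" if "\<sigma> < 1" "u \<in> members (Besov M s p q)" for u
  proof -
    have u: "u \<in> borel_measurable M" "Besov_norm M s p q u < \<infinity>"
      using that(2) by (auto simp: Besov_def Lp_loc_def)
    have "ennreal K * Besov_norm M s p q u < \<infinity>"
      using u(2) by (simp add: ennreal_mult_less_top)
    then have "vec_norm M p q (vecI M s \<tau>) u < \<infinity>"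
      using K[OF u(1)] by (rule le_less_trans[rotated])
    then have "u \<in> Lp_loc M (ennreal \<tau>)"
      by (rule in_Lp_loc_of_vecI[OF u(1) \<tau>(1) p0 q s])
    then show ?thesis
      using that(1) by (simp add: \<tau>_def)
  qed
  have "embeds (vec_space M \<sigma> p q (vecA M s \<sigma>)) (Besov M s p q)"
    using s p0 q \<sigma> by (intro embeds_vec_space_Besov Besov_le_of_I_le[where \<sigma>=\<sigma>] vecI_le_vecA)
  then show ?thesis
    using emb loc1 unfolding same_space_def embeds_def AB_def by simp blast
qed

end

section \<open>Counterexamples in Euclidean space\<close>

text \<open>The terms k and -k are collected at j = |k|; counting k = 0 twice does no harm to an
  upper bound.\<close>

lemma nn_integral_two_sided_geometric:
  assumes c: "0 < c"
  shows "(\<integral>\<^sup>+k. ennreal (2 powr (- c * \<bar>real_of_int k\<bar>)) \<partial>count_space UNIV) < \<infinity>"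
proof -
  have "(\<integral>\<^sup>+k. ennreal (2 powr (- c * \<bar>real_of_int k\<bar>)) \<partial>count_space UNIV)
      \<le> (\<integral>\<^sup>+k. (\<Sum>j. ennreal (2 powr (- c * real j)) * (indicator {int j} k + indicator {- int j} k)) \<partial>count_space UNIV)"
  proof (rule nn_integral_mono)
    fix k :: int
    let ?f = "\<lambda>j. ennreal (2 powr (- c * real j)) * (indicator {int j} k + indicator {- int j} k)"
    have "1 \<le> (indicator {int (nat \<bar>k\<bar>)} k + indicator {- int (nat \<bar>k\<bar>)} k :: ennreal)"
      by (auto split: split_indicator)
    then have "ennreal (2 powr (- c * \<bar>real_of_int k\<bar>)) * 1 \<le> ?f (nat \<bar>k\<bar>)"
      by (intro mult_mono) auto
    also have "\<dots> \<le> (SUP j. ?f j)"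
      by (rule SUP_upper) simp
    also have "\<dots> \<le> (\<Sum>j. ?f j)"
      by (rule SUP_le_suminf_ennreal)
    finally show "ennreal (2 powr (- c * \<bar>real_of_int k\<bar>)) \<le> (\<Sum>j. ?f j)"
      by simp
  qed
  also have "\<dots> = (\<Sum>j. \<integral>\<^sup>+k. ennreal (2 powr (- c * real j)) * (indicator {int j} k + indicator {- int j} k) \<partial>count_space UNIV)"
    by (intro nn_integral_suminf) auto
  also have "\<dots> = (\<Sum>j. ennreal (2 powr (- c * real j)) * 2)"
    by (intro suminf_cong) (simp add: nn_integral_cmult nn_integral_add)
  also have "\<dots> = ennreal (1 / (1 - 2 powr - c)) * 2"
    by (subst ennreal_suminf_multc, subst suminf_geometric_powr) (use c in simp_all)
  also have "\<dots> < \<infinity>"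
    by (simp add: ennreal_mult_less_top)
  finally show ?thesis .
qed

lemma lq_two_sided_geometric:
  assumes q: "0 < q" and \<eta>: "0 < \<eta>"
  shows "lq q (\<lambda>k. ennreal (2 powr (- \<eta> * \<bar>real_of_int k\<bar>))) < \<infinity>"
proof (cases "q = \<infinity>")
  case True
  have "lq q (\<lambda>k. ennreal (2 powr (- \<eta> * \<bar>real_of_int k\<bar>))) \<le> 1"
    using True \<eta> by (auto simp: lq_def intro!: SUP_least powr_le1_neg)
  then show ?thesis
    by (rule le_less_trans) simp
next
  case False
  then have r: "0 < enn2real q"
    using q by (simp add: enn2real_positive_iff top.not_eq_extremum)
  then show ?thesis
    using False nn_integral_two_sided_geometric[of "\<eta> * enn2real q"] \<eta>
    by (simp add: lq_def epow_less_top_iff epow_ennreal powr_powr mult_ac)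
qed

context doubling_metric_measure
begin

text \<open>The bound beats t^s by the power s' - s at small scales and is constant at large ones,
  where t^(-s) decays. The weighted samples are thus at most K 2^(-\<eta> |k|), which lies in every
  l^q, and one function can serve all q.\<close>

lemma in_Besov_of_osc_le:
  assumes u: "u \<in> borel_measurable M" and p: "0 < p" and q: "0 < q" and s: "0 < s" "s < s'" and K: "0 \<le> K"
    and le: "\<And>t. 0 < t \<Longrightarrow> Besov_osc M p u t \<le> ennreal (K * min 1 (t powr s'))"
  shows "u \<in> members (Besov M s p q)"
proof -
  define \<eta> where "\<eta> = min s (s' - s)"
  have \<eta>: "0 < \<eta>" "\<eta> \<le> s" "\<eta> \<le> s' - s" using s by (auto simp: \<eta>_def)
  have am: "almost_mono (2 powr s * B_const p) (\<lambda>t. ennreal (t powr - s) * Besov_osc M p u t)"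
    by (intro almost_mono_weight almost_mono_B u p s)
  have "dt_norm q (\<lambda>t. ennreal (t powr - s) * Besov_osc M p u t) \<le> ennreal (2 powr s * B_const p) *
      lq q (\<lambda>k. ennreal ((2 powr real_of_int k) powr - s) * Besov_osc M p u (2 powr real_of_int k))"
    using am q by (intro dt_norm_le_lq) (auto simp: almost_mono_def)
  also have "\<dots> \<le> ennreal (2 powr s * B_const p) * lq q (\<lambda>k. ennreal K * ennreal (2 powr (- \<eta> * \<bar>real_of_int k\<bar>)))"
  proof (intro mult_left_mono lq_mono q)
    fix k :: int
    have "(2 powr real_of_int k) powr - s * min 1 ((2 powr real_of_int k) powr s') \<le> 2 powr (- \<eta> * \<bar>real_of_int k\<bar>)"
    proof (cases "0 \<le> k")
      case True
      have "(2 powr real_of_int k) powr - s * min 1 ((2 powr real_of_int k) powr s') \<le> (2 powr real_of_int k) powr - s * 1"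
        by (intro mult_left_mono) auto
      also have "\<dots> \<le> 2 powr (- \<eta> * \<bar>real_of_int k\<bar>)"
        using True \<eta> by (simp add: powr_powr mult.commute mult_right_mono)
      finally show ?thesis .
    next
      case False
      have "(2 powr real_of_int k) powr - s * min 1 ((2 powr real_of_int k) powr s')
          \<le> (2 powr real_of_int k) powr - s * (2 powr real_of_int k) powr s'"
        by (intro mult_left_mono) auto
      also have "\<dots> = 2 powr (real_of_int k * (s' - s))"
        by (simp add: powr_powr right_diff_distrib flip: powr_add)
      also have "\<dots> \<le> 2 powr (- \<eta> * \<bar>real_of_int k\<bar>)"
        using False \<eta> mult_left_mono_neg[OF \<eta>(3), of "real_of_int k"] by (simp add: mult.commute)
      finally show ?thesis .
    qed
    then have "(2 powr real_of_int k) powr - s * (K * min 1 ((2 powr real_of_int k) powr s')) \<le> K * 2 powr (- \<eta> * \<bar>real_of_int k\<bar>)"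
      using K by (simp add: mult.left_commute mult_left_mono)
    then have "ennreal ((2 powr real_of_int k) powr - s) * ennreal (K * min 1 ((2 powr real_of_int k) powr s')) \<le> ennreal K * ennreal (2 powr (- \<eta> * \<bar>real_of_int k\<bar>))"
      using K by (simp add: ennreal_leI flip: ennreal_mult)
    then show "ennreal ((2 powr real_of_int k) powr - s) * Besov_osc M p u (2 powr real_of_int k) \<le> ennreal K * ennreal (2 powr (- \<eta> * \<bar>real_of_int k\<bar>))"
      using mult_left_mono[OF le[of "2 powr real_of_int k"], of "ennreal ((2 powr real_of_int k) powr - s)"]
      by simp
  qed simp
  also have "\<dots> < \<infinity>"
    using lq_two_sided_geometric[OF q \<eta>(1)] q by (simp add: lq_cmult ennreal_mult_less_top)
  finally have "Besov_norm M s p q u < \<infinity>"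
    by (simp add: Besov_norm_eq_dt_norm[OF q])
  then show ?thesis
    using in_Lp_loc_of_Besov_norm[OF u p q s(1)] by (simp add: Besov_def)
qed

end

text \<open>Volumes of balls scale exactly like the n-th power of the radius; the constant 2 is
  chosen because \<open>C1\<close> has to exceed 1. The Borel envelopes come from the construction
  of Lebesgue measure as a completion.\<close>

lemma doubling_lebesgue: "doubling_metric_measure (lebesgue :: (real ^ 'n) measure) 2 (real CARD('n))"
proof
  show "sets borel \<subseteq> sets (lebesgue :: (real ^ 'n) measure)"
    by auto
  show "\<exists>B\<in>sets borel. A \<subseteq> B \<and> emeasure lebesgue B = emeasure lebesgue A" if A: "A \<in> sets lebesgue" for A :: "(real ^ 'n) set"
  proof -
    obtain B where "A \<subseteq> B" "B \<in> sets lborel" "B - A \<in> null_sets lebesgue"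
      "emeasure lebesgue A = emeasure lborel B"
      by (rule completion_upper[OF A])
    then show ?thesis
      by (intro bexI[of _ B]) (simp_all only: emeasure_completion[OF sets_completionI_sets] main_part sets_lborel simp_thms)
  qed
  fix x :: "real ^ 'n" and r l :: real
  assume r: "0 < r"
  have eq: "emeasure lebesgue (ball x r) = ennreal (r ^ CARD('n)) * emeasure lebesgue (ball 0 1 :: (real ^ 'n) set)" if "0 < r" for r
    using emeasure_lebesgue_ball_conv_unit_ball[of r x] that by simp
  have fin: "ball y r \<in> lmeasurable" for y :: "real ^ 'n" and r by simp
  show "emeasure lebesgue (ball x r) < \<infinity>"
    using fin[of x r] by (auto simp: fmeasurable_def)
  show "0 < emeasure lebesgue (ball x r)"
    using content_ball_gt_0_iff[of x r] r by (simp add: emeasure_eq_measure2)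
  assume l: "1 < l"
  have "emeasure lebesgue (ball x (l * r)) = ennreal (l ^ CARD('n)) * emeasure lebesgue (ball x r)"
    using eq[of "l * r"] eq[of r] r l by (simp add: power_mult_distrib ennreal_mult mult.assoc)
  also have "\<dots> \<le> ennreal (2 * l powr real CARD('n)) * emeasure lebesgue (ball x r)"
    using l by (intro mult_right_mono ennreal_leI) (auto simp: powr_realpow)
  finally show "emeasure lebesgue (ball x (l * r)) \<le> ennreal (2 * l powr real CARD('n)) * emeasure lebesgue (ball x r)" .
qed auto

section \<open>Bumps and their dilated superpositions\<close>

definition bump :: "'a::real_normed_vector \<Rightarrow> real" where
  "bump x = max 0 (1 - norm x)"

lemma bump_bounds: "0 \<le> bump x" "bump x \<le> 1"
  by (auto simp: bump_def)

lemma bump_eq_0: "1 \<le> norm x \<Longrightarrow> bump x = 0"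
  by (simp add: bump_def)

lemma bump_lipschitz: "\<bar>bump x - bump y\<bar> \<le> dist x y"
  using norm_triangle_ineq3[of x y] by (auto simp: bump_def dist_norm max_def abs_if split: if_splits)

text \<open>The dilation is part of the statement so that it covers all the pieces of
  \<open>spike\<close>; the plain bump occurs below as \<open>bump (1 *\<^sub>R x)\<close>.\<close>

lemma measurable_bump [measurable]: "(\<lambda>x. bump (c *\<^sub>R x)) \<in> borel_measurable (lebesgue :: 'a::euclidean_space measure)"
proof -
  have "continuous_on UNIV (\<lambda>x::'a. bump (c *\<^sub>R x))"
    unfolding bump_def by (intro continuous_intros)
  then have "(\<lambda>x::'a. bump (c *\<^sub>R x)) \<in> borel_measurable borel"
    by (rule borel_measurable_continuous_onI)
  then show ?thesis
    by (simp add: measurable_completion)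
qed

lemma measure_lebesgue_ball:
  "0 < r \<Longrightarrow> emeasure lebesgue (ball (x :: real ^ 'n) r) = ennreal (r ^ CARD('n) * measure lebesgue (ball (0 :: real ^ 'n) 1))"
  using emeasure_lebesgue_ball_conv_unit_ball[of r x]
  by (simp add: emeasure_eq_measure2 ennreal_mult)

text \<open>The difference of values is at most min(1, l t), and it vanishes unless x or y lies in
  the support, a ball of measure proportional to l^(-n). The part with y in the support is
  integrated by \<open>nn_integral_avg_le\<close>.\<close>

lemma bump_average_osc:
  fixes P :: real
  assumes P: "0 < P"
  obtains K where "0 \<le> K" "\<And>l t. 0 < l \<Longrightarrow> 0 < t \<Longrightarrow>
    (\<integral>\<^sup>+x. avg lebesgue (ball x t) (\<lambda>y. ennreal (\<bar>bump (l *\<^sub>R x) - bump (l *\<^sub>R y)\<bar> powr P)) \<partial>(lebesgue :: (real ^ 'n) measure))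
      \<le> ennreal (K * min 1 (l * t) powr P * l powr - real CARD('n))"
proof -
  interpret doubling_metric_measure "lebesgue :: (real ^ 'n) measure" 2 "real CARD('n)"
    by (rule doubling_lebesgue)
  define V where "V = measure lebesgue (ball (0 :: real ^ 'n) 1)"
  show ?thesis
  proof (rule that)
    show "0 \<le> (1 + dbl 1) * V"
      using dbl_pos[of 1] by (simp add: V_def)
    fix l t :: real assume l: "0 < l" and t: "0 < t"
    define B where "B = ball (0 :: real ^ 'n) (1 / l)"
    define m where "m = min 1 (l * t) powr P"
    have m: "0 \<le> m" by (simp add: m_def)
    have [measurable]: "B \<in> sets lebesgue" by (simp add: B_def)
    have muB: "emeasure lebesgue B = ennreal (l powr - real CARD('n) * V)"
      unfolding B_def using measure_lebesgue_ball[of "1 / l" "0 :: real ^ 'n"] l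
      by (simp add: V_def powr_minus powr_realpow power_one_over inverse_eq_divide)
    have "(\<integral>\<^sup>+x. avg lebesgue (ball x t) (\<lambda>y. ennreal (\<bar>bump (l *\<^sub>R x) - bump (l *\<^sub>R y)\<bar> powr P)) \<partial>(lebesgue :: (real ^ 'n) measure))
        \<le> (\<integral>\<^sup>+x. ennreal m * (indicator B x + avg lebesgue (ball x t) (indicator B)) \<partial>lebesgue)"
    proof (rule nn_integral_mono)
      fix x :: "real ^ 'n"
      have "avg lebesgue (ball x t) (\<lambda>y. ennreal (\<bar>bump (l *\<^sub>R x) - bump (l *\<^sub>R y)\<bar> powr P))
          \<le> avg lebesgue (ball x t) (\<lambda>y. ennreal m * (indicator B x + indicator B y))"
      proof (rule avg_mono)
        fix y assume y: "y \<in> ball x t"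
        show "ennreal (\<bar>bump (l *\<^sub>R x) - bump (l *\<^sub>R y)\<bar> powr P) \<le> ennreal m * (indicator B x + indicator B y)"
        proof (cases "x \<in> B \<or> y \<in> B")
          case True
          have "dist (l *\<^sub>R x) (l *\<^sub>R y) = l * dist x y"
            using l by (simp add: dist_norm flip: scaleR_diff_right)
          also have "\<dots> \<le> l * t"
            using y l by simp
          finally have "\<bar>bump (l *\<^sub>R x) - bump (l *\<^sub>R y)\<bar> \<le> l * t"
            using bump_lipschitz by (rule order_trans[rotated])
          moreover have "\<bar>bump (l *\<^sub>R x) - bump (l *\<^sub>R y)\<bar> \<le> 1"
            using bump_bounds[of "l *\<^sub>R x"] bump_bounds[of "l *\<^sub>R y"] by linarith
          ultimately have "\<bar>bump (l *\<^sub>R x) - bump (l *\<^sub>R y)\<bar> powr P \<le> m"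
            unfolding m_def using P by (intro powr_mono2) auto
          then have "ennreal (\<bar>bump (l *\<^sub>R x) - bump (l *\<^sub>R y)\<bar> powr P) \<le> ennreal m * 1"
            by (simp add: ennreal_leI)
          also have "\<dots> \<le> ennreal m * (indicator B x + indicator B y)"
            using True by (intro mult_left_mono) (auto split: split_indicator)
          finally show ?thesis .
        next
          case False
          then have "bump (l *\<^sub>R x) = 0" "bump (l *\<^sub>R y) = 0"
            using l by (auto simp: B_def not_less field_simps intro!: bump_eq_0)
          then show ?thesis by simp
        qed
      qed
      also have "\<dots> = ennreal m * (indicator B x + avg lebesgue (ball x t) (indicator B))"
        using t by (simp add: avg_cmult avg_add)
      finally show "avg lebesgue (ball x t) (\<lambda>y. ennreal (\<bar>bump (l *\<^sub>R x) - bump (l *\<^sub>R y)\<bar> powr P))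
          \<le> ennreal m * (indicator B x + avg lebesgue (ball x t) (indicator B))" .
    qed
    also have "\<dots> = ennreal m * (emeasure lebesgue B + (\<integral>\<^sup>+x. avg lebesgue (ball x t) (indicator B) \<partial>lebesgue))"
      by (simp add: nn_integral_cmult nn_integral_add)
    also have "\<dots> \<le> ennreal m * (emeasure lebesgue B + ennreal (dbl 1) * emeasure lebesgue B)"
      using nn_integral_avg_le[OF t, of "indicator B"] by (intro mult_left_mono add_left_mono) auto
    also have "\<dots> = ennreal (m * ((1 + dbl 1) * (l powr - real CARD('n) * V)))"
      unfolding muB using m dbl_pos[of 1] by (simp add: V_def ennreal_mult ring_distribs)
    also have "m * ((1 + dbl 1) * (l powr - real CARD('n) * V)) = (1 + dbl 1) * V * min 1 (l * t) powr P * l powr - real CARD('n)"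
      by (simp add: m_def)
    finally show "(\<integral>\<^sup>+x. avg lebesgue (ball x t) (\<lambda>y. ennreal (\<bar>bump (l *\<^sub>R x) - bump (l *\<^sub>R y)\<bar> powr P)) \<partial>(lebesgue :: (real ^ 'n) measure))
        \<le> ennreal ((1 + dbl 1) * V * min 1 (l * t) powr P * l powr - real CARD('n))" .
  qed
qed

lemma bump_in_Besov:
  assumes s: "0 < s" "s < 1" and P: "0 < P" and q: "0 < q"
  shows "(\<lambda>x :: real ^ 'n. bump (1 *\<^sub>R x)) \<in> members (Besov lebesgue s (ennreal P) q)"
proof -
  interpret doubling_metric_measure "lebesgue :: (real ^ 'n) measure" 2 "real CARD('n)"
    by (rule doubling_lebesgue)
  obtain K where K: "0 \<le> K" "\<And>l t. 0 < l \<Longrightarrow> 0 < t \<Longrightarrow>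
    (\<integral>\<^sup>+x. avg lebesgue (ball x t) (\<lambda>y. ennreal (\<bar>bump (l *\<^sub>R x) - bump (l *\<^sub>R y)\<bar> powr P)) \<partial>(lebesgue :: (real ^ 'n) measure))
      \<le> ennreal (K * min 1 (l * t) powr P * l powr - real CARD('n))"
    using bump_average_osc[OF P, where 'n='n] by blast
  show ?thesis
  \<comment> \<open>The Lipschitz bound gives smoothness of order 1, which exceeds s.\<close>
  proof (rule in_Besov_of_osc_le[where s'=1 and K="K powr (1 / P)"])
    fix t :: real assume t: "0 < t"
    have "Besov_osc lebesgue (ennreal P) (\<lambda>x :: real ^ 'n. bump (1 *\<^sub>R x)) t \<le> epow (ennreal (K * min 1 t powr P)) (1 / P)"
      using K(2)[of 1 t] t P by (simp add: Besov_osc_def epow_mono)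
    also have "\<dots> = ennreal (K powr (1 / P) * min 1 (t powr 1))"
      using K(1) P t by (simp add: epow_ennreal powr_mult powr_powr)
    finally show "Besov_osc lebesgue (ennreal P) (\<lambda>x :: real ^ 'n. bump (1 *\<^sub>R x)) t \<le> ennreal (K powr (1 / P) * min 1 (t powr 1))" .
  qed (use s P q measurable_bump[of 1] in simp_all)
qed

text \<open>The values of the series at the origin, where it diverges, are irrelevant.\<close>

definition spike :: "real \<Rightarrow> 'a::euclidean_space \<Rightarrow> real" where
  "spike a x = (\<Sum>j. 2 powr (a * real j) * bump ((2 ^ j) *\<^sub>R x))"

lemma measurable_spike [measurable]: "spike a \<in> borel_measurable lebesgue"
  unfolding spike_def by measurable

lemma summable_spike:
  assumes "x \<noteq> 0"
  shows "summable (\<lambda>j. 2 powr (a * real j) * bump ((2 ^ j) *\<^sub>R x))"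
proof -
  obtain J :: nat where J: "1 / norm x < 2 ^ J"
    using real_arch_pow[of 2] by auto
  have "bump ((2 ^ j) *\<^sub>R x) = 0" if "J \<le> j" for j
  proof (rule bump_eq_0)
    have "(2 :: real) ^ J \<le> 2 ^ j"
      using that by (intro power_increasing) auto
    then have "1 / norm x < 2 ^ j"
      using J by linarith
    then show "1 \<le> norm ((2 ^ j) *\<^sub>R x)"
      using assms by (simp add: field_simps)
  qed
  then show ?thesis
    by (intro summable_finite[of "{..<J}"]) (auto simp: not_less)
qed

lemma spike_ge:
  assumes "x \<noteq> 0" "norm x \<le> 1 / 2 ^ Suc J"
  shows "2 powr (a * real J) / 2 \<le> spike a x"
proof -
  have "1 / 2 \<le> bump ((2 ^ J) *\<^sub>R x)"
    using assms by (simp add: bump_def field_simps le_max_iff_disj)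
  then have "2 powr (a * real J) * (1 / 2) \<le> 2 powr (a * real J) * bump ((2 ^ J) *\<^sub>R x)"
    by (intro mult_left_mono) auto
  also have "\<dots> = (\<Sum>j\<in>{J}. 2 powr (a * real j) * bump ((2 ^ j) *\<^sub>R x))"
    by simp
  also have "\<dots> \<le> spike a x"
    unfolding spike_def by (rule sum_le_suminf[OF summable_spike[OF assms(1)]]) (auto simp: bump_bounds)
  finally show ?thesis by simp
qed

text \<open>The sum over j is exchanged for a supremum at the price 2^(d j), and the
  \<open>P\<close>-th power of the supremum for a sum of \<open>P\<close>-th powers, so that P may
  lie on either side of 1.\<close>

lemma spike_diff_powr_le:
  assumes xy: "x \<noteq> 0" "y \<noteq> 0" and d: "0 < d" and P: "0 < P"
  shows "ennreal (\<bar>spike a x - spike a y\<bar> powr P) \<le> ennreal ((1 / (1 - 2 powr - d)) powr P) *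
    (\<Sum>j. ennreal (2 powr ((a + d) * P * real j)) * ennreal (\<bar>bump ((2 ^ j) *\<^sub>R x) - bump ((2 ^ j) *\<^sub>R y)\<bar> powr P))"
proof -
  define c where "c j = 2 powr (a * real j) * \<bar>bump ((2 ^ j) *\<^sub>R x) - bump ((2 ^ j) *\<^sub>R y)\<bar>" for j :: nat
  define D where "D j = 2 powr (a * real j) * bump ((2 ^ j) *\<^sub>R x) - 2 powr (a * real j) * bump ((2 ^ j) *\<^sub>R y)" for j :: nat
  have D: "\<bar>D j\<bar> = c j" for j
    by (simp add: D_def c_def abs_mult flip: right_diff_distrib)
  have "D sums (spike a x - spike a y)"
    unfolding D_def spike_def using xy by (intro sums_diff summable_sums summable_spike)
  then have lim: "(\<lambda>N. ennreal \<bar>sum D {..<N}\<bar>) \<longlonglongrightarrow> ennreal \<bar>spike a x - spike a y\<bar>"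
    by (intro tendsto_ennrealI tendsto_rabs) (simp add: sums_def)
  have bound: "ennreal \<bar>sum D {..<N}\<bar> \<le> (\<Sum>j. ennreal (c j))" for N
  proof -
    have "\<bar>sum D {..<N}\<bar> \<le> (\<Sum>j<N. c j)"
      using sum_abs[of D "{..<N}"] by (simp add: D)
    then have "ennreal \<bar>sum D {..<N}\<bar> \<le> (\<Sum>j<N. ennreal (c j))"
      by (simp add: sum_ennreal c_def ennreal_leI)
    also have "\<dots> \<le> (\<Sum>j. ennreal (c j))"
      by (intro sum_le_suminf) auto
    finally show ?thesis .
  qed
  have "ennreal \<bar>spike a x - spike a y\<bar> \<le> (\<Sum>j. ennreal (c j))"
    by (rule LIMSEQ_le_const2[OF lim]) (use bound in blast)
  also have "\<dots> \<le> (\<Sum>j. ennreal (2 powr (- d * real j)) * (SUP j. ennreal (2 powr (d * real j)) * ennreal (c j)))"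
  proof (intro suminf_le)
    fix j
    have "ennreal (c j) = ennreal (2 powr (- d * real j)) * (ennreal (2 powr (d * real j)) * ennreal (c j))"
      by (simp add: mult.assoc[symmetric] flip: ennreal_mult powr_add)
    also have "\<dots> \<le> ennreal (2 powr (- d * real j)) * (SUP j. ennreal (2 powr (d * real j)) * ennreal (c j))"
      by (intro mult_left_mono SUP_upper) auto
    finally show "ennreal (c j) \<le> ennreal (2 powr (- d * real j)) * (SUP j. ennreal (2 powr (d * real j)) * ennreal (c j))" .
  qed auto
  also have "\<dots> = ennreal (1 / (1 - 2 powr - d)) * (SUP j. ennreal (2 powr (d * real j)) * ennreal (c j))"
    by (subst ennreal_suminf_multc, subst suminf_geometric_powr) (use d in simp_all)
  finally have "epow (ennreal \<bar>spike a x - spike a y\<bar>) P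
      \<le> epow (ennreal (1 / (1 - 2 powr - d)) * (SUP j. ennreal (2 powr (d * real j)) * ennreal (c j))) P"
    using P by (intro epow_mono)
  also have "\<dots> = ennreal ((1 / (1 - 2 powr - d)) powr P) * epow (SUP j. ennreal (2 powr (d * real j)) * ennreal (c j)) P"
    using P d by (simp add: epow_mult epow_ennreal powr_less_one less_imp_le)
  also have "\<dots> \<le> ennreal ((1 / (1 - 2 powr - d)) powr P) * (\<Sum>j. epow (ennreal (2 powr (d * real j)) * ennreal (c j)) P)"
    by (intro mult_left_mono epow_SUP_le_suminf P) auto
  also have "(\<lambda>j. epow (ennreal (2 powr (d * real j)) * ennreal (c j)) P)
      = (\<lambda>j. ennreal (2 powr ((a + d) * P * real j)) * ennreal (\<bar>bump ((2 ^ j) *\<^sub>R x) - bump ((2 ^ j) *\<^sub>R y)\<bar> powr P))"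
  proof
    fix j
    have "(2 powr (d * real j) * c j) powr P = 2 powr ((a + d) * P * real j) * \<bar>bump ((2 ^ j) *\<^sub>R x) - bump ((2 ^ j) *\<^sub>R y)\<bar> powr P"
      by (simp add: c_def powr_mult powr_powr flip: powr_add mult.assoc) (simp add: algebra_simps)
    then show "epow (ennreal (2 powr (d * real j)) * ennreal (c j)) P
        = ennreal (2 powr ((a + d) * P * real j)) * ennreal (\<bar>bump ((2 ^ j) *\<^sub>R x) - bump ((2 ^ j) *\<^sub>R y)\<bar> powr P)"
      by (simp add: c_def epow_ennreal flip: ennreal_mult)
  qed
  finally show ?thesis
    by (simp only: epow_ennreal_abs_powr)
qed

text \<open>The j-th dilate contributes 2^((a + d) P j) min(1, 2^j t)^P 2^(-j n), where min(1, 2^j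
  t) \<le> 2^(j s') min(1, t^s'). As n = (a + 2 d + s') P, a factor 2^(-d P j) remains for the
  summation.\<close>

lemma spike_in_Besov:
  assumes P: "0 < P" and s: "0 < s" "s < 1" "s < real CARD('n) / P - a" and q: "0 < q"
  shows "(spike a :: real ^ 'n \<Rightarrow> real) \<in> members (Besov lebesgue s (ennreal P) q)"
proof -
  interpret doubling_metric_measure "lebesgue :: (real ^ 'n) measure" 2 "real CARD('n)"
    by (rule doubling_lebesgue)
  obtain K where K: "0 \<le> K" "\<And>l t. 0 < l \<Longrightarrow> 0 < t \<Longrightarrow>
    (\<integral>\<^sup>+x. avg lebesgue (ball x t) (\<lambda>y. ennreal (\<bar>bump (l *\<^sub>R x) - bump (l *\<^sub>R y)\<bar> powr P)) \<partial>(lebesgue :: (real ^ 'n) measure))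
      \<le> ennreal (K * min 1 (l * t) powr P * l powr - real CARD('n))"
    using bump_average_osc[OF P, where 'n='n] by blast
  \<comment> \<open>Room above s is required by \<open>in_Besov_of_osc_le\<close>; s' < 1 is the
    limit set by Lipschitz continuity, and s' < n/P - a leaves the margin that \<open>d\<close>
    halves.\<close>
  obtain s' where s': "s < s'" "s' < 1" "s' < real CARD('n) / P - a"
    using dense[of s "min 1 (real CARD('n) / P - a)"] s by auto
  define d where "d = (real CARD('n) / P - a - s') / 2"
  have d: "0 < d" using s' by (simp add: d_def)
  define G where "G = (1 / (1 - 2 powr - d)) powr P"
  define L where "L = G * (K * (1 / (1 - 2 powr - (d * P))))"
  have geo: "0 \<le> 1 / (1 - 2 powr - (d * P) :: real)"
    using d P by (simp add: powr_less_one less_imp_le)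
  have L: "0 \<le> L"
    using K(1) geo unfolding L_def G_def by (intro mult_nonneg_nonneg) auto
  have ae: "AE x in lebesgue. x \<noteq> (0 :: real ^ 'n)"
    by (intro AE_completion AE_lborel_singleton)
  show ?thesis
  proof (rule in_Besov_of_osc_le[where s'=s' and K="L powr (1 / P)"])
    fix t :: real assume t: "0 < t"
    define m where "m = min 1 (t powr s')"
    define w where "w j = 2 powr ((a + d) * P * real j)" for j :: nat
    define D where "D j x = avg lebesgue (ball x t) (\<lambda>y. ennreal (\<bar>bump ((2 ^ j) *\<^sub>R x) - bump ((2 ^ j) *\<^sub>R y)\<bar> powr P))"
      for j :: nat and x :: "real ^ 'n"
    have [measurable]: "D j \<in> borel_measurable lebesgue" for j
      unfolding D_def by (rule measurable_avg) measurable
    have piece: "ennreal (w j) * (\<integral>\<^sup>+x. D j x \<partial>lebesgue) \<le> ennreal (2 powr (- (d * P) * real j)) * ennreal (K * m powr P)" for j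
    proof -
      have "min 1 (2 ^ j * t) \<le> (2 ^ j) powr s' * m"
      proof -
        have "min 1 (2 ^ j * t) \<le> (2 ^ j * t) powr s'"
        proof (cases "2 ^ j * t \<le> 1")
          case True
          then have "(2 ^ j * t) powr 1 \<le> (2 ^ j * t) powr s'"
            using t s' by (intro powr_mono') auto
          then show ?thesis using t by simp
        next
          case False
          then show ?thesis
            using s s' by (auto simp: ge_one_powr_ge_zero min_le_iff_disj)
        qed
        moreover have "min 1 (2 ^ j * t) \<le> (2 ^ j) powr s' * 1"
          using s s' by (auto simp: ge_one_powr_ge_zero min_le_iff_disj)
        ultimately show ?thesis
          using t by (cases "1 \<le> t powr s'") (simp_all add: m_def powr_mult min_absorb2)
      qed
      then have "min 1 (2 ^ j * t) powr P \<le> ((2 ^ j) powr s' * m) powr P"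
        using t P by (intro powr_mono2) auto
      also have "\<dots> = 2 powr (real j * s' * P) * m powr P"
        by (simp add: m_def powr_mult powr_powr flip: powr_realpow)
      finally have min_le: "min 1 (2 ^ j * t) powr P \<le> 2 powr (real j * s' * P) * m powr P" .
      have "w j * (K * min 1 (2 ^ j * t) powr P * (2 ^ j) powr - real CARD('n))
          \<le> w j * (K * (2 powr (real j * s' * P) * m powr P) * (2 ^ j) powr - real CARD('n))"
        using K(1) by (intro mult_left_mono mult_right_mono min_le) (auto simp: w_def)
      also have "\<dots> = (2 powr ((a + d) * P * real j) * (2 powr (real j * s' * P) * 2 powr (real j * - real CARD('n)))) * (K * m powr P)"
        by (simp add: w_def powr_powr flip: powr_realpow)
      also have "2 powr ((a + d) * P * real j) * (2 powr (real j * s' * P) * 2 powr (real j * - real CARD('n))) = (2 :: real) powr (- (d * P) * real j)"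
      proof -
        have "a * P + 2 * d * P + s' * P = real CARD('n)"
          using P by (simp add: d_def field_simps)
        then have "real CARD('n) = a * P + 2 * d * P + s' * P" ..
        then show ?thesis
          unfolding powr_add[symmetric] by (simp only: ring_distribs minus_mult_right[symmetric]) (simp add: algebra_simps)
      qed
      finally have real_le: "w j * (K * min 1 (2 ^ j * t) powr P * (2 ^ j) powr - real CARD('n))
          \<le> 2 powr (- (d * P) * real j) * (K * m powr P)" .
      have "ennreal (w j) * (\<integral>\<^sup>+x. D j x \<partial>lebesgue) \<le> ennreal (w j) * ennreal (K * min 1 (2 ^ j * t) powr P * (2 ^ j) powr - real CARD('n))"
        unfolding D_def using t by (intro mult_left_mono K(2)) auto
      also have "\<dots> = ennreal (w j * (K * min 1 (2 ^ j * t) powr P * (2 ^ j) powr - real CARD('n)))"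
        using K(1) by (subst ennreal_mult) (auto simp: w_def)
      also have "\<dots> \<le> ennreal (2 powr (- (d * P) * real j) * (K * m powr P))"
        by (rule ennreal_leI[OF real_le])
      also have "\<dots> = ennreal (2 powr (- (d * P) * real j)) * ennreal (K * m powr P)"
        using K(1) by (subst ennreal_mult) auto
      finally show ?thesis .
    qed
    have "(\<integral>\<^sup>+x. avg lebesgue (ball x t) (\<lambda>y. ennreal (\<bar>spike a x - spike a y\<bar> powr P)) \<partial>(lebesgue :: (real ^ 'n) measure))
        \<le> (\<integral>\<^sup>+x. ennreal G * (\<Sum>j. ennreal (w j) * D j x) \<partial>lebesgue)"
    proof (rule nn_integral_mono_AE, use ae in eventually_elim)
      case (elim x)
      have "avg lebesgue (ball x t) (\<lambda>y. ennreal (\<bar>spike a x - spike a y\<bar> powr P))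
          \<le> avg lebesgue (ball x t) (\<lambda>y. ennreal G * (\<Sum>j. ennreal (w j) * ennreal (\<bar>bump ((2 ^ j) *\<^sub>R x) - bump ((2 ^ j) *\<^sub>R y)\<bar> powr P)))"
        using ae by (intro avg_mono_AE) (auto elim!: eventually_mono simp: G_def w_def intro!: spike_diff_powr_le elim d P)
      also have "\<dots> = ennreal G * (\<Sum>j. ennreal (w j) * D j x)"
        by (simp add: avg_cmult avg_suminf D_def)
      finally show ?case .
    qed
    also have "\<dots> = ennreal G * (\<Sum>j. ennreal (w j) * (\<integral>\<^sup>+x. D j x \<partial>lebesgue))"
      by (simp add: nn_integral_cmult nn_integral_suminf)
    also have "\<dots> \<le> ennreal G * (\<Sum>j. ennreal (2 powr (- (d * P) * real j)) * ennreal (K * m powr P))"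
      by (intro mult_left_mono suminf_le piece) auto
    also have "\<dots> = ennreal G * (ennreal (1 / (1 - 2 powr - (d * P))) * ennreal (K * m powr P))"
      by (subst ennreal_suminf_multc, subst suminf_geometric_powr) (use d P in simp_all)
    also have "\<dots> = ennreal (L * m powr P)"
    proof -
      have "ennreal G * (ennreal (1 / (1 - 2 powr - (d * P))) * ennreal (K * m powr P)) = ennreal (G * (1 / (1 - 2 powr - (d * P)) * (K * m powr P)))"
        using K(1) geo by (simp only: ennreal_mult[symmetric] G_def powr_ge_zero mult_nonneg_nonneg)
      then show ?thesis by (simp add: L_def mult_ac)
    qed
    finally have "Besov_osc lebesgue (ennreal P) (spike a :: real ^ 'n \<Rightarrow> real) t \<le> epow (ennreal (L * m powr P)) (1 / P)"
      using P by (simp add: Besov_osc_def epow_mono)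
    also have "\<dots> = ennreal (L powr (1 / P) * m)"
      using L P by (simp add: epow_ennreal powr_mult powr_powr m_def)
    finally show "Besov_osc lebesgue (ennreal P) (spike a :: real ^ 'n \<Rightarrow> real) t \<le> ennreal (L powr (1 / P) * min 1 (t powr s'))"
      by (simp add: m_def)
  qed (use s s' P q in simp_all)
qed

text \<open>On the ball of radius 2^(-(J+1)) about the origin the J-th term alone contributes 2^(a
  J)/2, so the integral is at least a constant times 2^(J (a \<sigma> - n)), which is unbounded in
  J.\<close>

lemma spike_not_in_Lp_loc:
  assumes \<sigma>: "0 < \<sigma>" and a: "real CARD('n) < a * \<sigma>"
  shows "(spike a :: real ^ 'n \<Rightarrow> real) \<notin> Lp_loc lebesgue (ennreal \<sigma>)"
proof
  assume "(spike a :: real ^ 'n \<Rightarrow> real) \<in> Lp_loc lebesgue (ennreal \<sigma>)"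
  interpret doubling_metric_measure "lebesgue :: (real ^ 'n) measure" 2 "real CARD('n)"
    by (rule doubling_lebesgue)
  define I where "I = (\<integral>\<^sup>+x\<in>ball (0 :: real ^ 'n) 1. ennreal (\<bar>spike a x\<bar> powr \<sigma>) \<partial>lebesgue)"
  have "I < \<infinity>"
    using \<open>spike a \<in> _\<close> Lp_loc_finite_iff[OF measurable_spike \<sigma>, of "0 :: real ^ 'n" 1 a] by (simp add: Lp_loc_def I_def)
  then obtain i where i: "I = ennreal i" "0 \<le> i"
    by (cases I) auto
  define V where "V = measure lebesgue (ball (0 :: real ^ 'n) 1)"
  have V: "0 < V"
    using content_ball_gt_0_iff[of "0 :: real ^ 'n" 1] by (simp add: V_def)
  define c where "c = V / (2 powr \<sigma> * 2 ^ CARD('n))"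
  have c: "0 < c" using V by (simp add: c_def)
  define b where "b = 2 powr (a * \<sigma> - real CARD('n))"
  have b: "1 < b" using a by (simp add: b_def)
  have ae: "AE x in lebesgue. x \<noteq> (0 :: real ^ 'n)"
    by (intro AE_completion AE_lborel_singleton)
  have "c * b ^ J \<le> i" for J
  proof -
    let ?B = "ball (0 :: real ^ 'n) (1 / 2 ^ Suc J)"
    have "ennreal ((2 powr (a * real J) / 2) powr \<sigma>) * emeasure lebesgue ?B
        = (\<integral>\<^sup>+x\<in>?B. ennreal ((2 powr (a * real J) / 2) powr \<sigma>) \<partial>lebesgue)"
      by (simp add: nn_integral_cmult_indicator)
    also have "\<dots> \<le> I"
      unfolding I_def
    proof (rule nn_integral_mono_AE, use ae in eventually_elim)
      case (elim x)
      show ?case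
      proof (cases "x \<in> ?B")
        case True
        then have "2 powr (a * real J) / 2 \<le> spike a x"
          using elim by (intro spike_ge) auto
        then have "(2 powr (a * real J) / 2) powr \<sigma> \<le> \<bar>spike a x\<bar> powr \<sigma>"
          using \<sigma> by (intro powr_mono2) auto
        moreover have "x \<in> ball 0 1"
        proof -
          have "1 / 2 ^ Suc J \<le> (1 :: real)"
            using one_le_power[of "2 :: real" "Suc J"] by (simp add: divide_le_eq_1)
          moreover have "norm x < 1 / 2 ^ Suc J"
            using True by (simp del: power_Suc)
          ultimately have "norm x < 1"
            by linarith
          then show ?thesis
            by simp
        qed
        ultimately show ?thesis
          using True by (simp add: ennreal_leI)
      qed simp
    qed
    also have "emeasure lebesgue ?B = ennreal ((1 / 2 ^ Suc J) ^ CARD('n) * V)"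
      unfolding V_def by (rule measure_lebesgue_ball) simp
    finally have "(2 powr (a * real J) / 2) powr \<sigma> * ((1 / 2 ^ Suc J) ^ CARD('n) * V) \<le> i"
      using i V by (simp add: ennreal_le_iff flip: ennreal_mult)
    moreover have "(2 powr (a * real J) / 2) powr \<sigma> * ((1 / 2 ^ Suc J) ^ CARD('n) * V) = c * b ^ J"
    proof -
      have "b ^ J = 2 powr (a * real J * \<sigma>) / 2 powr (real J * real CARD('n))"
        by (simp add: b_def powr_powr left_diff_distrib right_diff_distrib mult_ac flip: powr_realpow powr_diff)
      moreover have "(2 powr (a * real J) / 2) powr \<sigma> = 2 powr (a * real J * \<sigma>) / 2 powr \<sigma>"
        by (simp add: powr_divide powr_powr)
      moreover have "(1 / 2 ^ Suc J) ^ CARD('n) = 1 / (2 ^ CARD('n) * 2 powr (real J * real CARD('n)) :: real)"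
        by (simp add: power_divide power_mult_distrib powr_realpow flip: power_mult of_nat_mult)
      ultimately show ?thesis
        by (simp add: c_def mult_ac)
    qed
    ultimately show ?thesis by simp
  qed
  moreover obtain J where "i / c < b ^ J"
    using real_arch_pow[OF b] by blast
  then have "i < c * b ^ J"
    using c by (simp add: field_simps)
  ultimately show False
    by (meson not_less)
qed

section \<open>Failure at the endpoint \<epsilon> = s\<close>

lemma bump_oscillates:
  assumes P: "0 < P"
  obtains \<kappa> where "0 < \<kappa>" "\<And>x :: real ^ 'n. x \<in> ball 0 1 \<Longrightarrow>
    ennreal \<kappa> \<le> (INF c::real. avg lebesgue (ball x 4) (\<lambda>y. ennreal (\<bar>bump (1 *\<^sub>R y) - c\<bar> powr P)))"
proof -
  interpret doubling_metric_measure "lebesgue :: (real ^ 'n) measure" 2 "real CARD('n)"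
    by (rule doubling_lebesgue)
  define V where "V = measure lebesgue (ball (0 :: real ^ 'n) 1)"
  have V: "0 < V"
    using content_ball_gt_0_iff[of "0 :: real ^ 'n" 1] by (simp add: V_def)
  obtain v :: "real ^ 'n" where v: "norm v = 2"
    using vector_choose_size[of 2] by auto
  define N where "N = CARD('n)"
  define \<kappa> where "\<kappa> = (1 / 4) powr P * ((1 / 4) ^ N * V) / (4 ^ N * V)"
  have "ennreal \<kappa> \<le> avg lebesgue (ball x 4) (\<lambda>y. ennreal (\<bar>bump (1 *\<^sub>R y) - c\<bar> powr P))"
    if x: "x \<in> ball 0 1" for x :: "real ^ 'n" and c
  proof -
    \<comment> \<open>No constant fits both values of the bump: it exceeds 3/4 on a small ball about
      the origin and vanishes on one about a vector of norm 2, and every c is at distance at least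
      1/4 from one of the two.\<close>
    have "\<exists>z. ball z (1 / 4) \<subseteq> ball x 4 \<and> (\<forall>y\<in>ball z (1 / 4). 1 / 4 \<le> \<bar>bump (1 *\<^sub>R y) - c\<bar>)"
    proof (cases "c \<le> 1 / 2")
      case True
      have "y \<in> ball x 4 \<and> 1 / 4 \<le> \<bar>bump (1 *\<^sub>R y) - c\<bar>" if "y \<in> ball 0 (1 / 4)" for y
        using that True x dist_triangle[of x y 0] by (simp add: bump_def dist_commute)
      then show ?thesis by blast
    next
      case False
      have "y \<in> ball x 4 \<and> 1 / 4 \<le> \<bar>bump (1 *\<^sub>R y) - c\<bar>" if y: "y \<in> ball v (1 / 4)" for y
      proof -
        have "norm v \<le> norm y + dist v y"
          using norm_triangle_sub[of v y] by (simp add: dist_norm)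
        then have "bump y = 0"
          using y v by (intro bump_eq_0) simp
        moreover have "dist x y \<le> dist x 0 + (dist 0 v + dist v y)"
          using dist_triangle[of x y 0] dist_triangle[of 0 y v] by linarith
        then have "dist x y < 4"
          using x y v by (simp add: dist_commute)
        ultimately show ?thesis
          using False by simp
      qed
      then show ?thesis by blast
    qed
    then obtain z where z: "ball z (1 / 4) \<subseteq> ball x 4" "\<And>y. y \<in> ball z (1 / 4) \<Longrightarrow> 1 / 4 \<le> \<bar>bump (1 *\<^sub>R y) - c\<bar>"
      by blast
    have "ennreal ((1 / 4) powr P) * emeasure lebesgue (ball z (1 / 4)) = (\<integral>\<^sup>+y\<in>ball z (1 / 4). ennreal ((1 / 4) powr P) \<partial>lebesgue)"
      by (simp add: nn_integral_cmult_indicator)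
    also have "\<dots> \<le> (\<integral>\<^sup>+y\<in>ball x 4. ennreal (\<bar>bump (1 *\<^sub>R y) - c\<bar> powr P) \<partial>lebesgue)"
    proof (rule nn_integral_mono)
      fix y :: "real ^ 'n"
      show "ennreal ((1 / 4) powr P) * indicator (ball z (1 / 4)) y
          \<le> ennreal (\<bar>bump (1 *\<^sub>R y) - c\<bar> powr P) * indicator (ball x 4) y"
      proof (cases "y \<in> ball z (1 / 4)")
        case True
        then have "(1 / 4) powr P \<le> \<bar>bump (1 *\<^sub>R y) - c\<bar> powr P"
          using z P by (intro powr_mono2) auto
        then show ?thesis
          using True z(1) by (auto simp: ennreal_leI subset_iff)
      qed simp
    qed
    finally have "ennreal ((1 / 4) powr P) * emeasure lebesgue (ball z (1 / 4)) / emeasure lebesgue (ball x 4)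
        \<le> avg lebesgue (ball x 4) (\<lambda>y. ennreal (\<bar>bump (1 *\<^sub>R y) - c\<bar> powr P))"
      unfolding avg_def by (rule divide_right_mono_ennreal)
    moreover have "ennreal ((1 / 4) powr P) * emeasure lebesgue (ball z (1 / 4)) / emeasure lebesgue (ball x 4) = ennreal \<kappa>"
      using measure_lebesgue_ball[of "1 / 4" z] measure_lebesgue_ball[of 4 x] V
      by (simp add: \<kappa>_def V_def N_def divide_ennreal flip: ennreal_mult)
    ultimately show ?thesis by simp
  qed
  moreover have "0 < \<kappa>"
    using V by (simp add: \<kappa>_def)
  ultimately show ?thesis
    using that by (meson INF_greatest)
qed

text \<open>For \<open>\<epsilon> = s\<close> the functional \<^const>\<open>vecS\<close> is nondecreasing in \<open>t\<close>, so its norm is infinite unless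
  it vanishes.\<close>

lemma bump_not_in_SB:
  assumes P: "0 < P"
  shows "(\<lambda>x :: real ^ 'n. bump (1 *\<^sub>R x)) \<notin> members (SB lebesgue s s P (ennreal P) (ennreal P))"
proof
  let ?u = "\<lambda>x :: real ^ 'n. bump (1 *\<^sub>R x)"
  assume "?u \<in> members (SB lebesgue s s P (ennreal P) (ennreal P))"
  then have "vec_norm lebesgue (ennreal P) (ennreal P) (vecS lebesgue s s P) ?u < \<infinity>"
    by (simp add: SB_def vec_space_def)
  then have fin: "(\<integral>\<^sup>+t\<in>{0<..}. epow (Lp_norm lebesgue (ennreal P) (\<lambda>x. vecS lebesgue s s P ?u x t)) P * ennreal (1 / t) \<partial>lborel) < \<infinity>"
    using P by (simp add: vec_norm_def epow_less_top_iff)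
  interpret doubling_metric_measure "lebesgue :: (real ^ 'n) measure" 2 "real CARD('n)"
    by (rule doubling_lebesgue)
  obtain \<kappa> where \<kappa>: "0 < \<kappa>" "\<And>x :: real ^ 'n. x \<in> ball 0 1 \<Longrightarrow>
    ennreal \<kappa> \<le> (INF c::real. avg lebesgue (ball x 4) (\<lambda>y. ennreal (\<bar>bump (1 *\<^sub>R y) - c\<bar> powr P)))"
    using bump_oscillates[OF P, where 'n='n] by blast
  define V where "V = measure lebesgue (ball (0 :: real ^ 'n) 1)"
  have V: "0 < V"
    using content_ball_gt_0_iff[of "0 :: real ^ 'n" 1] by (simp add: V_def)
  define e where "e = 4 powr - s * \<kappa> powr (1 / P)"
  have e: "0 < e" using \<kappa>(1) by (simp add: e_def)
  define C where "C = e powr P * V"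
  have C: "0 < C" using e V by (simp add: C_def)
  have low: "ennreal C \<le> epow (Lp_norm lebesgue (ennreal P) (\<lambda>x. vecS lebesgue s s P ?u x t)) P" if t: "4 \<le> t" for t
  proof -
    have "ennreal C = (\<integral>\<^sup>+x\<in>ball (0 :: real ^ 'n) 1. ennreal (e powr P) \<partial>lebesgue)"
      using V by (simp add: nn_integral_cmult_indicator C_def V_def emeasure_eq_measure2 ennreal_mult)
    also have "\<dots> \<le> (\<integral>\<^sup>+x. epow (vecS lebesgue s s P ?u x t) P \<partial>lebesgue)"
    proof (rule nn_integral_mono)
      fix x :: "real ^ 'n"
      show "ennreal (e powr P) * indicator (ball 0 1) x \<le> epow (vecS lebesgue s s P ?u x t) P"
      proof (cases "x \<in> ball 0 1")
        case True
        have "epow (ennreal \<kappa>) (1 / P) \<le> oscI P ?u 4 x"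
          unfolding oscI_def using \<kappa>(2)[OF True] P by (intro epow_mono) auto
        then have "ennreal (4 powr - s) * ennreal (\<kappa> powr (1 / P)) \<le> ennreal (4 powr - s) * oscI P ?u 4 x"
          using \<kappa>(1) by (intro mult_left_mono) (auto simp: epow_ennreal)
        also have "\<dots> \<le> (SUP r\<in>{0<..t}. ennreal (r powr - s) * oscI P ?u r x)"
          using t by (intro SUP_upper) auto
        also have "\<dots> = vecS lebesgue s s P ?u x t"
          using t by (simp add: vecS_eq)
        finally have "ennreal e \<le> vecS lebesgue s s P ?u x t"
          by (simp add: e_def ennreal_mult)
        then have "epow (ennreal e) P \<le> epow (vecS lebesgue s s P ?u x t) P"
          using P by (intro epow_mono)
        then show ?thesis
          using True e by (simp add: epow_ennreal)
      qed simp
    qed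
    also have "\<dots> = epow (Lp_norm lebesgue (ennreal P) (\<lambda>x. vecS lebesgue s s P ?u x t)) P"
      using P by (simp add: Lp_norm_def)
    finally show ?thesis .
  qed
  \<comment> \<open>Starting at k = 3 keeps t above 4 on the whole interval (2^(k-1), 2^k]. Each
    octave then contributes C/2.\<close>
  define b where "b k = (if 3 \<le> k then ennreal (C / 2 powr real_of_int k) else 0)" for k :: int
  have "(\<integral>\<^sup>+k. b k * ennreal (2 powr (real_of_int k - 1)) \<partial>count_space UNIV)
      = (\<integral>\<^sup>+t. (\<integral>\<^sup>+k. b k * indicator (dyadic_interval k) t \<partial>count_space UNIV) \<partial>lborel)"
    by (rule nn_integral_dyadic_steps[symmetric])
  also have "\<dots> \<le> (\<integral>\<^sup>+t\<in>{0<..}. epow (Lp_norm lebesgue (ennreal P) (\<lambda>x. vecS lebesgue s s P ?u x t)) P * ennreal (1 / t) \<partial>lborel)"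
  proof (rule nn_integral_mono)
    fix t :: real
    show "(\<integral>\<^sup>+k. b k * indicator (dyadic_interval k) t \<partial>count_space UNIV)
        \<le> epow (Lp_norm lebesgue (ennreal P) (\<lambda>x. vecS lebesgue s s P ?u x t)) P * ennreal (1 / t) * indicator {0<..} t"
    proof (cases "0 < t")
      case True
      define k where "k = \<lceil>log 2 t\<rceil>"
      have "t \<in> dyadic_interval k"
        using True in_dyadic_interval_iff k_def by blast
      then have tk: "2 powr (real_of_int k - 1) < t" "t \<le> 2 powr real_of_int k"
        by auto
      have "b k \<le> epow (Lp_norm lebesgue (ennreal P) (\<lambda>x. vecS lebesgue s s P ?u x t)) P * ennreal (1 / t)"
      proof (cases "3 \<le> k")
        case k: True
        have "2 powr 2 \<le> (2 :: real) powr (real_of_int k - 1)"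
          using k by (intro powr_mono) auto
        then have "4 \<le> t" using tk(1) by simp
        have "b k = ennreal C * ennreal (1 / 2 powr real_of_int k)"
          using k C by (simp add: b_def flip: ennreal_mult)
        also have "\<dots> \<le> epow (Lp_norm lebesgue (ennreal P) (\<lambda>x. vecS lebesgue s s P ?u x t)) P * ennreal (1 / t)"
          using low[OF \<open>4 \<le> t\<close>] tk True by (intro mult_mono ennreal_leI) (auto simp: frac_le)
        finally show ?thesis .
      qed (simp add: b_def)
      then show ?thesis
        using nn_integral_dyadic_step[OF True, of b] True by (simp add: k_def)
    next
      case False
      have "t \<notin> dyadic_interval k" for k
        using False by (intro notin_dyadic_interval) simp
      then show ?thesis
        by (simp del: greaterThanAtMost_iff)
    qed
  qed
  also have "\<dots> < \<infinity>" by (rule fin)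
  finally have "(\<integral>\<^sup>+k. b k * ennreal (2 powr (real_of_int k - 1)) \<partial>count_space UNIV) < \<infinity>" .
  moreover have "(\<integral>\<^sup>+k. b k * ennreal (2 powr (real_of_int k - 1)) \<partial>count_space UNIV)
      = (\<integral>\<^sup>+k. ennreal (C / 2) * indicator {3 :: int..} k \<partial>count_space UNIV)"
  proof (rule nn_integral_cong)
    fix k :: int
    have "C / 2 powr real_of_int k * 2 powr (real_of_int k - 1) = C / 2"
      by (simp add: powr_diff)
    then have "ennreal (C / 2 powr real_of_int k) * ennreal (2 powr (real_of_int k - 1)) = ennreal (C / 2)"
      using C by (subst ennreal_mult[symmetric]) auto
    then show "b k * ennreal (2 powr (real_of_int k - 1)) = ennreal (C / 2) * indicator {3 :: int..} k"
      by (simp add: b_def)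
  qed
  moreover have "(\<integral>\<^sup>+k. ennreal (C / 2) * indicator {3 :: int..} k \<partial>count_space UNIV) = ennreal (C / 2) * emeasure (count_space UNIV) {3 :: int..}"
    by (rule nn_integral_cmult_indicator) simp
  moreover have "emeasure (count_space UNIV) {3 :: int..} = \<infinity>"
    by (simp add: emeasure_count_space infinite_Ici)
  ultimately show False
    using C by (simp add: ennreal_mult_top)
qed

text \<open>The exponent of the spike is squeezed between n/\<sigma>, above which local
  \<sigma>-integrability fails, and n/p - s, below which the Besov norm is finite; the hypothesis on
  s says that this interval is nonempty.\<close>

lemma Besov_not_in_Lp_loc:
  assumes "0 < p" "0 < \<sigma>" "0 < s" "s < 1" and s: "s < real CARD('n) / p - real CARD('n) / \<sigma>"
  obtains u :: "real ^ 'n \<Rightarrow> real" where "u \<notin> Lp_loc lebesgue (ennreal \<sigma>)"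
    "\<And>q. 0 < q \<Longrightarrow> u \<in> members (Besov lebesgue s (ennreal p) q)"
proof -
  obtain a where a: "real CARD('n) / \<sigma> < a" "a < real CARD('n) / p - s"
    using dense[of "real CARD('n) / \<sigma>" "real CARD('n) / p - s"] s by auto
  show ?thesis
  proof (rule that)
    show "(spike a :: real ^ 'n \<Rightarrow> real) \<notin> Lp_loc lebesgue (ennreal \<sigma>)"
      using a assms by (intro spike_not_in_Lp_loc) (simp_all add: pos_divide_less_eq)
    show "(spike a :: real ^ 'n \<Rightarrow> real) \<in> members (Besov lebesgue s (ennreal p) q)" if "0 < q" for q
      using a assms that by (intro spike_in_Besov) auto
  qed
qed

theorem theorem1p1:
  shows
   "(\<forall>(M :: 'a::metric_space measure) (C1::real) (n::real) (s::real) (p::ennreal) (q::ennreal).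
       doubling_metric_measure M C1 n \<and> 0 < s \<and> 0 < p \<and> 0 < q \<longrightarrow>
         (\<forall>\<sigma>::real. 0 < \<sigma> \<and> ennreal \<sigma> \<le> p \<longrightarrow>
            same_space (Besov M s p q) (CB M s \<sigma> p q)) \<and>
         (\<forall>\<sigma>::real. 0 < \<sigma> \<and> ennreal \<sigma> < p_star n s p \<longrightarrow>
            same_space (Besov M s p q) (IB M s \<sigma> p q)) \<and>
         (\<forall>(\<epsilon>::real) (\<sigma>::real). 0 \<le> \<epsilon> \<and> \<epsilon> < s \<and> 0 < \<sigma> \<and> ennreal \<sigma> < p_star n s p \<longrightarrow>
            same_space (Besov M s p q) (SB M s \<epsilon> \<sigma> p q)) \<and>
         (\<forall>\<sigma>::real. ennreal (n / (n + s)) < p \<and> 0 < \<sigma> \<and> ennreal \<sigma> < p_star n s p \<longrightarrow>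
            same_space (Besov M s p q) (AB M s \<sigma> p q)))
    \<and>
    (\<forall>(s::real) (p::real) (\<sigma>::real).
       0 < s \<and> s < 1 \<and> 0 < p \<and> p < real CARD('n) / s \<and>
       p_star (real CARD('n)) s (ennreal p) < ennreal \<sigma> \<longrightarrow>
       (\<exists>u :: real ^ 'n::finite \<Rightarrow> real. \<forall>q::ennreal. 0 < q \<longrightarrow>
          u \<in> members (Besov lebesgue s (ennreal p) q) \<and>
          u \<notin> Lp_loc lebesgue (ennreal \<sigma>) \<and>
          u \<notin> members (AB lebesgue s \<sigma> (ennreal p) q) \<and>
          u \<notin> members (IB lebesgue s \<sigma> (ennreal p) q) \<and>
          (\<forall>\<epsilon>::real. 0 \<le> \<epsilon> \<and> \<epsilon> \<le> s \<longrightarrow>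
             u \<notin> members (SB lebesgue s \<epsilon> \<sigma> (ennreal p) q))))
    \<and>
    (\<forall>(s::real) (p::real) (\<sigma>::real).
       0 < p \<and> p < \<sigma> \<and> 0 < s \<and> s < real CARD('n) / p - real CARD('n) / \<sigma> \<and> s < 1 \<longrightarrow>
       (\<exists>u :: real ^ 'n \<Rightarrow> real. \<forall>q::ennreal. 0 < q \<longrightarrow>
          u \<in> members (Besov lebesgue s (ennreal p) q) \<and>
          u \<notin> members (CB lebesgue s \<sigma> (ennreal p) q)))
    \<and>
    (\<forall>(s::real) (p::real). 0 < s \<and> s < 1 \<and> 0 < p \<longrightarrow>
       (\<exists>u :: real ^ 'n \<Rightarrow> real.
          u \<in> members (Besov lebesgue s (ennreal p) (ennreal p)) \<and>
          u \<notin> members (SB lebesgue s s p (ennreal p) (ennreal p))))"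
proof (intro conjI allI impI)
  fix M :: "'a measure" and C1 n s :: real and p q :: ennreal
  assume *: "doubling_metric_measure M C1 n \<and> 0 < s \<and> 0 < p \<and> 0 < q"
  then interpret doubling_metric_measure M C1 n by blast
  show "same_space (Besov M s p q) (CB M s \<sigma> p q)" if "0 < \<sigma> \<and> ennreal \<sigma> \<le> p" for \<sigma>
    using * that by (intro Besov_eq_CB) auto
  show "same_space (Besov M s p q) (IB M s \<sigma> p q)" if "0 < \<sigma> \<and> ennreal \<sigma> < p_star n s p" for \<sigma>
    using * that by (intro Besov_eq_IB) auto
  show "same_space (Besov M s p q) (SB M s \<epsilon> \<sigma> p q)"
    if "0 \<le> \<epsilon> \<and> \<epsilon> < s \<and> 0 < \<sigma> \<and> ennreal \<sigma> < p_star n s p" for \<epsilon> \<sigma>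
    using * that by (intro Besov_eq_SB) auto
  show "same_space (Besov M s p q) (AB M s \<sigma> p q)"
    if "ennreal (n / (n + s)) < p \<and> 0 < \<sigma> \<and> ennreal \<sigma> < p_star n s p" for \<sigma>
    using * that by (intro Besov_eq_AB) auto
next
  fix s p \<sigma> :: real
  assume *: "0 < s \<and> s < 1 \<and> 0 < p \<and> p < real CARD('n) / s \<and>
    p_star (real CARD('n)) s (ennreal p) < ennreal \<sigma>"
  then have sp: "0 < s" "s < 1" "0 < p" "p < real CARD('n) / s"
    "p_star (real CARD('n)) s (ennreal p) < ennreal \<sigma>"
    by auto
  then have pos: "0 < real CARD('n) - p * s"
    by (simp add: pos_less_divide_eq)
  have "ennreal p < ennreal (real CARD('n) / s)"
    using sp by (simp add: ennreal_less_iff)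
  then have "ennreal (real CARD('n) * p / (real CARD('n) - p * s)) < ennreal \<sigma>"
    using sp by (simp add: p_star_def)
  moreover have "0 < real CARD('n) * p / (real CARD('n) - p * s)"
    using sp pos by simp
  ultimately have "0 < real CARD('n) * p / (real CARD('n) - p * s)"
    "real CARD('n) * p / (real CARD('n) - p * s) < \<sigma>"
    by (simp_all add: ennreal_less_iff)
  then have \<sigma>: "0 < \<sigma>" "real CARD('n) * p < \<sigma> * (real CARD('n) - p * s)"
    using pos by (linarith, simp add: pos_divide_less_eq)
  \<comment> \<open>Division by p \<sigma> turns \<sigma> > p_*(s) into the nonempty interval that
    the spike requires.\<close>
  then have "s < real CARD('n) / p - real CARD('n) / \<sigma>"
    using sp by (simp add: field_simps)
  then obtain u :: "real ^ 'n \<Rightarrow> real" where u: "u \<notin> Lp_loc lebesgue (ennreal \<sigma>)"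
    "\<And>q. 0 < q \<Longrightarrow> u \<in> members (Besov lebesgue s (ennreal p) q)"
    by (rule Besov_not_in_Lp_loc[OF sp(3) \<sigma>(1) sp(1,2)]) (rule that)
  then show "\<exists>u :: real ^ 'n \<Rightarrow> real. \<forall>q::ennreal. 0 < q \<longrightarrow>
      u \<in> members (Besov lebesgue s (ennreal p) q) \<and>
      u \<notin> Lp_loc lebesgue (ennreal \<sigma>) \<and>
      u \<notin> members (AB lebesgue s \<sigma> (ennreal p) q) \<and>
      u \<notin> members (IB lebesgue s \<sigma> (ennreal p) q) \<and>
      (\<forall>\<epsilon>::real. 0 \<le> \<epsilon> \<and> \<epsilon> \<le> s \<longrightarrow> u \<notin> members (SB lebesgue s \<epsilon> \<sigma> (ennreal p) q))"
    by (intro exI[of _ u]) (simp add: AB_def IB_def SB_def vec_space_def)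
next
  fix s p \<sigma> :: real
  assume *: "0 < p \<and> p < \<sigma> \<and> 0 < s \<and> s < real CARD('n) / p - real CARD('n) / \<sigma> \<and> s < 1"
  then have sp: "0 < p" "0 < \<sigma>" "0 < s" "s < 1" "s < real CARD('n) / p - real CARD('n) / \<sigma>"
    by auto
  obtain u :: "real ^ 'n \<Rightarrow> real" where u: "u \<notin> Lp_loc lebesgue (ennreal \<sigma>)"
    "\<And>q. 0 < q \<Longrightarrow> u \<in> members (Besov lebesgue s (ennreal p) q)"
    by (rule Besov_not_in_Lp_loc[OF sp]) (rule that)
  then show "\<exists>u :: real ^ 'n \<Rightarrow> real. \<forall>q::ennreal. 0 < q \<longrightarrow>
      u \<in> members (Besov lebesgue s (ennreal p) q) \<and> u \<notin> members (CB lebesgue s \<sigma> (ennreal p) q)"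
    by (intro exI[of _ u]) (simp add: CB_def vec_space_def)
next
  fix s p :: real
  assume "0 < s \<and> s < 1 \<and> 0 < p"
  then show "\<exists>u :: real ^ 'n \<Rightarrow> real.
      u \<in> members (Besov lebesgue s (ennreal p) (ennreal p)) \<and>
      u \<notin> members (SB lebesgue s s p (ennreal p) (ennreal p))"
    using bump_in_Besov[of s p "ennreal p", where 'n='n] bump_not_in_SB[of p s, where 'n='n] by auto
qed

end
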